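(* There is an absolute constant $c>0$ and a randomized LOCAL algorithm with the following property. Let $\delta\in(0,1/2)$ be an arbitrary parameter. Let $H=(V,E)$ be a hypergraph of rank at most $r$ and maximum degree at most $\Delta$, given with a good coloring and an edge-weighting $a$. Then the algorithm runs in $\tilde O(\log\Delta+r\log\log\frac1\delta+(\log\log\frac1\delta)^2)$ rounds and outputs a matching $M$ of $H$ such that, with probability at least $1-\delta$, $a(M)\ge c\,a^*(H)/r$.
   Context: **Hypergraph notation.** For a hypergraph $H=(V,E)$: - $E$ may be a multiset. - $N(v)$ is the set of edges containing $v$, and $\deg(v)=|N(v)|$. - The rank is the maximum edge size. - A matching is a set of pairwise disjoint edges. **Weights.** An edge-weighting is a function $a:E\to[0,\infty)$, and $a(L)=\sum_{e\in L}a(e)$. **Fractional matchings.** A fractional matching is $h:E\to[0,1]$ with $\sum_{e\in N(v)}h(e)\le1$ for all $v$, and $a(h)=\sum_e a(e)h(e)$. Then $a^*(H)$ is the maximum of $a(h)$ over fractional matchings. **LOCAL model.** The model is run on the incidence graph $\mathrm{Inc}(H)$, the bipartite graph with a node for each vertex and each edge of $H$, where $v$ and $e$ are adjacent iff $v\in e$. - In synchronous rounds, nodes do unbounded computation and exchange unbounded messages with neighbours. - In the randomized variant, each node has private independent random bits. - Upper bounds $n,\Delta,r\ (r\ge2)$ on the number of vertices, maximum degree and rank are globally known. **Good coloring.** A good coloring of $H$ is a proper vertex coloring of $\mathrm{Inc}(H)^2$ (nodes adjacent iff at distance $\le2$ in $\mathrm{Inc}(H)$) with $\mathrm{poly}(r,\Delta)$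 colors. **Notation.** $\tilde O(x)=x\cdot\mathrm{polylog}(x)$. *)

theory Defs
  imports "HOL-Probability.Probability" "HOL-Library.Multiset"
begin

text \<open>A hypergraph is given by a finite vertex set V (of naturals), a finite set E of
edge indices (so that E may be a multiset of vertex sets) and a map ends assigning to
every edge index its (nonempty) set of vertices.\<close>

definition hypergraph :: "nat set \<Rightarrow> nat set \<Rightarrow> (nat \<Rightarrow> nat set) \<Rightarrow> bool" where
  "hypergraph V E ends \<longleftrightarrow> finite V \<and> finite E \<and> (\<forall>e\<in>E. ends e \<subseteq> V \<and> ends e \<noteq> {})"

definition hdeg :: "nat set \<Rightarrow> (nat \<Rightarrow> nat set) \<Rightarrow> nat \<Rightarrow> nat" where
  "hdeg E ends v = card {e \<in> E. v \<in> ends e}"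

definition is_matching :: "nat set \<Rightarrow> (nat \<Rightarrow> nat set) \<Rightarrow> nat set \<Rightarrow> bool" where
  "is_matching E ends M \<longleftrightarrow> M \<subseteq> E \<and>
     (\<forall>e\<in>M. \<forall>e'\<in>M. e \<noteq> e' \<longrightarrow> ends e \<inter> ends e' = {})"

definition frac_matching :: "nat set \<Rightarrow> nat set \<Rightarrow> (nat \<Rightarrow> nat set) \<Rightarrow> (nat \<Rightarrow> real) \<Rightarrow> bool" where
  "frac_matching V E ends h \<longleftrightarrow> (\<forall>e\<in>E. 0 \<le> h e \<and> h e \<le> 1) \<and>
     (\<forall>v\<in>V. (\<Sum>e\<in>{e\<in>E. v \<in> ends e}. h e) \<le> 1)"

text \<open>a^*(H): maximum weight of a fractional matching (the maximum exists; we write Sup).\<close>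
definition frac_opt :: "nat set \<Rightarrow> nat set \<Rightarrow> (nat \<Rightarrow> nat set) \<Rightarrow> (nat \<Rightarrow> real) \<Rightarrow> real" where
  "frac_opt V E ends a = Sup {(\<Sum>e\<in>E. a e * h e) | h. frac_matching V E ends h}"

definition inc_nodes :: "nat set \<Rightarrow> nat set \<Rightarrow> (nat + nat) set" where
  "inc_nodes V E = Inl ` V \<union> Inr ` E"

definition inc_adj :: "nat set \<Rightarrow> nat set \<Rightarrow> (nat \<Rightarrow> nat set) \<Rightarrow> nat + nat \<Rightarrow> nat + nat \<Rightarrow> bool" where
  "inc_adj V E ends x y \<longleftrightarrow>
     (\<exists>v e. v \<in> V \<and> e \<in> E \<and> v \<in> ends e \<and> ((x = Inl v \<and> y = Inr e) \<or> (x = Inr e \<and> y = Inl v)))"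

definition inc_nbrs :: "nat set \<Rightarrow> nat set \<Rightarrow> (nat \<Rightarrow> nat set) \<Rightarrow> nat + nat \<Rightarrow> (nat + nat) set" where
  "inc_nbrs V E ends x = {y \<in> inc_nodes V E. inc_adj V E ends x y}"

text \<open>A good coloring: proper coloring of Inc(H)^2 using colors from {0..<K}.
 The number of colors is poly(r,Delta); below K = (r + Delta)^d for an arbitrary fixed d.\<close>
definition good_coloring :: "nat set \<Rightarrow> nat set \<Rightarrow> (nat \<Rightarrow> nat set) \<Rightarrow> nat \<Rightarrow> (nat + nat \<Rightarrow> nat) \<Rightarrow> bool" where
  "good_coloring V E ends K col \<longleftrightarrow>
     (\<forall>x\<in>inc_nodes V E. col x < K) \<and>
     (\<forall>x\<in>inc_nodes V E. \<forall>y\<in>inc_nodes V E. x \<noteq> y \<longrightarrow>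
        (inc_adj V E ends x y \<or> (\<exists>z\<in>inc_nodes V E. inc_adj V E ends x z \<and> inc_adj V E ends z y))
        \<longrightarrow> col x \<noteq> col y)"

text \<open>The full information a node has after t rounds of the LOCAL model on Inc(H):
 its initial knowledge (whether it is an edge-node, its color, its weight (0 for vertex
 nodes), its private random bits) and, for t+1, its view after t rounds together with
 the multiset of views after t rounds of its neighbours.\<close>
datatype view = Base bool nat real "nat \<Rightarrow> bool" | Step view "view multiset"

fun local_view :: "nat set \<Rightarrow> nat set \<Rightarrow> (nat \<Rightarrow> nat set) \<Rightarrow> (nat \<Rightarrow> real) \<Rightarrow> (nat + nat \<Rightarrow> nat)
    \<Rightarrow> (nat + nat \<Rightarrow> nat \<Rightarrow> bool) \<Rightarrow> nat \<Rightarrow> nat + nat \<Rightarrow> view" where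
  "local_view V E ends a col \<omega> 0 x =
     Base (case x of Inl _ \<Rightarrow> False | Inr _ \<Rightarrow> True) (col x) (case x of Inl _ \<Rightarrow> 0 | Inr e \<Rightarrow> a e) (\<omega> x)"
| "local_view V E ends a col \<omega> (Suc t) x =
     Step (local_view V E ends a col \<omega> t x)
          (image_mset (local_view V E ends a col \<omega> t) (mset_set (inc_nbrs V E ends x)))"

definition alg_output :: "nat set \<Rightarrow> nat set \<Rightarrow> (nat \<Rightarrow> nat set) \<Rightarrow> (nat \<Rightarrow> real) \<Rightarrow> (nat + nat \<Rightarrow> nat)
    \<Rightarrow> (nat + nat \<Rightarrow> nat \<Rightarrow> bool) \<Rightarrow> nat \<Rightarrow> (view \<Rightarrow> bool) \<Rightarrow> nat set" where
  "alg_output V E ends a col \<omega> T D = {e \<in> E. D (local_view V E ends a col \<omega> T (Inr e))}"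

definition bits_M :: "(nat \<Rightarrow> bool) measure" where
  "bits_M = PiM UNIV (\<lambda>_::nat. measure_pmf (bernoulli_pmf (1/2)))"

definition rand_M :: "nat set \<Rightarrow> nat set \<Rightarrow> (nat + nat \<Rightarrow> nat \<Rightarrow> bool) measure" where
  "rand_M V E = PiM (inc_nodes V E) (\<lambda>_. bits_M)"

definition lg :: "real \<Rightarrow> real" where
  "lg y = max 1 (ln y)"

definition round_expr :: "nat \<Rightarrow> nat \<Rightarrow> real \<Rightarrow> real" where
  "round_expr \<Delta> r \<delta> = lg (real \<Delta>) + real r * lg (lg (1/\<delta>)) + (lg (lg (1/\<delta>)))^2"

end

(* Every edge e starts with the tiny fractional value 1/2^s and doubles it as long as its load, the
   sum of a f * y f over f = e and over the neighbours f, is below a e. After s rounds all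
   loads are at least a e, so y is a dual solution and the total A of a e * y e is at least a*(H)/r. The
   neighbours that stop no later than e contribute at most 2 * a e to the load of e at any time; hence the
   quadratic form Q(y), the sum over intersecting pairs of min (a e) (a f) * y e * y f, is at most 2 * A.

   Values below 1/K are rounded independently to 0 or 1/K, where K is of order r log(1/delta). A
   Chernoff bound for the total, and another one together with Markov's inequality for the edges that
   become overloaded (these are dropped), show that total and quadratic form survive up to constants
   with probability 1 - delta. Only log K levels are left, and they are rounded up deterministically one
   level at a time. In each step the pairs inside a colour class are ignored; the objective is then
   linear on every class and the classes can be processed one after the other, each edge following its
   derivative. The number of classes is of order log K and the pairs ignored make up a 1/log K fraction
   of Q, which costs only a constant factor over all levels. Such a colouring is obtained from the good
   colouring by two palette reductions with a code of large distance and a greedy recolouring, all of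
   it performed twice. At the end Q is less than the total by a constant factor, and from every
   intersecting pair the lighter edge is removed. *)
theory Submission
  imports Defs "HOL-Library.Log_Nat" "HOL-Analysis.Harmonic_Numbers"
begin

section \<open>Quantities computable in the LOCAL model\<close>

text \<open>Rounding all values deterministically would involve about log (r \<Delta>) levels, and
  the cost grows with the square of the number of levels; sampling cuts the levels to log K, about
  log r + log log (1/\<delta>). The factor r in K comes from concentration: a single edge may carry
  weight up to r * A, and a single neighbour may add up to r * a e to the load of e. To keep the
  loss constant over L levels, only a 1/L fraction of the pairs may be ignored per level, so about L
  classes are needed. Greedy recolouring with q colours takes about q^2 rounds, which for q = L
  means L^3 in all, more than the bound allows. Composing two colourings with about sqrt L colours
  each gives L classes for about L rounds per level, hence L^2 in all. Likewise a single palette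
  reduction would leave about log^2 (r + \<Delta>) greedy steps; the second one turns this logarithm
  into a log log. Of L^2 there remain (log r)^2, absorbed by a summand r of the bound, and (log log
  (1/\<delta>))^2.\<close>

record inst =
  verts :: "nat set"
  edges :: "nat set"
  ends :: "nat \<Rightarrow> nat set"
  wt :: "nat \<Rightarrow> real"
  col :: "nat + nat \<Rightarrow> nat"
  rnd :: "nat + nat \<Rightarrow> nat \<Rightarrow> bool"

definition wf_inst :: "inst \<Rightarrow> bool" where
  "wf_inst I \<longleftrightarrow> hypergraph (verts I) (edges I) (ends I)"

definition inst_view :: "inst \<Rightarrow> nat \<Rightarrow> nat + nat \<Rightarrow> view" where
  "inst_view I = local_view (verts I) (edges I) (ends I) (wt I) (col I) (rnd I)"

text \<open>One \<open>g\<close> serves all instances, so it is a rule that can be fixed in advance.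
  The type \<open>'b\<close> may be a function type; a node then knows a whole table of
  values.\<close>

definition edge_local :: "nat \<Rightarrow> (inst \<Rightarrow> nat \<Rightarrow> 'b) \<Rightarrow> bool" where
  "edge_local t F \<longleftrightarrow> (\<exists>g. \<forall>I e. wf_inst I \<longrightarrow> e \<in> edges I \<longrightarrow> F I e = g (inst_view I t (Inr e)))"

text \<open>Common vertices are counted with multiplicity: the nodes are anonymous, so an edge cannot
  tell whether neighbours reached through two of its vertices are the same edge.\<close>

definition overlap :: "inst \<Rightarrow> nat \<Rightarrow> nat \<Rightarrow> real" where
  "overlap I e f = (if e = f then 0 else real (card (ends I e \<inter> ends I f)))"

lemma edge_localI:
  assumes "\<And>I e. wf_inst I \<Longrightarrow> e \<in> edges I \<Longrightarrow> F I e = g (inst_view I t (Inr e))"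
  shows "edge_local t F"
  using assms unfolding edge_local_def by blast

lemma edge_localE:
  assumes "edge_local t F"
  obtains g where "\<And>I e. wf_inst I \<Longrightarrow> e \<in> edges I \<Longrightarrow> F I e = g (inst_view I t (Inr e))"
  using assms unfolding edge_local_def by blast

lemma edge_local_const: "edge_local t (\<lambda>I e. c)"
  by (rule edge_localI[where g="\<lambda>_. c"]) simp

lemma edge_local_map:
  assumes "edge_local t F"
  shows "edge_local t (\<lambda>I e. h (F I e))"
proof -
  from assms obtain g where "\<And>I e. wf_inst I \<Longrightarrow> e \<in> edges I \<Longrightarrow> F I e = g (inst_view I t (Inr e))"
    by (rule edge_localE) blast
  then show ?thesis by (intro edge_localI[where g="\<lambda>v. h (g v)"]) simp
qed

lemma edge_local_map2:
  assumes "edge_local t F" "edge_local t G"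
  shows "edge_local t (\<lambda>I e. h (F I e) (G I e))"
proof -
  from assms(1) obtain f where f: "\<And>I e. wf_inst I \<Longrightarrow> e \<in> edges I \<Longrightarrow> F I e = f (inst_view I t (Inr e))"
    by (rule edge_localE) blast
  from assms(2) obtain g where g: "\<And>I e. wf_inst I \<Longrightarrow> e \<in> edges I \<Longrightarrow> G I e = g (inst_view I t (Inr e))"
    by (rule edge_localE) blast
  show ?thesis by (rule edge_localI[where g="\<lambda>v. h (f v) (g v)"]) (simp add: f g)
qed

lemma edge_local_Pair:
  "edge_local t F \<Longrightarrow> edge_local t G \<Longrightarrow> edge_local t (\<lambda>I e. (F I e, G I e))"
  by (rule edge_local_map2)

lemma edge_local_Suc:
  assumes "edge_local t F"
  shows "edge_local (Suc t) F"
proof -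
  from assms obtain g where g: "\<And>I e. wf_inst I \<Longrightarrow> e \<in> edges I \<Longrightarrow> F I e = g (inst_view I t (Inr e))"
    by (rule edge_localE) blast
  show ?thesis
    by (rule edge_localI[where g="\<lambda>v. case v of Step w M \<Rightarrow> g w"]) (simp add: g inst_view_def)
qed

lemma edge_local_mono:
  assumes "edge_local t F" "t \<le> t'"
  shows "edge_local t' F"
  using assms(2,1) by (induction rule: dec_induct) (auto intro: edge_local_Suc)

lemma edge_local_cong:
  assumes "edge_local t F" "t \<le> t'" "\<And>I e. wf_inst I \<Longrightarrow> e \<in> edges I \<Longrightarrow> G I e = F I e"
  shows "edge_local t' G"
proof -
  from edge_local_mono[OF assms(1,2)] obtain g
    where g: "\<And>I e. wf_inst I \<Longrightarrow> e \<in> edges I \<Longrightarrow> F I e = g (inst_view I t' (Inr e))"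
    by (rule edge_localE) blast
  show ?thesis by (rule edge_localI[where g=g]) (simp add: assms(3) g)
qed

lemma edge_local_wt: "edge_local 0 wt"
  by (rule edge_localI[where g="\<lambda>v. case v of Base b c w r \<Rightarrow> w"]) (simp add: inst_view_def)

lemma edge_local_col: "edge_local 0 (\<lambda>I e. col I (Inr e))"
  by (rule edge_localI[where g="\<lambda>v. case v of Base b c w r \<Rightarrow> c"]) (simp add: inst_view_def)

lemma edge_local_rnd: "edge_local 0 (\<lambda>I e. rnd I (Inr e))"
  by (rule edge_localI[where g="\<lambda>v. case v of Base b c w r \<Rightarrow> r"]) (simp add: inst_view_def)

lemma inc_nbrs_edge:
  assumes "hypergraph V E nd" "e \<in> E"
  shows "inc_nbrs V E nd (Inr e) = Inl ` nd e"
  using assms by (auto simp: inc_nbrs_def inc_adj_def inc_nodes_def hypergraph_def)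

lemma inc_nbrs_vertex:
  assumes "hypergraph V E nd" "v \<in> V"
  shows "inc_nbrs V E nd (Inl v) = Inr ` {f \<in> E. v \<in> nd f}"
  using assms by (auto simp: inc_nbrs_def inc_adj_def inc_nodes_def hypergraph_def)

definition edges_at :: "inst \<Rightarrow> nat \<Rightarrow> nat set" where
  "edges_at I v = {f \<in> edges I. v \<in> ends I f}"

lemma wf_instD:
  assumes "wf_inst I"
  shows "finite (verts I)" "finite (edges I)" "finite (edges_at I v)"
    "e \<in> edges I \<Longrightarrow> ends I e \<subseteq> verts I" "e \<in> edges I \<Longrightarrow> finite (ends I e)"
    "e \<in> edges I \<Longrightarrow> ends I e \<noteq> {}"
  using assms by (auto simp: wf_inst_def hypergraph_def edges_at_def intro: finite_subset)

lemma view_edge: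
  assumes "wf_inst I" "e \<in> edges I"
  shows "inst_view I (Suc t) (Inr e) = Step (inst_view I t (Inr e))
           {# inst_view I t (Inl v). v \<in># mset_set (ends I e) #}"
  using assms
  by (simp add: inst_view_def wf_inst_def inc_nbrs_edge image_mset_mset_set[symmetric] inj_on_def
      multiset.map_comp o_def)

lemma view_vertex:
  assumes "wf_inst I" "v \<in> verts I"
  shows "inst_view I (Suc t) (Inl v) = Step (inst_view I t (Inl v))
           {# inst_view I t (Inr f). f \<in># mset_set (edges_at I v) #}"
  using assms
  by (simp add: inst_view_def wf_inst_def inc_nbrs_vertex image_mset_mset_set[symmetric] inj_on_def
      multiset.map_comp o_def edges_at_def)

text \<open>Double counting of the pairs of a vertex of \<open>e\<close> and another edge at that
  vertex. The right side is what the vertices can relay, and it dictates the multiplicity in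
  \<open>overlap\<close>.\<close>

lemma sum_overlap:
  assumes wf: "wf_inst I" and e: "e \<in> edges I"
  shows "(\<Sum>f\<in>edges I. overlap I e f * G f) = (\<Sum>v\<in>ends I e. \<Sum>f\<in>edges_at I v - {e}. G f)"
proof -
  note fin = wf_instD(2)[OF wf] wf_instD(5)[OF wf]
  have "(\<Sum>v\<in>ends I e. \<Sum>f\<in>edges_at I v - {e}. G f)
      = (\<Sum>v\<in>ends I e. \<Sum>f\<in>edges I. if v \<in> ends I f \<and> f \<noteq> e then G f else 0)"
    by (intro sum.cong refl sum.mono_neutral_cong_left) (auto simp: edges_at_def fin)
  also have "\<dots> = (\<Sum>f\<in>edges I. \<Sum>v\<in>ends I e. if v \<in> ends I f \<and> f \<noteq> e then G f else 0)"
    by (rule sum.swap)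
  also have "\<dots> = (\<Sum>f\<in>edges I. overlap I e f * G f)"
  proof (intro sum.cong refl)
    fix f assume "f \<in> edges I"
    have "(\<Sum>v\<in>ends I e. if v \<in> ends I f \<and> f \<noteq> e then G f else 0)
        = (\<Sum>v\<in>ends I e \<inter> ends I f. if f \<noteq> e then G f else 0)"
      using e fin by (intro sum.mono_neutral_cong_right) auto
    then show "(\<Sum>v\<in>ends I e. if v \<in> ends I f \<and> f \<noteq> e then G f else 0) = overlap I e f * G f"
      by (auto simp: overlap_def)
  qed
  finally show ?thesis by simp
qed

text \<open>A vertex forwards the multiset of states it receives; removing one copy of its own state,
  an edge recovers the states of the other edges at that vertex without any identifiers.\<close>

lemma edge_local_overlap_sum:
  fixes K :: "'c \<Rightarrow> 'b \<Rightarrow> 'b \<Rightarrow> real"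
  assumes "edge_local t P"
  shows "edge_local (t + 2) (\<lambda>I e c. \<Sum>f\<in>edges I. overlap I e f * K c (P I e) (P I f))"
proof -
  from assms obtain g where g: "\<And>I e. wf_inst I \<Longrightarrow> e \<in> edges I \<Longrightarrow> P I e = g (inst_view I t (Inr e))"
    by (rule edge_localE) blast
  define at_vertex where "at_vertex = (\<lambda>c w m. case m of Step _ M' \<Rightarrow>
      (\<Sum>s\<in>#image_mset g M' - {#g w#}. K c (g w) s))"
  \<comment> \<open>The own view after \<open>t\<close> rounds lies two levels deep in the view
    after \<open>t + 2\<close> rounds. It is the one that the vertices received, so its state is the
    copy to be removed.\<close>
  define G where "G = (\<lambda>u. case u of Step u' M \<Rightarrow> (case u' of Step w _ \<Rightarrow>
       (\<lambda>c. \<Sum>m\<in>#M. at_vertex c w m)))"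
  show ?thesis
  proof (rule edge_localI[where g=G])
    fix I e assume wf: "wf_inst I" and e: "e \<in> edges I"
    have V: "ends I e \<subseteq> verts I" using wf_instD(4)[OF wf e] .
    have step: "at_vertex c (inst_view I t (Inr e)) (inst_view I (Suc t) (Inl v))
        = (\<Sum>f\<in>edges_at I v - {e}. K c (P I e) (P I f))" if v: "v \<in> ends I e" for v c
    proof -
      have e_at: "e \<in> edges_at I v" using v e by (simp add: edges_at_def)
      have img: "image_mset g {# inst_view I t (Inr f). f \<in># mset_set (edges_at I v) #}
          = image_mset (P I) (mset_set (edges_at I v))"
        unfolding multiset.map_comp o_def
        using wf_instD(3)[OF wf, of v] g[OF wf] by (intro image_mset_cong) (auto simp: edges_at_def)
      have spl: "mset_set (edges_at I v) = add_mset e (mset_set (edges_at I v - {e}))"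
        using e_at wf_instD(3)[OF wf] by (simp add: mset_set.remove)
      show ?thesis
        unfolding view_vertex[OF wf subsetD[OF V v]] at_vertex_def view.case img
        unfolding spl by (simp add: g[OF wf e, symmetric] sum_unfold_sum_mset multiset.map_comp o_def)
    qed
    \<comment> \<open>The exchanged states do not depend on \<open>c\<close>: the same two rounds
      yield the sums for all \<open>c\<close>, so an edge can compare all candidate colours at
      once.\<close>
    show "(\<lambda>c. \<Sum>f\<in>edges I. overlap I e f * K c (P I e) (P I f)) = G (inst_view I (t + 2) (Inr e))"
    proof
      fix c
      have "G (inst_view I (t + 2) (Inr e)) c
        = (\<Sum>v\<in>ends I e. at_vertex c (inst_view I t (Inr e)) (inst_view I (Suc t) (Inl v)))"
        by (simp add: G_def view_edge[OF wf e] sum_unfold_sum_mset multiset.map_comp o_def)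
      also have "\<dots> = (\<Sum>v\<in>ends I e. \<Sum>f\<in>edges_at I v - {e}. K c (P I e) (P I f))"
        by (intro sum.cong refl step)
      finally show "(\<Sum>f\<in>edges I. overlap I e f * K c (P I e) (P I f)) = G (inst_view I (t + 2) (Inr e)) c"
        by (simp add: sum_overlap[OF wf e])
    qed
  qed
qed

section \<open>Colourings with few monochromatic pairs\<close>

text \<open>An error-correcting code: the word of \<open>u\<close> is \<lambda>t.
  \<open>h t u\<close>, of length \<open>k * j\<close>, and different words agree in less than a 1/k
  fraction of the places. Hence a random place, used as a hash function, merges two given colours
  with probability below 1/k.\<close>

definition separating :: "nat \<Rightarrow> nat \<Rightarrow> (nat \<Rightarrow> nat \<Rightarrow> nat) \<Rightarrow> bool" where
  "separating k j h \<longleftrightarrow> (\<forall>t<k*j. \<forall>u<2^j. h t u < 2*k*j) \<and>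
     (\<forall>u<2^j. \<forall>v<2^j. u \<noteq> v \<longrightarrow> card {t. t < k*j \<and> h t u = h t v} < j)"

text \<open>Union bound over the \<open>j\<close>-sets \<open>J\<close> of places of agreement; each
  of them leaves \<open>s - j\<close> letters free.\<close>

lemma card_agree_le:
  fixes s j q :: nat and u :: "nat \<Rightarrow> nat"
  assumes "j \<le> s"
  shows "card {w \<in> {..<s} \<rightarrow>\<^sub>E {..<q}. j \<le> card {t. t < s \<and> w t = u t}} \<le> s ^ j * q ^ (s - j)"
proof -
  let ?W = "{..<s} \<rightarrow>\<^sub>E {..<q}"
  let ?J = "{J. J \<subseteq> {..<s} \<and> card J = j}"
  let ?A = "\<lambda>J. {w \<in> ?W. \<forall>t\<in>J. w t = u t}"
  have finW: "finite ?W" by (intro finite_PiE) auto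
  have sub: "{w \<in> ?W. j \<le> card {t. t < s \<and> w t = u t}} \<subseteq> (\<Union>J\<in>?J. ?A J)"
  proof
    fix w assume w: "w \<in> {w \<in> ?W. j \<le> card {t. t < s \<and> w t = u t}}"
    then obtain J where "J \<subseteq> {t. t < s \<and> w t = u t}" "card J = j"
      using obtain_subset_with_card_n by (metis (no_types, lifting) mem_Collect_eq)
    then show "w \<in> (\<Union>J\<in>?J. ?A J)" using w by auto
  qed
  have A: "card (?A J) \<le> q ^ (s - j)" if "J \<in> ?J" for J
  proof -
    have J: "J \<subseteq> {..<s}" "card J = j" using that by auto
    let ?r = "\<lambda>w. restrict w ({..<s} - J)"
    have inj: "inj_on ?r (?A J)"
    proof (rule inj_onI)
      fix x y assume x: "x \<in> ?A J" and y: "y \<in> ?A J" and eq: "?r x = ?r y"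
      show "x = y"
      proof
        fix t
        consider "t \<in> J" | "t \<in> {..<s} - J" | "t \<notin> {..<s}" using J by blast
        then show "x t = y t"
        proof cases
          case 2
          then show ?thesis using fun_cong[OF eq, of t] by (simp add: restrict_apply)
        next
          case 3
          then show ?thesis using x y by (auto simp: PiE_def extensional_def)
        qed (use x y in auto)
      qed
    qed
    have "card (?A J) \<le> card (({..<s} - J) \<rightarrow>\<^sub>E {..<q})"
      by (rule card_inj_on_le[OF inj]) (auto intro!: finite_PiE)
    also have "\<dots> = q ^ (s - j)"
      using J by (subst card_PiE) (auto simp: card_Diff_subset finite_subset)
    finally show ?thesis .
  qed
  have finJ: "finite ?J" by (rule finite_subset[of _ "Pow {..<s}"]) auto
  have "card {w \<in> ?W. j \<le> card {t. t < s \<and> w t = u t}} \<le> card (\<Union>J\<in>?J. ?A J)"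
    by (rule card_mono[OF _ sub]) (use finJ finW in auto)
  also have "\<dots> \<le> (\<Sum>J\<in>?J. card (?A J))" by (rule card_UN_le[OF finJ])
  also have "\<dots> \<le> card ?J * q ^ (s - j)" using sum_bounded_above[of ?J "\<lambda>J. card (?A J)"] A by auto
  also have "card ?J = s choose j" using n_subsets[of "{..<s}" j] by simp
  also have "(s choose j) * q ^ (s - j) \<le> s ^ j * q ^ (s - j)"
    using binomial_le_pow[OF assms] by simp
  finally show ?thesis .
qed

text \<open>Greedy (Gilbert--Varshamov) choice of code words: as long as fewer than \<open>2 ^ j\<close> words are
  chosen, the words agreeing in \<open>j\<close> places with a chosen one do not exhaust all words.\<close>

lemma separating_exists:
  assumes k: "k \<ge> 1" and j: "j \<ge> 1"
  shows "\<exists>h. separating k j h"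
proof -
  define s where "s = k * j"
  define q where "q = 2 * s"
  let ?W = "{..<s} \<rightarrow>\<^sub>E {..<q}"
  have js: "j \<le> s" and s0: "s > 0" using k j by (auto simp: s_def)
  have "N \<le> 2 ^ j \<Longrightarrow> \<exists>g. (\<forall>u<N. g u \<in> ?W) \<and>
      (\<forall>u<N. \<forall>v<N. u \<noteq> v \<longrightarrow> card {t. t < s \<and> g u t = g v t} < j)" for N :: nat
  proof (induction N)
    case (Suc N)
    then obtain g where gW: "\<forall>u<N. g u \<in> ?W"
      and g: "\<forall>u<N. \<forall>v<N. u \<noteq> v \<longrightarrow> card {t. t < s \<and> g u t = g v t} < j" by auto
    let ?B = "\<lambda>u. {w \<in> ?W. j \<le> card {t. t < s \<and> w t = g u t}}"
    have "card (\<Union>u\<in>{..<N}. ?B u) \<le> (\<Sum>u<N. card (?B u))" by (rule card_UN_le) auto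
    also have "\<dots> \<le> (\<Sum>u<N. s ^ j * q ^ (s - j))" by (intro sum_mono card_agree_le js)
    also have "\<dots> = N * (s ^ j * q ^ (s - j))" by simp
    \<comment> \<open>The alphabet size q = 2 s is made for this count:
      \<open>2 ^ j * s ^ j = q ^ j\<close>, so it would take at least \<open>2 ^ j\<close> such
      balls to fill the space.\<close>
    also have "\<dots> < 2 ^ j * (s ^ j * q ^ (s - j))" using Suc.prems s0 by (simp add: q_def)
    also have "\<dots> = q ^ (j + (s - j))"
      by (simp only: power_add q_def power_mult_distrib mult.assoc)
    also have "\<dots> = card ?W" using js by (simp add: card_PiE)
    finally have lt: "card (\<Union>u\<in>{..<N}. ?B u) < card ?W" .
    have "\<not> ?W \<subseteq> (\<Union>u\<in>{..<N}. ?B u)"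
    proof
      assume "?W \<subseteq> (\<Union>u\<in>{..<N}. ?B u)"
      then have "card ?W \<le> card (\<Union>u\<in>{..<N}. ?B u)"
        by (intro card_mono) (simp_all add: finite_PiE)
      then show False using lt by simp
    qed
    moreover have "\<exists>w. w \<in> A \<and> w \<notin> B" if "\<not> A \<subseteq> B" for A B :: "(nat \<Rightarrow> nat) set"
      using that by blast
    ultimately obtain w where w: "w \<in> ?W" "w \<notin> (\<Union>u\<in>{..<N}. ?B u)" by meson
    then have w1: "\<forall>u<N. card {t. t < s \<and> w t = g u t} < j" by (simp add: not_le[symmetric])
    then have w2: "\<forall>u<N. card {t. t < s \<and> g u t = w t} < j" by (simp add: eq_commute)
    show ?case
    proof (intro exI[of _ "g(N := w)"] conjI allI impI)
      fix u v assume "u < Suc N" "v < Suc N" "u \<noteq> v"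
      then consider "u < N" "v < N" | "u = N" "v < N" | "u < N" "v = N" by linarith
      then show "card {t. t < s \<and> (g(N := w)) u t = (g(N := w)) v t} < j"
        by cases (use g w1 w2 \<open>u \<noteq> v\<close> in simp_all)
    next
      fix u assume "u < Suc N"
      then show "(g(N := w)) u \<in> ?W" using gW w(1) by (cases "u = N") simp_all
    qed
  qed simp
  from this[of "2 ^ j"] obtain g :: "nat \<Rightarrow> nat \<Rightarrow> nat" where gW: "\<forall>u<2^j. g u \<in> ?W"
      and g: "\<forall>u<2^j. \<forall>v<2^j. u \<noteq> v \<longrightarrow> card {t. t < s \<and> g u t = g v t} < j" by auto
  have "separating k j (\<lambda>t u. g u t)"
    unfolding separating_def using gW g
    by (auto simp: s_def[symmetric] q_def PiE_def Pi_def mult.assoc)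
  then show ?thesis by blast
qed

text \<open>The choice depends on \<open>k\<close> and \<open>j\<close> only, so all nodes use the
  same code without communicating.\<close>

definition hash :: "nat \<Rightarrow> nat \<Rightarrow> nat \<Rightarrow> nat \<Rightarrow> nat" where
  "hash k j = (SOME h. separating k j h)"

lemma separating_hash: "k \<ge> 1 \<Longrightarrow> j \<ge> 1 \<Longrightarrow> separating k j (hash k j)"
  unfolding hash_def by (rule someI_ex[OF separating_exists])

section \<open>Palette reduction by averaging\<close>

definition pick :: "nat \<Rightarrow> (nat \<Rightarrow> real) \<Rightarrow> nat" where
  "pick k g = (SOME c. c < k \<and> real k * g c \<le> (\<Sum>i<k. g i))"

lemma pick:
  assumes "k > 0"
  shows "pick k g < k" "real k * g (pick k g) \<le> (\<Sum>i<k. g i)"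
proof -
  have "\<exists>c<k. real k * g c \<le> (\<Sum>i<k. g i)"
  proof (rule ccontr)
    assume "\<not> ?thesis"
    then have "(\<Sum>c<k. \<Sum>i<k. g i) < (\<Sum>c<k. real k * g c)"
      using assms by (intro sum_strict_mono) (auto simp: not_le)
    then show False by (simp add: sum_distrib_left)
  qed
  then have "pick k g < k \<and> real k * g (pick k g) \<le> (\<Sum>i<k. g i)"
    unfolding pick_def by (rule someI_ex)
  then show "pick k g < k" "real k * g (pick k g) \<le> (\<Sum>i<k. g i)" by auto
qed

definition hash_col ::
  "nat set \<Rightarrow> (nat \<Rightarrow> nat \<Rightarrow> real) \<Rightarrow> nat \<Rightarrow> nat \<Rightarrow> (nat \<Rightarrow> nat) \<Rightarrow> nat \<Rightarrow> nat" where
  "hash_col E W k j \<phi> e =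
     (let t = pick (k*j) (\<lambda>t. \<Sum>f\<in>E. W e f * of_bool (hash k j t (\<phi> f) = hash k j t (\<phi> e)))
      in t * (2*k*j) + hash k j t (\<phi> e))"

text \<open>Every edge selects its own place \<open>t\<close>, but \<open>t\<close> is part of the
  new colour, so a collision with \<open>e\<close> forces the other edge to have used the same
  place. The bound therefore involves only the choice of \<open>e\<close>, which is no worse than
  the average over all places: pairs with different old colours contribute a 1/k fraction to that
  average, pairs with equal old colours their full weight.\<close>

lemma hash_col:
  assumes W: "\<And>f. f \<in> E \<Longrightarrow> W e f \<ge> 0" and k: "k \<ge> 1" and j: "j \<ge> 1"
    and \<phi>: "\<And>e. e \<in> E \<Longrightarrow> \<phi> e < 2 ^ j" and e: "e \<in> E"
  defines "\<psi> \<equiv> hash_col E W k j \<phi>"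
  shows "\<psi> e < k*j*(2*k*j)"
    and "real k * (\<Sum>f\<in>E. W e f * of_bool (\<psi> f = \<psi> e))
           \<le> (\<Sum>f\<in>E. W e f) + real k * (\<Sum>f\<in>E. W e f * of_bool (\<phi> f = \<phi> e))"
proof -
  define h where "h = hash k j"
  define q where "q = 2*k*j"
  define cost where "cost = (\<lambda>e t. \<Sum>f\<in>E. W e f * of_bool (h t (\<phi> f) = h t (\<phi> e)))"
  define T where "T = (\<lambda>e. pick (k*j) (cost e))"
  have kj: "k * j > 0" using k j by simp
  have q0: "q > 0" using k j by (simp add: q_def)
  have sep: "separating k j h" unfolding h_def using k j by (rule separating_hash)
  have hq: "h t (\<phi> f) < q" if "t < k*j" "f \<in> E" for t f
    using sep \<phi>[OF that(2)] that(1) by (simp add: separating_def q_def)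
  have T: "T f < k*j" for f unfolding T_def by (rule pick(1)[OF kj])
  have \<psi>: "\<psi> f = T f * q + h (T f) (\<phi> f)" for f
    by (simp add: \<psi>_def hash_col_def T_def cost_def h_def q_def Let_def)
  have "\<psi> e < Suc (T e) * q" using hq[OF T e] by (simp add: \<psi>)
  also have "\<dots> \<le> (k*j) * q" using T[of e] by (intro mult_le_mono1) simp
  finally show "\<psi> e < k*j*(2*k*j)" by (simp add: q_def)
  have dec: "T f = T e \<and> h (T e) (\<phi> f) = h (T e) (\<phi> e)" if "f \<in> E" "\<psi> f = \<psi> e" for f
  proof -
    have "\<psi> f div q = T f" "\<psi> e div q = T e"
      using hq[OF T that(1), of f] hq[OF T e, of e] q0 by (simp_all add: \<psi>)
    then show ?thesis using that(2) by (simp add: \<psi>)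
  qed
  have mono: "(\<Sum>f\<in>E. W e f * of_bool (\<psi> f = \<psi> e)) \<le> cost e (T e)"
    unfolding cost_def using dec W by (intro sum_mono mult_left_mono) auto
  have "real (k*j) * cost e (T e) \<le> (\<Sum>t<k*j. cost e t)"
    unfolding T_def by (rule pick(2)[OF kj])
  also have "\<dots> = (\<Sum>f\<in>E. W e f * (\<Sum>t<k*j. of_bool (h t (\<phi> f) = h t (\<phi> e))))"
    unfolding cost_def by (subst sum.swap) (simp add: sum_distrib_left mult.commute)
  also have "\<dots> \<le> (\<Sum>f\<in>E. W e f * (real j + real (k*j) * of_bool (\<phi> f = \<phi> e)))"
  proof (intro sum_mono mult_left_mono W)
    fix f assume f: "f \<in> E"
    show "(\<Sum>t<k*j. of_bool (h t (\<phi> f) = h t (\<phi> e))) \<le> real j + real (k*j) * of_bool (\<phi> f = \<phi> e)"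
    proof (cases "\<phi> f = \<phi> e")
      case False
      have "(\<Sum>t<k*j. of_bool (h t (\<phi> f) = h t (\<phi> e)) :: real)
          = real (card {t. t < k*j \<and> h t (\<phi> f) = h t (\<phi> e)})"
        by (simp add: of_bool_def sum.If_cases Int_def)
      also have "card {t. t < k*j \<and> h t (\<phi> f) = h t (\<phi> e)} < j"
        using sep \<phi>[OF f] \<phi>[OF e] False by (simp add: separating_def)
      finally show ?thesis using False by simp
    qed simp
  qed auto
  also have "\<dots> = real j * ((\<Sum>f\<in>E. W e f) + real k * (\<Sum>f\<in>E. W e f * of_bool (\<phi> f = \<phi> e)))"
    by (simp add: algebra_simps sum.distrib sum_distrib_left)
  finally have "real j * (real k * cost e (T e))
      \<le> real j * ((\<Sum>f\<in>E. W e f) + real k * (\<Sum>f\<in>E. W e f * of_bool (\<phi> f = \<phi> e)))"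
    by (simp add: mult_ac)
  then have "real k * cost e (T e)
      \<le> (\<Sum>f\<in>E. W e f) + real k * (\<Sum>f\<in>E. W e f * of_bool (\<phi> f = \<phi> e))"
    using j by simp
  moreover have "real k * (\<Sum>f\<in>E. W e f * of_bool (\<psi> f = \<psi> e)) \<le> real k * cost e (T e)"
    using mono by (intro mult_left_mono) auto
  ultimately show "real k * (\<Sum>f\<in>E. W e f * of_bool (\<psi> f = \<psi> e))
           \<le> (\<Sum>f\<in>E. W e f) + real k * (\<Sum>f\<in>E. W e f * of_bool (\<phi> f = \<phi> e))" by linarith
qed

section \<open>Greedy recolouring\<close>

primrec greedy_col ::
  "nat set \<Rightarrow> (nat \<Rightarrow> nat \<Rightarrow> real) \<Rightarrow> nat \<Rightarrow> (nat \<Rightarrow> nat) \<Rightarrow> nat \<Rightarrow> nat \<Rightarrow> nat" where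
  "greedy_col E W k \<phi> 0 = (\<lambda>e. 0)"
| "greedy_col E W k \<phi> (Suc i) = (\<lambda>e. if \<phi> e = i
     then pick k (\<lambda>c. \<Sum>f\<in>E. W e f * of_bool (\<phi> f < i \<and> greedy_col E W k \<phi> i f = c))
     else greedy_col E W k \<phi> i e)"

lemma greedy_col_less: "k > 0 \<Longrightarrow> greedy_col E W k \<phi> i e < k"
  by (induction i) (auto intro: pick(1))

lemma greedy_col_stable: "\<phi> e < i \<Longrightarrow> i \<le> i' \<Longrightarrow> greedy_col E W k \<phi> i' e = greedy_col E W k \<phi> i e"
  by (induction i' rule: nat_induct) (auto simp: le_Suc_eq)

text \<open>When \<open>e\<close> chooses, all edges with smaller \<open>\<phi>\<close> have their
  final colours, and \<open>e\<close> chooses no worse than the average of \<open>k\<close> colours.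
  The initial colour 0 is only a placeholder; the test \<open>\<phi> f < i\<close> keeps it out of
  the sums.\<close>

lemma greedy_col_back:
  fixes E :: "nat set" and W :: "nat \<Rightarrow> nat \<Rightarrow> real"
  assumes k: "k > 0" and N: "\<phi> e < N"
  defines "c \<equiv> greedy_col E W k \<phi> N"
  shows "real k * (\<Sum>f\<in>E. W e f * of_bool (\<phi> f < \<phi> e \<and> c f = c e))
           \<le> (\<Sum>f\<in>E. W e f * of_bool (\<phi> f < \<phi> e))"
proof -
  define g where "g = (\<lambda>b. \<Sum>f\<in>E. W e f * of_bool (\<phi> f < \<phi> e \<and> greedy_col E W k \<phi> (\<phi> e) f = b))"
  have ce: "c e = pick k g"
    unfolding c_def g_def using greedy_col_stable[of \<phi> e "Suc (\<phi> e)" N E W k] N by simp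
  have "c f = greedy_col E W k \<phi> (\<phi> e) f" if "\<phi> f < \<phi> e" for f
    unfolding c_def using greedy_col_stable[of \<phi> f "\<phi> e" N E W k] that N by simp
  then have "(\<Sum>f\<in>E. W e f * of_bool (\<phi> f < \<phi> e \<and> c f = c e)) = g (c e)"
    unfolding g_def by (intro sum.cong refl arg_cong2[where f="(*)"]) auto
  moreover have "real k * g (c e) \<le> (\<Sum>b<k. g b)" unfolding ce by (rule pick(2)[OF k])
  moreover have "(\<Sum>b<k. g b) = (\<Sum>f\<in>E. W e f * of_bool (\<phi> f < \<phi> e))"
  proof -
    have "(\<Sum>b<k. g b) = (\<Sum>f\<in>E. W e f *
        (\<Sum>b<k. of_bool (\<phi> f < \<phi> e \<and> greedy_col E W k \<phi> (\<phi> e) f = b)))"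
      unfolding g_def by (subst sum.swap) (simp add: sum_distrib_left mult.commute)
    also have "\<dots> = (\<Sum>f\<in>E. W e f * of_bool (\<phi> f < \<phi> e))"
    proof (intro sum.cong refl arg_cong2[where f="(*)"])
      fix f
      have "(\<Sum>b<k. of_bool (\<phi> f < \<phi> e \<and> greedy_col E W k \<phi> (\<phi> e) f = b) :: real)
          = (\<Sum>b<k. if greedy_col E W k \<phi> (\<phi> e) f = b then of_bool (\<phi> f < \<phi> e) else 0)"
        by (intro sum.cong) auto
      then show "(\<Sum>b<k. of_bool (\<phi> f < \<phi> e \<and> greedy_col E W k \<phi> (\<phi> e) f = b))
          = (of_bool (\<phi> f < \<phi> e) :: real)"
        using greedy_col_less[OF k] by (simp add: sum.delta')
    qed
    finally show ?thesis .
  qed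
  ultimately show ?thesis by simp
qed

text \<open>Unlike hashing, the greedy choice controls an edge only against its predecessors.
  Symmetry allows each pair to be charged to its later member, so the bound holds for the total, not
  for every single edge. Pairs with equal \<open>\<phi>\<close> choose simultaneously and are
  counted in full.\<close>

lemma greedy_col_mono:
  assumes W: "\<And>e f. e \<in> E \<Longrightarrow> f \<in> E \<Longrightarrow> W e f \<ge> 0"
    and sym: "\<And>e f. e \<in> E \<Longrightarrow> f \<in> E \<Longrightarrow> W e f = W f e"
    and k: "k > 0" and N: "\<And>e. e \<in> E \<Longrightarrow> \<phi> e < N"
  defines "c \<equiv> greedy_col E W k \<phi> N"
  shows "real k * (\<Sum>e\<in>E. \<Sum>f\<in>E. W e f * of_bool (c f = c e))
     \<le> (\<Sum>e\<in>E. \<Sum>f\<in>E. W e f) + real k * (\<Sum>e\<in>E. \<Sum>f\<in>E. W e f * of_bool (\<phi> f = \<phi> e))"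
proof -
  let ?S = "\<lambda>P. \<Sum>e\<in>E. \<Sum>f\<in>E. W e f * of_bool (P e f)"
  have swap: "?S P = ?S (\<lambda>e f. P f e)" for P
    by (subst sum.swap) (intro sum.cong refl, simp add: sym)
  have b: "real k * ?S (\<lambda>e f. \<phi> f < \<phi> e \<and> c f = c e) \<le> ?S (\<lambda>e f. \<phi> f < \<phi> e)"
    unfolding sum_distrib_left[of "real k" _ E] c_def
    by (intro sum_mono order_trans[OF _ greedy_col_back[where \<phi>=\<phi> and N=N, OF k N]]) (simp_all add: sum_distrib_left)
  have "?S (\<lambda>e f. c f = c e) \<le> ?S (\<lambda>e f. \<phi> f < \<phi> e \<and> c f = c e)
      + ?S (\<lambda>e f. \<phi> e < \<phi> f \<and> c e = c f) + ?S (\<lambda>e f. \<phi> f = \<phi> e)"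
    unfolding sum.distrib[symmetric] distrib_left[symmetric]
    by (intro sum_mono mult_left_mono W) auto
  also have "?S (\<lambda>e f. \<phi> e < \<phi> f \<and> c e = c f) = ?S (\<lambda>e f. \<phi> f < \<phi> e \<and> c f = c e)"
    by (rule swap)
  finally have "real k * ?S (\<lambda>e f. c f = c e) \<le> real k * (?S (\<lambda>e f. \<phi> f < \<phi> e \<and> c f = c e)
      + ?S (\<lambda>e f. \<phi> f < \<phi> e \<and> c f = c e) + ?S (\<lambda>e f. \<phi> f = \<phi> e))"
    by (intro mult_left_mono) auto
  moreover have "?S (\<lambda>e f. \<phi> f < \<phi> e) + ?S (\<lambda>e f. \<phi> f < \<phi> e) \<le> (\<Sum>e\<in>E. \<Sum>f\<in>E. W e f)"
  proof -
    have "?S (\<lambda>e f. \<phi> f < \<phi> e) + ?S (\<lambda>e f. \<phi> f < \<phi> e) = ?S (\<lambda>e f. \<phi> f < \<phi> e) + ?S (\<lambda>e f. \<phi> e < \<phi> f)"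
      using swap[of "\<lambda>e f. \<phi> f < \<phi> e"] by simp
    also have "\<dots> = (\<Sum>e\<in>E. \<Sum>f\<in>E. W e f * (of_bool (\<phi> f < \<phi> e) + of_bool (\<phi> e < \<phi> f)))"
      by (simp add: sum.distrib distrib_left)
    also have "\<dots> \<le> (\<Sum>e\<in>E. \<Sum>f\<in>E. W e f * 1)"
      by (intro sum_mono mult_left_mono W) auto
    finally show ?thesis by simp
  qed
  ultimately show ?thesis using b by (simp add: algebra_simps)
qed

text \<open>The greedy procedure needs one exchange per colour, so the palette is shrunk beforehand:
  from \<open>2 ^ j1\<close> to 2 k^2 j1^2, which is at most \<open>2 ^ j2\<close>, and then to 2
  k^2 j2^2. Here \<open>j1\<close> is logarithmic in the given palette, but \<open>j2\<close> only
  doubly logarithmic in it.\<close>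

definition refine_col ::
  "nat set \<Rightarrow> (nat \<Rightarrow> nat \<Rightarrow> real) \<Rightarrow> nat \<Rightarrow> nat \<Rightarrow> nat \<Rightarrow> (nat \<Rightarrow> nat) \<Rightarrow> nat \<Rightarrow> nat" where
  "refine_col E W k j1 j2 \<phi> =
     greedy_col E W k (hash_col E W k j2 (hash_col E W k j1 \<phi>)) (k*j2*(2*k*j2))"

text \<open>\<open>\<phi>\<close> starts without monochromatic weight, and each of the three stages
  adds at most a 1/k fraction of the total.\<close>

lemma refine_col_mono:
  assumes W: "\<And>e f. e \<in> E \<Longrightarrow> f \<in> E \<Longrightarrow> W e f \<ge> 0"
    and sym: "\<And>e f. e \<in> E \<Longrightarrow> f \<in> E \<Longrightarrow> W e f = W f e"
    and k: "k \<ge> 1" and j1: "j1 \<ge> 1" and j2: "j2 \<ge> 1" and j12: "k*j1*(2*k*j1) \<le> 2 ^ j2"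
    and \<phi>: "\<And>e. e \<in> E \<Longrightarrow> \<phi> e < 2 ^ j1"
    and proper: "\<And>e f. e \<in> E \<Longrightarrow> f \<in> E \<Longrightarrow> \<phi> e = \<phi> f \<Longrightarrow> W e f = 0"
  defines "c \<equiv> refine_col E W k j1 j2 \<phi>"
  shows "real k * (\<Sum>e\<in>E. \<Sum>f\<in>E. W e f * of_bool (c f = c e)) \<le> 3 * (\<Sum>e\<in>E. \<Sum>f\<in>E. W e f)"
proof -
  define \<phi>1 where "\<phi>1 = hash_col E W k j1 \<phi>"
  define \<phi>2 where "\<phi>2 = hash_col E W k j2 \<phi>1"
  have m0: "(\<Sum>f\<in>E. W e f * of_bool (\<phi> f = \<phi> e)) = 0" if "e \<in> E" for e
    using proper that by (intro sum.neutral) auto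
  have h1: "\<phi>1 e < k*j1*(2*k*j1)"
    "real k * (\<Sum>f\<in>E. W e f * of_bool (\<phi>1 f = \<phi>1 e))
       \<le> (\<Sum>f\<in>E. W e f) + real k * (\<Sum>f\<in>E. W e f * of_bool (\<phi> f = \<phi> e))" if e: "e \<in> E" for e
    unfolding \<phi>1_def using hash_col[of E W e k j1 \<phi>] W k j1 \<phi> e by blast+
  have l1: "\<phi>1 e < 2 ^ j2" if "e \<in> E" for e using h1(1)[OF that] j12 by linarith
  have h2: "\<phi>2 e < k*j2*(2*k*j2)"
    "real k * (\<Sum>f\<in>E. W e f * of_bool (\<phi>2 f = \<phi>2 e))
       \<le> (\<Sum>f\<in>E. W e f) + real k * (\<Sum>f\<in>E. W e f * of_bool (\<phi>1 f = \<phi>1 e))" if e: "e \<in> E" for e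
    unfolding \<phi>2_def using hash_col[of E W e k j2 \<phi>1] W k j2 l1 e by blast+
  have "real k * (\<Sum>f\<in>E. W e f * of_bool (\<phi>2 f = \<phi>2 e)) \<le> 2 * (\<Sum>f\<in>E. W e f)" if "e \<in> E" for e
    using h2(2)[OF that] h1(2)[OF that] m0[OF that] by simp
  then have "real k * (\<Sum>e\<in>E. \<Sum>f\<in>E. W e f * of_bool (\<phi>2 f = \<phi>2 e)) \<le> 2 * (\<Sum>e\<in>E. \<Sum>f\<in>E. W e f)"
    unfolding sum_distrib_left[of "real k" _ E] sum_distrib_left[of 2 _ E] by (rule sum_mono)
  moreover have "real k * (\<Sum>e\<in>E. \<Sum>f\<in>E. W e f * of_bool (c f = c e))
     \<le> (\<Sum>e\<in>E. \<Sum>f\<in>E. W e f) + real k * (\<Sum>e\<in>E. \<Sum>f\<in>E. W e f * of_bool (\<phi>2 f = \<phi>2 e))"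
    unfolding c_def refine_col_def \<phi>1_def[symmetric] \<phi>2_def[symmetric]
    using k h2(1) by (intro greedy_col_mono W sym) auto
  ultimately show ?thesis by simp
qed

text \<open>The second colouring sees only the pairs left monochromatic by the first, so the
  fractions multiply to (3/k)^2. It starts from the original \<open>\<phi>\<close>, which is proper
  for these pairs too. The product has k^2 colours, while the greedy phases take only about k^2 j2^2
  rounds; reaching k^2 colours in a single greedy phase would take about k^4 j2^2.\<close>

definition pair_col ::
  "nat set \<Rightarrow> (nat \<Rightarrow> nat \<Rightarrow> real) \<Rightarrow> nat \<Rightarrow> nat \<Rightarrow> nat \<Rightarrow> (nat \<Rightarrow> nat) \<Rightarrow> nat \<Rightarrow> nat" where
  "pair_col E W k j1 j2 \<phi> e =
     (let c = refine_col E W k j1 j2 \<phi>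
      in c e * k + refine_col E (\<lambda>e f. W e f * of_bool (c f = c e)) k j1 j2 \<phi> e)"

lemma refine_col_less: "k \<ge> 1 \<Longrightarrow> refine_col E W k j1 j2 \<phi> e < k"
  unfolding refine_col_def by (rule greedy_col_less) simp

lemma pair_col_less:
  assumes "k \<ge> 1"
  shows "pair_col E W k j1 j2 \<phi> e < k * k"
proof -
  have "refine_col E W k j1 j2 \<phi> e * k + x < k * k" if "x < k" for x
  proof -
    have "refine_col E W k j1 j2 \<phi> e * k + x < Suc (refine_col E W k j1 j2 \<phi> e) * k" using that by simp
    also have "\<dots> \<le> k * k" using refine_col_less[OF assms, of E W j1 j2 \<phi> e] by (intro mult_le_mono1) simp
    finally show ?thesis .
  qed
  then show ?thesis by (simp add: pair_col_def Let_def refine_col_less[OF assms])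
qed

lemma pair_col_mono:
  assumes W: "\<And>e f. e \<in> E \<Longrightarrow> f \<in> E \<Longrightarrow> W e f \<ge> 0"
    and sym: "\<And>e f. e \<in> E \<Longrightarrow> f \<in> E \<Longrightarrow> W e f = W f e"
    and k: "k \<ge> 1" and j1: "j1 \<ge> 1" and j2: "j2 \<ge> 1" and j12: "k*j1*(2*k*j1) \<le> 2 ^ j2"
    and \<phi>: "\<And>e. e \<in> E \<Longrightarrow> \<phi> e < 2 ^ j1"
    and proper: "\<And>e f. e \<in> E \<Longrightarrow> f \<in> E \<Longrightarrow> \<phi> e = \<phi> f \<Longrightarrow> W e f = 0"
  defines "c \<equiv> pair_col E W k j1 j2 \<phi>"
  shows "(real k)\<^sup>2 * (\<Sum>e\<in>E. \<Sum>f\<in>E. W e f * of_bool (c f = c e)) \<le> 9 * (\<Sum>e\<in>E. \<Sum>f\<in>E. W e f)"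
proof -
  define c1 where "c1 = refine_col E W k j1 j2 \<phi>"
  define W1 where "W1 = (\<lambda>e f. W e f * of_bool (c1 f = c1 e))"
  define c2 where "c2 = refine_col E W1 k j1 j2 \<phi>"
  have c: "c e = c1 e * k + c2 e" for e by (simp add: c_def pair_col_def c1_def c2_def W1_def Let_def)
  have dec: "c1 f = c1 e \<and> c2 f = c2 e" if "c f = c e" for e f
  proof -
    have "c2 e < k" "c2 f < k" unfolding c2_def using k by (auto intro: refine_col_less)
    then have "c e div k = c1 e" "c f div k = c1 f" unfolding c by auto
    then show ?thesis using that by (simp add: c)
  qed
  have 1: "real k * (\<Sum>e\<in>E. \<Sum>f\<in>E. W1 e f) \<le> 3 * (\<Sum>e\<in>E. \<Sum>f\<in>E. W e f)"
    unfolding W1_def c1_def by (rule refine_col_mono) fact+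
  have 2: "real k * (\<Sum>e\<in>E. \<Sum>f\<in>E. W1 e f * of_bool (c2 f = c2 e)) \<le> 3 * (\<Sum>e\<in>E. \<Sum>f\<in>E. W1 e f)"
    unfolding c2_def
  proof (rule refine_col_mono[OF _ _ k j1 j2 j12 \<phi>])
    fix e f assume "e \<in> E" "f \<in> E"
    then show "W1 e f \<ge> 0" "W1 e f = W1 f e" using W sym[of e f] by (auto simp: W1_def)
    assume "\<phi> e = \<phi> f"
    then show "W1 e f = 0" using proper \<open>e \<in> E\<close> \<open>f \<in> E\<close> by (simp add: W1_def)
  qed
  have "(\<Sum>e\<in>E. \<Sum>f\<in>E. W e f * of_bool (c f = c e)) \<le> (\<Sum>e\<in>E. \<Sum>f\<in>E. W1 e f * of_bool (c2 f = c2 e))"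
    unfolding W1_def using W by (intro sum_mono) (auto dest: dec)
  then have "(real k)\<^sup>2 * (\<Sum>e\<in>E. \<Sum>f\<in>E. W e f * of_bool (c f = c e))
      \<le> (real k)\<^sup>2 * (\<Sum>e\<in>E. \<Sum>f\<in>E. W1 e f * of_bool (c2 f = c2 e))"
    by (intro mult_left_mono) auto
  also have "\<dots> = real k * (real k * (\<Sum>e\<in>E. \<Sum>f\<in>E. W1 e f * of_bool (c2 f = c2 e)))"
    by (simp add: power2_eq_square)
  also have "\<dots> \<le> real k * (3 * (\<Sum>e\<in>E. \<Sum>f\<in>E. W1 e f))" using 2 by (intro mult_left_mono) auto
  finally show ?thesis using 1 by simp
qed

section \<open>Deterministic rounding\<close>

definition quad :: "nat set \<Rightarrow> (nat \<Rightarrow> nat \<Rightarrow> real) \<Rightarrow> (nat \<Rightarrow> real) \<Rightarrow> real" where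
  "quad E w x = (\<Sum>e\<in>E. \<Sum>f\<in>E. w e f * (x e * x f)) / 2"

lemma quad_add:
  assumes sym: "\<And>e f. e \<in> E \<Longrightarrow> f \<in> E \<Longrightarrow> u e f = u f e"
  shows "quad E u (\<lambda>e. y e + D e) = quad E u y + (\<Sum>e\<in>E. D e * (\<Sum>f\<in>E. u e f * y f)) + quad E u D"
proof -
  have "(\<Sum>e\<in>E. \<Sum>f\<in>E. u e f * (y e * D f)) = (\<Sum>e\<in>E. \<Sum>f\<in>E. u e f * (D e * y f))"
    by (subst sum.swap) (intro sum.cong refl, simp add: sym)
  then show ?thesis
    by (simp add: quad_def distrib_left distrib_right sum.distrib add_divide_distrib sum_distrib_left
      sum_distrib_right mult.left_commute mult.commute[of _ 2])
qed

lemma quad_mono: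
  assumes "\<And>e f. e \<in> E \<Longrightarrow> f \<in> E \<Longrightarrow> w e f * (x e * x f) \<le> w' e f * (x' e * x' f)"
  shows "quad E w x \<le> quad E w' x'"
  unfolding quad_def using assms by (intro divide_right_mono sum_mono) auto

lemma quad_split: "quad E (\<lambda>e f. w e f + w' e f) x = quad E w x + quad E w' x"
  by (simp add: quad_def distrib_right sum.distrib add_divide_distrib)

primrec class_round ::
  "nat set \<Rightarrow> (nat \<Rightarrow> real) \<Rightarrow> (nat \<Rightarrow> nat \<Rightarrow> real) \<Rightarrow> real \<Rightarrow> real \<Rightarrow> (nat \<Rightarrow> nat) \<Rightarrow> (nat \<Rightarrow> real)
    \<Rightarrow> nat \<Rightarrow> nat \<Rightarrow> real" where
  "class_round E a w lm p c x 0 = x"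
| "class_round E a w lm p c x (Suc i) = (\<lambda>e. if x e = p \<and> c e = i
     then (if lm * (\<Sum>f\<in>E. w e f * (if x f = p \<and> c f = i then 0 else class_round E a w lm p c x i f)) < a e
           then 2 * p else 0)
     else class_round E a w lm p c x i e)"

lemma class_round_before:
  "x e \<noteq> p \<or> i \<le> c e \<Longrightarrow> class_round E a w lm p c x i e = x e"
  by (induction i) auto

lemma class_round_after:
  "x e = p \<Longrightarrow> c e < i \<Longrightarrow> class_round E a w lm p c x i e \<in> {0, 2 * p}"
  by (induction i) (auto simp: less_Suc_eq)

text \<open>Ignoring pairs inside a class, the objective is linear in the values of one class, so moving
  every value of the class in the direction of its own derivative cannot decrease it.\<close>

lemma class_round_step:
  fixes E :: "nat set" and w :: "nat \<Rightarrow> nat \<Rightarrow> real" and a x :: "nat \<Rightarrow> real" and c :: "nat \<Rightarrow> nat" and p lm :: real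
  assumes p: "p \<ge> 0" and sym: "\<And>e f. e \<in> E \<Longrightarrow> f \<in> E \<Longrightarrow> w e f = w f e"
  defines "u \<equiv> \<lambda>e f. w e f * of_bool (\<not> (x e = p \<and> x f = p \<and> c f = c e))"
    and "y \<equiv> class_round E a w lm p c x"
  shows "(\<Sum>e\<in>E. a e * y i e) - lm * quad E u (y i)
     \<le> (\<Sum>e\<in>E. a e * y (Suc i) e) - lm * quad E u (y (Suc i))"
proof -
  define D where "D = (\<lambda>e. y (Suc i) e - y i e)"
  have usym: "u e f = u f e" if "e \<in> E" "f \<in> E" for e f
    using sym[OF that] by (simp add: u_def eq_commute[of "c f"] conj_commute[of "x f = p"] conj_left_commute[of "x f = p"])
  have off: "D e = 0" if "\<not> (x e = p \<and> c e = i)" for e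
    using that by (auto simp: D_def y_def)
  have "quad E u (\<lambda>e. y i e + D e)
      = quad E u (y i) + (\<Sum>e\<in>E. D e * (\<Sum>f\<in>E. u e f * y i f)) + quad E u D"
    by (rule quad_add) (rule usym)
  moreover have "quad E u D = 0"
  proof -
    have "u e f * (D e * D f) = 0" for e f
      using off[of e] off[of f] by (auto simp: u_def)
    then show ?thesis by (simp only: quad_def sum.neutral_const div_0)
  qed
  moreover have "(\<lambda>e. y i e + D e) = y (Suc i)" by (simp add: D_def)
  ultimately have q: "quad E u (y (Suc i)) = quad E u (y i) + (\<Sum>e\<in>E. D e * (\<Sum>f\<in>E. u e f * y i f))"
    by simp
  have "0 \<le> (\<Sum>e\<in>E. D e * (a e - lm * (\<Sum>f\<in>E. u e f * y i f)))"
  proof (rule sum_nonneg)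
    fix e
    show "0 \<le> D e * (a e - lm * (\<Sum>f\<in>E. u e f * y i f))"
    proof (cases "x e = p \<and> c e = i")
      case True
      have s: "(\<Sum>f\<in>E. u e f * y i f) = (\<Sum>f\<in>E. w e f * (if x f = p \<and> c f = i then 0 else y i f))"
        using True by (intro sum.cong) (auto simp: u_def)
      have ye: "y i e = p" using True class_round_before[of x e p i c] by (simp add: y_def)
      have "D e = (if lm * (\<Sum>f\<in>E. u e f * y i f) < a e then p else - p)"
        using True ye by (simp add: D_def y_def s[unfolded y_def])
      then show ?thesis using p
        by (cases "lm * (\<Sum>f\<in>E. u e f * y i f) < a e") (simp_all add: mult_nonneg_nonneg mult_nonneg_nonpos)
    qed (simp add: off)
  qed
  then have "lm * (\<Sum>e\<in>E. D e * (\<Sum>f\<in>E. u e f * y i f)) \<le> (\<Sum>e\<in>E. a e * D e)"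
    by (simp add: right_diff_distrib sum_subtractf sum_distrib_left mult_ac)
  moreover have "(\<Sum>e\<in>E. a e * y (Suc i) e) = (\<Sum>e\<in>E. a e * y i e) + (\<Sum>e\<in>E. a e * D e)"
    by (simp add: D_def right_diff_distrib sum_subtractf)
  ultimately show ?thesis unfolding q by (simp add: distrib_left)
qed

text \<open>No step lowers the objective from which the pairs inside a class are removed. Such a
  pair changes from p * p to at most 2p * 2p, so putting these pairs back costs 4 - 1 = 3 times
  their initial share.\<close>

lemma class_round:
  fixes E :: "nat set" and w :: "nat \<Rightarrow> nat \<Rightarrow> real" and a x :: "nat \<Rightarrow> real" and c :: "nat \<Rightarrow> nat" and p lm :: real
  assumes p: "p \<ge> 0" and lm: "lm \<ge> 0"
    and w: "\<And>e f. e \<in> E \<Longrightarrow> f \<in> E \<Longrightarrow> w e f \<ge> 0"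
    and sym: "\<And>e f. e \<in> E \<Longrightarrow> f \<in> E \<Longrightarrow> w e f = w f e"
    and N: "\<And>e. e \<in> E \<Longrightarrow> c e < N"
  defines "y \<equiv> class_round E a w lm p c x N"
    and "v \<equiv> \<lambda>e f. w e f * of_bool (x e = p \<and> x f = p \<and> c f = c e)"
  shows "(\<Sum>e\<in>E. a e * x e) - lm * (quad E w x + 3 * quad E v x) \<le> (\<Sum>e\<in>E. a e * y e) - lm * quad E w y"
proof -
  \<comment> \<open>\<open>u\<close> refers to the initial values \<open>x\<close>, not to the
    current ones; the form is the same in all steps, so their inequalities can be chained.\<close>
  define u where "u = (\<lambda>e f. w e f * of_bool (\<not> (x e = p \<and> x f = p \<and> c f = c e)))"
  have "(\<Sum>e\<in>E. a e * x e) - lm * quad E u x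
     \<le> (\<Sum>e\<in>E. a e * class_round E a w lm p c x i e) - lm * quad E u (class_round E a w lm p c x i)" for i
  proof (induction i)
    case (Suc i)
    then show ?case using class_round_step[where E=E and w=w and x=x and c=c and a=a and lm=lm and i=i, OF p sym] unfolding u_def by linarith
  qed simp
  from this[of N] have 1: "(\<Sum>e\<in>E. a e * x e) - lm * quad E u x \<le> (\<Sum>e\<in>E. a e * y e) - lm * quad E u y"
    unfolding y_def .
  have split: "quad E w z = quad E u z + quad E v z" for z
    unfolding quad_split[symmetric] u_def v_def by (intro arg_cong[where f="\<lambda>w. quad E w z"] ext) auto
  have "quad E v y \<le> quad E (\<lambda>e f. 4 * v e f) x"
  proof (rule quad_mono)
    fix e f assume E: "e \<in> E" "f \<in> E"
    show "v e f * (y e * y f) \<le> 4 * v e f * (x e * x f)"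
    proof (cases "x e = p \<and> x f = p \<and> c f = c e")
      case True
      then have "y e \<in> {0, 2 * p}" "y f \<in> {0, 2 * p}"
        unfolding y_def using class_round_after[of x _ p c N E a w lm] N[OF E(1)] N[OF E(2)] by metis+
      then have "y e * y f \<le> 4 * (x e * x f)" using True p by auto
      then show ?thesis using mult_left_mono[of "y e * y f" "4 * (x e * x f)" "v e f"] w[OF E]
        by (simp add: v_def mult_ac)
    next
      case False
      then have "v e f = 0" by (auto simp: v_def)
      then show ?thesis by simp
    qed
  qed
  also have "\<dots> = 4 * quad E v x" by (simp add: quad_def sum_distrib_left mult_ac)
  finally have "lm * quad E v y \<le> lm * (4 * quad E v x)" using lm by (rule mult_left_mono)
  then show ?thesis using 1 split[of x] split[of y] by (simp add: algebra_simps)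
qed

text \<open>Level \<open>l\<close> consists of the edges of value \<open>(1/2) ^ l\<close>, which are rounded to \<open>0\<close> or
  \<open>(1/2) ^ (l - 1)\<close>. The pairs inside a class grow by a factor of at most \<open>4\<close> and make up at most
  the fraction \<open>9 / k\<^sup>2\<close> of all pairs, so the quadratic form may grow by \<open>3 * 9 / k\<^sup>2\<close>; this is paid
  for by a decreasing weight of the quadratic form in the objective.\<close>

definition level_round ::
  "nat set \<Rightarrow> (nat \<Rightarrow> real) \<Rightarrow> (nat \<Rightarrow> nat \<Rightarrow> real) \<Rightarrow> nat \<Rightarrow> nat \<Rightarrow> nat \<Rightarrow> (nat \<Rightarrow> nat) \<Rightarrow> nat
    \<Rightarrow> (nat \<Rightarrow> real) \<Rightarrow> nat \<Rightarrow> real" where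
  "level_round E a w k j1 j2 \<phi> l x =
     (let p = (1/2) ^ l;
          c = pair_col E (\<lambda>e f. w e f * of_bool (x e = p \<and> x f = p)) k j1 j2 \<phi>
      in class_round E a w ((1 + 27 / (real k)\<^sup>2) ^ (l - 1)) p c x (k * k))"

primrec rounding ::
  "nat set \<Rightarrow> (nat \<Rightarrow> real) \<Rightarrow> (nat \<Rightarrow> nat \<Rightarrow> real) \<Rightarrow> nat \<Rightarrow> nat \<Rightarrow> nat \<Rightarrow> (nat \<Rightarrow> nat) \<Rightarrow> nat
    \<Rightarrow> (nat \<Rightarrow> real) \<Rightarrow> nat \<Rightarrow> nat \<Rightarrow> real" where
  "rounding E a w k j1 j2 \<phi> L x 0 = x"
| "rounding E a w k j1 j2 \<phi> L x (Suc i) = level_round E a w k j1 j2 \<phi> (L - i) (rounding E a w k j1 j2 \<phi> L x i)"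

locale conflict_weights =
  fixes E :: "nat set" and w :: "nat \<Rightarrow> nat \<Rightarrow> real" and k j1 j2 :: nat and \<phi> :: "nat \<Rightarrow> nat"
  assumes w_nonneg: "\<And>e f. e \<in> E \<Longrightarrow> f \<in> E \<Longrightarrow> w e f \<ge> 0"
    and w_sym: "\<And>e f. e \<in> E \<Longrightarrow> f \<in> E \<Longrightarrow> w e f = w f e"
    and k: "k \<ge> 1" and j1: "j1 \<ge> 1" and j2: "j2 \<ge> 1" and j12: "k*j1*(2*k*j1) \<le> 2 ^ j2"
    and \<phi>_less: "\<And>e. e \<in> E \<Longrightarrow> \<phi> e < 2 ^ j1"
    and proper: "\<And>e f. e \<in> E \<Longrightarrow> f \<in> E \<Longrightarrow> \<phi> e = \<phi> f \<Longrightarrow> w e f = 0"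
begin

lemma level_round:
  fixes a x :: "nat \<Rightarrow> real"
  assumes l: "l \<ge> 1" and x: "\<And>e. e \<in> E \<Longrightarrow> x e \<ge> 0"
  defines "\<beta> \<equiv> 1 + 27 / (real k)\<^sup>2" and "y \<equiv> level_round E a w k j1 j2 \<phi> l x"
  shows "(\<Sum>e\<in>E. a e * x e) - \<beta> ^ l * quad E w x \<le> (\<Sum>e\<in>E. a e * y e) - \<beta> ^ (l - 1) * quad E w y"
proof -
  define p :: real where "p = (1/2) ^ l"
  define W where "W = (\<lambda>e f. w e f * of_bool (x e = p \<and> x f = p))"
  define c where "c = pair_col E W k j1 j2 \<phi>"
  define v where "v = (\<lambda>e f. w e f * of_bool (x e = p \<and> x f = p \<and> c f = c e))"
  have \<beta>: "\<beta> \<ge> 1" by (simp add: \<beta>_def)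
  have k2: "(real k)\<^sup>2 > 0" using k by simp
  have y: "y = class_round E a w (\<beta> ^ (l - 1)) p c x (k * k)"
    by (simp add: y_def level_round_def Let_def p_def W_def c_def \<beta>_def)
  have "(real k)\<^sup>2 * (\<Sum>e\<in>E. \<Sum>f\<in>E. W e f * of_bool (c f = c e)) \<le> 9 * (\<Sum>e\<in>E. \<Sum>f\<in>E. W e f)"
    unfolding c_def
  proof (rule pair_col_mono[OF _ _ k j1 j2 j12 \<phi>_less])
    fix e f assume E: "e \<in> E" "f \<in> E"
    show "W e f \<ge> 0" "W e f = W f e" using w_nonneg[OF E] w_sym[OF E] by (auto simp: W_def)
    assume "\<phi> e = \<phi> f"
    then show "W e f = 0" using proper[OF E] by (simp add: W_def)
  qed
  \<comment> \<open>On the support of \<open>W\<close> all values equal \<open>p\<close>, so a bound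
    on sums of weights becomes a bound on quadratic forms after multiplication by
    \<open>p\<^sup>2/2\<close>.\<close>
  then have "(p\<^sup>2/2) * ((real k)\<^sup>2 * (\<Sum>e\<in>E. \<Sum>f\<in>E. W e f * of_bool (c f = c e)))
      \<le> (p\<^sup>2/2) * (9 * (\<Sum>e\<in>E. \<Sum>f\<in>E. W e f))"
    by (rule mult_left_mono) simp
  then have le: "(real k)\<^sup>2 * ((p\<^sup>2/2) * (\<Sum>e\<in>E. \<Sum>f\<in>E. W e f * of_bool (c f = c e)))
      \<le> 9 * ((p\<^sup>2/2) * (\<Sum>e\<in>E. \<Sum>f\<in>E. W e f))" by (simp only: mult_ac)
  have qv: "quad E v x = (p\<^sup>2/2) * (\<Sum>e\<in>E. \<Sum>f\<in>E. W e f * of_bool (c f = c e))"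
    by (auto simp: quad_def v_def W_def sum_distrib_left sum_divide_distrib power2_eq_square intro!: sum.cong)
  have qW: "quad E W x = (p\<^sup>2/2) * (\<Sum>e\<in>E. \<Sum>f\<in>E. W e f)"
    by (auto simp: quad_def W_def sum_distrib_left sum_divide_distrib power2_eq_square intro!: sum.cong)
  have "(real k)\<^sup>2 * quad E v x \<le> 9 * quad E W x" using le unfolding qv qW .
  moreover have "quad E W x \<le> quad E w x"
    using w_nonneg x by (intro quad_mono) (auto simp: W_def)
  ultimately have "(real k)\<^sup>2 * quad E v x \<le> 9 * quad E w x" by linarith
  then have "3 * quad E v x \<le> 27 / (real k)\<^sup>2 * quad E w x"
    using k2 by (simp add: field_simps)
  then have "quad E w x + 3 * quad E v x \<le> \<beta> * quad E w x" by (simp add: \<beta>_def distrib_right)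
  then have "\<beta> ^ (l - 1) * (quad E w x + 3 * quad E v x) \<le> \<beta> ^ (l - 1) * (\<beta> * quad E w x)"
    using \<beta> by (intro mult_left_mono) auto
  also have "\<beta> ^ (l - 1) * (\<beta> * quad E w x) = \<beta> ^ l * quad E w x"
    using l by (cases l) simp_all
  finally have "\<beta> ^ (l - 1) * (quad E w x + 3 * quad E v x) \<le> \<beta> ^ l * quad E w x" .
  moreover have "(\<Sum>e\<in>E. a e * x e) - \<beta> ^ (l - 1) * (quad E w x + 3 * quad E v x)
      \<le> (\<Sum>e\<in>E. a e * y e) - \<beta> ^ (l - 1) * quad E w y"
    unfolding y v_def using \<beta> w_nonneg w_sym
    by (intro class_round) (auto simp: c_def p_def intro!: pair_col_less k)
  ultimately show ?thesis by linarith
qed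

lemma level_round_levels:
  fixes a x :: "nat \<Rightarrow> real"
  assumes l: "l \<ge> 1" and x: "x e = 0 \<or> (\<exists>j\<le>l. x e = (1/2) ^ j)"
  defines "y \<equiv> level_round E a w k j1 j2 \<phi> l x"
  shows "y e = 0 \<or> (\<exists>j\<le>l - 1. y e = (1/2) ^ j)"
proof -
  define p :: real where "p = (1/2) ^ l"
  define c where "c = pair_col E (\<lambda>e f. w e f * of_bool (x e = p \<and> x f = p)) k j1 j2 \<phi>"
  have y: "y = class_round E a w ((1 + 27 / (real k)\<^sup>2) ^ (l - 1)) p c x (k * k)"
    by (simp add: y_def level_round_def Let_def p_def c_def)
  show ?thesis
  proof (cases "x e = p")
    case True
    have "c e < k * k" unfolding c_def by (rule pair_col_less[OF k])
    then have "y e \<in> {0, 2 * p}" unfolding y using True by (intro class_round_after)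
    moreover have "2 * p = (1/2) ^ (l - 1)" using l by (cases l) (simp_all add: p_def)
    ultimately show ?thesis by auto
  next
    case False
    then have "y e = x e" unfolding y by (intro class_round_before) simp
    moreover have "j \<le> l - 1" if "j \<le> l" "x e = (1/2) ^ j" for j
      using that False by (cases "j = l") (auto simp: p_def)
    ultimately show ?thesis using x by auto
  qed
qed

text \<open>The inequalities of the levels telescope, with weight \<beta>^L of the quadratic form at
  the start and 1 at the end. The condition on \<open>k\<close> gives \<beta>^L \<le> exp 1 \<le>
  3.\<close>

lemma rounding:
  fixes a x :: "nat \<Rightarrow> real"
  assumes x: "\<And>e. e \<in> E \<Longrightarrow> x e = 0 \<or> (\<exists>j\<le>L. x e = (1/2) ^ j)" and kL: "27 * L \<le> k\<^sup>2"
  defines "y \<equiv> rounding E a w k j1 j2 \<phi> L x L"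
  shows "\<And>e. e \<in> E \<Longrightarrow> y e = 0 \<or> y e = 1"
    and "(\<Sum>e\<in>E. a e * x e) - 3 * quad E w x \<le> (\<Sum>e\<in>E. a e * y e) - quad E w y"
proof -
  define \<beta> where "\<beta> = 1 + 27 / (real k)\<^sup>2"
  let ?X = "rounding E a w k j1 j2 \<phi> L x"
  have lev: "e \<in> E \<Longrightarrow> i \<le> L \<Longrightarrow> ?X i e = 0 \<or> (\<exists>j\<le>L - i. ?X i e = (1/2) ^ j)" for e i
  proof (induction i)
    case (Suc i)
    have "L - Suc i = (L - i) - 1" "L - i \<ge> 1" using Suc.prems by auto
    then show ?case using level_round_levels[of "L - i" "?X i" e a] Suc by simp
  qed (use x in simp)
  have pot: "i \<le> L \<Longrightarrow> (\<Sum>e\<in>E. a e * x e) - \<beta> ^ L * quad E w x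
      \<le> (\<Sum>e\<in>E. a e * ?X i e) - \<beta> ^ (L - i) * quad E w (?X i)" for i
  proof (induction i)
    case (Suc i)
    have "L - Suc i = (L - i) - 1" "L - i \<ge> 1" using Suc.prems by auto
    moreover have "?X i e \<ge> 0" if "e \<in> E" for e using lev[of e i] that Suc.prems by auto
    ultimately show ?case
      using level_round[of "L - i" "?X i" a] Suc.IH Suc.prems by (simp add: \<beta>_def)
  qed simp
  show "y e = 0 \<or> y e = 1" if "e \<in> E" for e using lev[OF that, of L] by (auto simp: y_def)
  have x0: "x e \<ge> 0" if "e \<in> E" for e using x[OF that] by auto
  have "\<beta> ^ L \<le> exp (27 / (real k)\<^sup>2) ^ L"
    unfolding \<beta>_def by (intro power_mono) (auto simp: exp_ge_add_one_self)
  also have "\<dots> = exp (27 * real L / (real k)\<^sup>2)" by (simp add: exp_of_nat_mult[symmetric] mult_ac)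
  also have "\<dots> \<le> exp 1"
  proof -
    have "27 * real L \<le> (real k)\<^sup>2" using kL of_nat_mono[OF kL, where 'a=real] by simp
    then show ?thesis using k by (simp add: field_simps)
  qed
  also have "\<dots> \<le> 3" by (rule exp_le)
  finally have "\<beta> ^ L * quad E w x \<le> 3 * quad E w x"
    by (rule mult_right_mono) (auto simp: quad_def intro!: sum_nonneg mult_nonneg_nonneg w_nonneg x0)
  then show "(\<Sum>e\<in>E. a e * x e) - 3 * quad E w x \<le> (\<Sum>e\<in>E. a e * y e) - quad E w y"
    using pot[of L] by (simp add: y_def)
qed

end

section \<open>From an integral solution to a matching\<close>

definition beats :: "(nat \<Rightarrow> real) \<Rightarrow> (nat \<Rightarrow> nat) \<Rightarrow> nat \<Rightarrow> nat \<Rightarrow> bool" where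
  "beats a \<phi> f e \<longleftrightarrow> a e < a f \<or> a e = a f \<and> \<phi> e < \<phi> f"

text \<open>Absence of a chosen neighbour that beats \<open>e\<close> is expressed by a sum because
  weighted neighbourhood sums are what two rounds provide.\<close>

definition unbeaten ::
  "nat set \<Rightarrow> (nat \<Rightarrow> real) \<Rightarrow> (nat \<Rightarrow> nat \<Rightarrow> real) \<Rightarrow> (nat \<Rightarrow> nat) \<Rightarrow> (nat \<Rightarrow> real) \<Rightarrow> nat \<Rightarrow> bool" where
  "unbeaten E a M \<phi> x e \<longleftrightarrow> x e = 1 \<and> (\<Sum>f\<in>E. M e f * of_bool (x f = 1 \<and> beats a \<phi> f e)) \<le> 0"

text \<open>An edge that is removed has a chosen neighbour at least as heavy, so its weight is the
  minimum of the two and is paid for by that pair. Of two edges at most one beats the other, so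
  every pair pays only once.\<close>

lemma unbeaten_weight:
  assumes fin: "finite E" and M: "\<And>e f. e \<in> E \<Longrightarrow> f \<in> E \<Longrightarrow> M e f = 0 \<or> M e f \<ge> 1"
    and Msym: "\<And>e f. e \<in> E \<Longrightarrow> f \<in> E \<Longrightarrow> M e f = M f e"
    and a: "\<And>e. e \<in> E \<Longrightarrow> a e \<ge> 0" and x: "\<And>e. e \<in> E \<Longrightarrow> x e = 0 \<or> x e = 1"
  shows "(\<Sum>e\<in>E. a e * x e) - quad E (\<lambda>e f. M e f * min (a e) (a f)) x
     \<le> (\<Sum>e\<in>{e\<in>E. unbeaten E a M \<phi> x e}. a e)"
proof -
  let ?w = "\<lambda>e f. M e f * min (a e) (a f)"
  let ?B = "\<Sum>e\<in>E. \<Sum>f\<in>E. ?w e f * (x e * x f) * of_bool (beats a \<phi> f e)"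
  have M0: "M e f \<ge> 0" if "e \<in> E" "f \<in> E" for e f using M[OF that] by auto
  have pos: "?w e f * (x e * x f) \<ge> 0" if "e \<in> E" "f \<in> E" for e f
    using M0[OF that] a[OF that(1)] a[OF that(2)] x[OF that(1)] x[OF that(2)] by auto
  have "a e * x e \<le> a e * of_bool (unbeaten E a M \<phi> x e)
      + (\<Sum>f\<in>E. ?w e f * (x e * x f) * of_bool (beats a \<phi> f e))" if e: "e \<in> E" for e
  proof (cases "x e = 1 \<and> \<not> unbeaten E a M \<phi> x e")
    case True
    then have "(\<Sum>f\<in>E. M e f * of_bool (x f = 1 \<and> beats a \<phi> f e)) > 0" by (auto simp: unbeaten_def)
    then have "\<exists>f\<in>E. M e f * of_bool (x f = 1 \<and> beats a \<phi> f e) > 0"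
      by (meson not_le sum_nonpos)
    then obtain f where f: "f \<in> E" "M e f * of_bool (x f = 1 \<and> beats a \<phi> f e) > 0" by blast
    then have f: "f \<in> E" "x f = 1" "beats a \<phi> f e" "M e f \<ge> 1"
      using M[OF e f(1)] by (auto split: if_splits simp: of_bool_def)
    have "a e = min (a e) (a f)" using f(3) by (auto simp: beats_def)
    then have "a e * x e \<le> ?w e f * (x e * x f) * of_bool (beats a \<phi> f e)"
      using f True a[OF e] mult_right_mono[of 1 "M e f" "a e"] by simp
    also have "\<dots> \<le> (\<Sum>f\<in>E. ?w e f * (x e * x f) * of_bool (beats a \<phi> f e))"
      using e pos by (intro member_le_sum[OF f(1) _ fin]) auto
    finally show ?thesis using a[OF e] by simp
  next
    case False
    have "0 \<le> (\<Sum>f\<in>E. ?w e f * (x e * x f) * of_bool (beats a \<phi> f e))"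
      using e pos by (intro sum_nonneg) auto
    then show ?thesis using False x[OF e] a[OF e] by auto
  qed
  then have "(\<Sum>e\<in>E. a e * x e) \<le> (\<Sum>e\<in>E. a e * of_bool (unbeaten E a M \<phi> x e)) + ?B"
    unfolding sum.distrib[symmetric] by (intro sum_mono)
  also have "(\<Sum>e\<in>E. a e * of_bool (unbeaten E a M \<phi> x e)) = (\<Sum>e\<in>{e\<in>E. unbeaten E a M \<phi> x e}. a e)"
    by (rule sum.mono_neutral_cong_right) (auto simp: fin)
  also have "?B \<le> quad E ?w x"
  proof -
    have "?B = (\<Sum>e\<in>E. \<Sum>f\<in>E. ?w e f * (x e * x f) * of_bool (beats a \<phi> e f))"
      by (subst sum.swap) (intro sum.cong refl, simp add: Msym min.commute mult_ac)
    then have "?B + ?B = (\<Sum>e\<in>E. \<Sum>f\<in>E. ?w e f * (x e * x f) * (of_bool (beats a \<phi> f e) + of_bool (beats a \<phi> e f)))"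
      by (simp add: sum.distrib distrib_left)
    also have "\<dots> \<le> (\<Sum>e\<in>E. \<Sum>f\<in>E. ?w e f * (x e * x f) * 1)"
      using pos by (intro sum_mono mult_left_mono) (auto simp: beats_def)
    finally show ?thesis by (simp add: quad_def)
  qed
  finally show ?thesis by simp
qed

text \<open>Two remaining neighbours could not beat each other, so they would agree in weight and in
  colour, contrary to the good colouring. The colours thus break ties without identifiers.\<close>

lemma unbeaten_independent:
  assumes fin: "finite E" and M: "\<And>e f. e \<in> E \<Longrightarrow> f \<in> E \<Longrightarrow> M e f \<ge> 0"
    and Msym: "\<And>e f. e \<in> E \<Longrightarrow> f \<in> E \<Longrightarrow> M e f = M f e"
    and proper: "\<And>e f. e \<in> E \<Longrightarrow> f \<in> E \<Longrightarrow> \<phi> e = \<phi> f \<Longrightarrow> M e f = 0"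
    and E: "e \<in> E" "f \<in> E" and un: "unbeaten E a M \<phi> x e" "unbeaten E a M \<phi> x f"
  shows "M e f = 0"
proof (rule ccontr)
  assume n: "M e f \<noteq> 0"
  have "\<not> beats a \<phi> f e" if E: "e \<in> E" "f \<in> E" and un: "unbeaten E a M \<phi> x e" "unbeaten E a M \<phi> x f"
    and n: "M e f \<noteq> 0" for e f
  proof
    assume b: "beats a \<phi> f e"
    have "M e f * of_bool (x f = 1 \<and> beats a \<phi> f e) \<le> (\<Sum>f\<in>E. M e f * of_bool (x f = 1 \<and> beats a \<phi> f e))"
      using M E(1) by (intro member_le_sum[OF E(2) _ fin]) auto
    then show False using un b M[OF E] n by (auto simp: unbeaten_def)
  qed
  from this[OF E un n] this[OF E(2,1) un(2,1)] n Msym[OF E] have "\<phi> e = \<phi> f"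
    by (auto simp: beats_def)
  then show False using proper[OF E] n by simp
qed

section \<open>The fractional solution\<close>

text \<open>The fractional value of \<open>e\<close> after \<open>i\<close> rounds is \<open>2 ^ dbl E M a s i e / 2 ^ s\<close>; the test is
  multiplied by \<open>2 ^ s\<close>.\<close>

primrec dbl ::
  "nat set \<Rightarrow> (nat \<Rightarrow> nat \<Rightarrow> real) \<Rightarrow> (nat \<Rightarrow> real) \<Rightarrow> nat \<Rightarrow> nat \<Rightarrow> nat \<Rightarrow> nat" where
  "dbl E M a s 0 = (\<lambda>e. 0)"
| "dbl E M a s (Suc i) = (\<lambda>e. if a e * 2 ^ dbl E M a s i e + (\<Sum>f\<in>E. M e f * (a f * 2 ^ dbl E M a s i f)) < a e * 2 ^ s
     then Suc (dbl E M a s i e) else dbl E M a s i e)"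

definition halvings ::
  "nat set \<Rightarrow> (nat \<Rightarrow> nat \<Rightarrow> real) \<Rightarrow> (nat \<Rightarrow> real) \<Rightarrow> nat \<Rightarrow> nat \<Rightarrow> nat" where
  "halvings E M a s e = s - dbl E M a s s e"

locale doubling =
  fixes E :: "nat set" and M :: "nat \<Rightarrow> nat \<Rightarrow> real" and a :: "nat \<Rightarrow> real" and s :: nat
  assumes fin: "finite E" and M_nonneg: "\<And>e f. e \<in> E \<Longrightarrow> f \<in> E \<Longrightarrow> M e f \<ge> 0"
    and a_nonneg: "\<And>e. e \<in> E \<Longrightarrow> a e \<ge> 0"
    and M_le: "\<And>e. e \<in> E \<Longrightarrow> (\<Sum>f\<in>E. M e f) \<le> 2 ^ s"
begin

abbreviation "n \<equiv> dbl E M a s"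

definition active :: "nat \<Rightarrow> nat \<Rightarrow> bool" where
  "active i e \<longleftrightarrow> a e * 2 ^ n i e + (\<Sum>f\<in>E. M e f * (a f * 2 ^ n i f)) < a e * 2 ^ s"

abbreviation y :: "nat \<Rightarrow> real" where
  "y e \<equiv> (1/2) ^ halvings E M a s e"

lemma n_Suc: "n (Suc i) e = (if active i e then Suc (n i e) else n i e)"
  by (simp add: active_def)

lemma n_mono: "i \<le> i' \<Longrightarrow> n i e \<le> n i' e"
  by (rule lift_Suc_mono_le[of "\<lambda>i. n i e"]) (simp_all add: n_Suc del: dbl.simps)

text \<open>Loads only grow while the threshold stays fixed, so an edge that has stopped never
  resumes.\<close>

lemma active_antimono:
  assumes "active i' e" "i \<le> i'" "e \<in> E"
  shows "active i e"
proof -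
  have "a e * 2 ^ n i e + (\<Sum>f\<in>E. M e f * (a f * 2 ^ n i f))
      \<le> a e * 2 ^ n i' e + (\<Sum>f\<in>E. M e f * (a f * 2 ^ n i' f))"
    using assms a_nonneg M_nonneg
    by (intro add_mono sum_mono mult_left_mono power_increasing n_mono) auto
  then show ?thesis using assms(1) unfolding active_def by linarith
qed

lemma n_active:
  assumes "e \<in> E"
  shows "active i e \<Longrightarrow> n i e = i"
proof (induction i)
  case (Suc i)
  then have "active i e" using active_antimono[of "Suc i" e i] assms by simp
  then show ?case using Suc by (simp add: n_Suc del: dbl.simps)
qed simp

lemma n_inactive:
  assumes "e \<in> E" "\<not> active i e"
  shows "n (i + d) e = n i e"
proof (induction d)
  case (Suc d)
  have "\<not> active (i + d) e" using assms active_antimono[of "i + d" e i] by auto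
  then show ?case using Suc by (simp add: n_Suc del: dbl.simps)
qed simp

lemma stopping_time:
  assumes e: "e \<in> E"
  obtains t where "t \<le> s" "\<And>i. n i e = min i t" "\<And>i. i < t \<Longrightarrow> active i e" "\<not> active t e"
proof -
  \<comment> \<open>An edge active at time \<open>s\<close> would have doubled \<open>s\<close>
    times, and its own term alone would reach the threshold.\<close>
  have s: "\<not> active s e"
  proof
    assume act: "active s e"
    have "0 \<le> (\<Sum>f\<in>E. M e f * (a f * 2 ^ n s f))"
      using e a_nonneg M_nonneg by (intro sum_nonneg mult_nonneg_nonneg) auto
    then show False using act n_active[OF e act] by (simp add: active_def)
  qed
  define t where "t = (LEAST i. \<not> active i e)"
  have t: "\<not> active t e" unfolding t_def by (rule LeastI) (rule s)
  have less: "active i e" if "i < t" for i using not_less_Least that unfolding t_def by blast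
  have "t \<le> s" unfolding t_def by (rule Least_le) (rule s)
  have le: "n i e = i" if "i \<le> t" for i
  proof (cases i)
    case (Suc i')
    then have "active i' e" using less that by simp
    then show ?thesis using n_active[OF e] Suc by (simp add: n_Suc del: dbl.simps)
  qed simp
  have "n i e = min i t" for i
    using le[of i] le[of t] n_inactive[OF e t, of "i - t"] by (cases "i \<le> t") auto
  then show ?thesis using that \<open>t \<le> s\<close> less t by blast
qed

lemma n_le: "e \<in> E \<Longrightarrow> n s e \<le> s"
  by (rule stopping_time[of e]) auto

lemma y_eq:
  assumes "e \<in> E"
  shows "y e = 2 ^ n s e / 2 ^ s"
proof -
  have "(2::real) ^ s = 2 ^ n s e * 2 ^ (s - n s e)"
    using n_le[OF assms] by (simp add: power_add[symmetric])
  then show ?thesis by (simp add: halvings_def power_one_over)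
qed

lemma cover:
  assumes e: "e \<in> E"
  shows "a e \<le> a e * y e + (\<Sum>f\<in>E. M e f * (a f * y f))"
proof -
  obtain t where t: "t \<le> s" "\<not> active t e" using stopping_time[OF e] by metis
  have "\<not> active s e" using active_antimono[of s e t] t e by blast
  then have "a e * 2 ^ s / 2 ^ s \<le> (a e * 2 ^ n s e + (\<Sum>f\<in>E. M e f * (a f * 2 ^ n s f))) / 2 ^ s"
    unfolding active_def by (intro divide_right_mono) auto
  also have "\<dots> = a e * (2 ^ n s e / 2 ^ s) + (\<Sum>f\<in>E. M e f * (a f * (2 ^ n s f / 2 ^ s)))"
    by (simp add: add_divide_distrib sum_divide_distrib)
  also have "\<dots> = a e * y e + (\<Sum>f\<in>E. M e f * (a f * y f))"
    using e by (simp add: y_eq)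
  finally show ?thesis by simp
qed

text \<open>When \<open>e\<close> doubles for the last time its load is still below \<open>a e\<close>, and every \<open>f\<close> that
  stops no later than \<open>e\<close> has by then reached at least half of its final value.\<close>

lemma late_load:
  assumes e: "e \<in> E"
  shows "(\<Sum>f\<in>E. M e f * min (a e) (a f) * (if halvings E M a s e \<le> halvings E M a s f then y f else 0)) \<le> 2 * a e"
proof (cases "n s e")
  \<comment> \<open>An edge that never doubled has no last doubling to argue with. But then every
    \<open>f\<close> in the sum has the initial value as well, and the choice of \<open>s\<close> in
    \<open>M_le\<close> bounds the sum directly.\<close>
  case 0
  have "(\<Sum>f\<in>E. M e f * min (a e) (a f) * (if halvings E M a s e \<le> halvings E M a s f then y f else 0))
      \<le> (\<Sum>f\<in>E. M e f * (a e / 2 ^ s))"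
  proof (rule sum_mono)
    fix f assume f: "f \<in> E"
    have "min (a e) (a f) * (if halvings E M a s e \<le> halvings E M a s f then y f else 0) \<le> a e / 2 ^ s"
    proof (cases "halvings E M a s e \<le> halvings E M a s f")
      case True
      then have "n s f = 0" using n_le[OF f] 0 by (simp add: halvings_def)
      then show ?thesis using True y_eq[OF f] a_nonneg[OF e] by (auto simp: divide_simps)
    qed (use a_nonneg[OF e] in simp)
    then show "M e f * min (a e) (a f) * (if halvings E M a s e \<le> halvings E M a s f then y f else 0)
        \<le> M e f * (a e / 2 ^ s)"
      using M_nonneg[OF e f] by (simp only: mult.assoc mult_left_mono)
  qed
  also have "\<dots> = (\<Sum>f\<in>E. M e f) * (a e / 2 ^ s)" by (rule sum_distrib_right[symmetric])
  also have "\<dots> \<le> 2 ^ s * (a e / 2 ^ s)" using M_le[OF e] a_nonneg[OF e] by (intro mult_right_mono) auto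
  finally show ?thesis using a_nonneg[OF e] by simp
next
  case (Suc i)
  obtain t where t: "t \<le> s" "\<And>i. n i e = min i t" "\<And>i. i < t \<Longrightarrow> active i e"
    using stopping_time[OF e] by metis
  have ti: "t = Suc i" using t(1,2) Suc by simp
  then have "active i e" using t(3) by simp
  moreover have "0 \<le> a e * 2 ^ n i e" using a_nonneg[OF e] by simp
  ultimately have lt: "(\<Sum>f\<in>E. M e f * (a f * 2 ^ n i f)) \<le> a e * 2 ^ s"
    unfolding active_def by linarith
  have "(\<Sum>f\<in>E. M e f * min (a e) (a f) * (if halvings E M a s e \<le> halvings E M a s f then y f else 0))
      \<le> (\<Sum>f\<in>E. 2 / 2 ^ s * (M e f * (a f * 2 ^ n i f)))"
  proof (rule sum_mono)
    fix f assume f: "f \<in> E"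
    have "min (a e) (a f) * (if halvings E M a s e \<le> halvings E M a s f then y f else 0)
        \<le> a f * (2 * 2 ^ n i f / 2 ^ s)"
    proof (cases "halvings E M a s e \<le> halvings E M a s f")
      case True
      obtain t' where t': "t' \<le> s" "\<And>i. n i f = min i t'" using stopping_time[OF f] by metis
      have "n s f \<le> Suc i" using True n_le[OF f] n_le[OF e] Suc by (simp add: halvings_def)
      then have "n s f \<le> Suc (n i f)" using t' by simp
      then have "(2::real) ^ n s f \<le> 2 ^ Suc (n i f)" by (rule power_increasing) simp
      then have "y f \<le> 2 * 2 ^ n i f / 2 ^ s" unfolding y_eq[OF f] by (intro divide_right_mono) auto
      then have "min (a e) (a f) * y f \<le> a f * (2 * 2 ^ n i f / 2 ^ s)"
        using a_nonneg[OF f] by (intro mult_mono) auto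
      then show ?thesis using True by simp
    qed (use a_nonneg[OF f] in simp)
    then have "M e f * (min (a e) (a f) * (if halvings E M a s e \<le> halvings E M a s f then y f else 0))
        \<le> M e f * (a f * (2 * 2 ^ n i f / 2 ^ s))"
      using M_nonneg[OF e f] by (rule mult_left_mono)
    then show "M e f * min (a e) (a f) * (if halvings E M a s e \<le> halvings E M a s f then y f else 0)
        \<le> 2 / 2 ^ s * (M e f * (a f * 2 ^ n i f))" by (simp add: mult_ac)
  qed
  also have "\<dots> = 2 / 2 ^ s * (\<Sum>f\<in>E. M e f * (a f * 2 ^ n i f))" by (simp add: sum_distrib_left)
  also have "\<dots> \<le> 2 / 2 ^ s * (a e * 2 ^ s)" by (rule mult_left_mono[OF lt]) simp
  finally show ?thesis by simp
qed

text \<open>Weak duality: the covering inequalities are weighted by \<open>h\<close> and the sums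
  exchanged, so that every \<open>f\<close> collects the value of \<open>h\<close> on its closed
  neighbourhood.\<close>

lemma frac_bound:
  assumes sym: "\<And>e f. e \<in> E \<Longrightarrow> f \<in> E \<Longrightarrow> M e f = M f e"
    and h: "\<And>e. e \<in> E \<Longrightarrow> h e \<ge> 0" and r: "\<And>f. f \<in> E \<Longrightarrow> h f + (\<Sum>e\<in>E. M f e * h e) \<le> r"
  shows "(\<Sum>e\<in>E. a e * h e) \<le> r * (\<Sum>e\<in>E. a e * y e)"
proof -
  have "(\<Sum>e\<in>E. a e * h e) \<le> (\<Sum>e\<in>E. (a e * y e + (\<Sum>f\<in>E. M e f * (a f * y f))) * h e)"
    using cover h by (intro sum_mono mult_right_mono) auto
  also have "\<dots> = (\<Sum>e\<in>E. a e * y e * h e) + (\<Sum>e\<in>E. \<Sum>f\<in>E. M e f * (a f * y f) * h e)"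
    by (simp add: distrib_right sum.distrib sum_distrib_right)
  also have "(\<Sum>e\<in>E. \<Sum>f\<in>E. M e f * (a f * y f) * h e) = (\<Sum>f\<in>E. a f * y f * (\<Sum>e\<in>E. M f e * h e))"
    by (subst sum.swap) (auto simp: sum_distrib_left sum_distrib_right sym mult_ac intro!: sum.cong)
  also have "(\<Sum>e\<in>E. a e * y e * h e) + \<dots> = (\<Sum>f\<in>E. a f * y f * (h f + (\<Sum>e\<in>E. M f e * h e)))"
    by (simp add: distrib_left sum.distrib)
  also have "\<dots> \<le> (\<Sum>f\<in>E. a f * y f * r)"
    using r a_nonneg by (intro sum_mono mult_left_mono) auto
  finally show ?thesis by (simp add: sum_distrib_left mult_ac)
qed

end

text \<open>The pairs are oriented by the exponents \<open>\<eta>\<close>, which are known before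
  sampling; the orientation therefore does not depend on the random bits.\<close>

definition late_sum ::
  "nat set \<Rightarrow> (nat \<Rightarrow> nat \<Rightarrow> real) \<Rightarrow> (nat \<Rightarrow> nat) \<Rightarrow> (nat \<Rightarrow> real) \<Rightarrow> nat \<Rightarrow> real" where
  "late_sum E w \<eta> z e = (\<Sum>f\<in>E. w e f * (if \<eta> e \<le> \<eta> f then z f else 0))"

text \<open>Values below \<open>(1/2) ^ m\<close> are replaced by \<open>(1/2) ^ m\<close> on the sample \<open>Z\<close>, which contains \<open>e\<close>
  with probability \<open>(1/2) ^ (\<eta> e - m)\<close> (truncated subtraction), so expectations are preserved.\<close>

definition sampled :: "nat \<Rightarrow> (nat \<Rightarrow> nat) \<Rightarrow> nat set \<Rightarrow> nat \<Rightarrow> real" where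
  "sampled m \<eta> Z e = of_bool (e \<in> Z) * (1/2) ^ min (\<eta> e) m"

text \<open>Division by 64 shrinks the linear total once and the quadratic form twice, which makes
  the form small compared with the total. As 64 = 2^6, the values remain powers of two and only six
  levels are added.\<close>

definition pruned ::
  "nat set \<Rightarrow> (nat \<Rightarrow> nat \<Rightarrow> real) \<Rightarrow> (nat \<Rightarrow> real) \<Rightarrow> (nat \<Rightarrow> nat) \<Rightarrow> (nat \<Rightarrow> real) \<Rightarrow> nat \<Rightarrow> real" where
  "pruned E w a \<eta> z e = (if late_sum E w \<eta> z e \<le> 8 * a e then z e / 64 else 0)"

text \<open>Each pair is charged to the member with the smaller exponent. A surviving edge has late
  load at most \<open>8 * a e\<close> before the division by 64, hence at most
  \<open>a e / 8\<close> after it.\<close>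

lemma quad_pruned:
  fixes a z :: "nat \<Rightarrow> real" and \<eta> :: "nat \<Rightarrow> nat"
  assumes w: "\<And>e f. e \<in> E \<Longrightarrow> f \<in> E \<Longrightarrow> w e f \<ge> 0" and sym: "\<And>e f. e \<in> E \<Longrightarrow> f \<in> E \<Longrightarrow> w e f = w f e"
    and z: "\<And>e. e \<in> E \<Longrightarrow> z e \<ge> 0"
  defines "x \<equiv> pruned E w a \<eta> z"
  shows "8 * quad E w x \<le> (\<Sum>e\<in>E. a e * x e)"
proof -
  have x0: "x e \<ge> 0" "x e \<le> z e / 64" if "e \<in> E" for e using z[OF that] by (auto simp: x_def pruned_def)
  let ?F = "\<lambda>P. \<Sum>e\<in>E. \<Sum>f\<in>E. w e f * (x e * x f) * of_bool (P e f)"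
  have "2 * quad E w x = (\<Sum>e\<in>E. \<Sum>f\<in>E. w e f * (x e * x f) * 1)" by (simp add: quad_def)
  also have "\<dots> \<le> ?F (\<lambda>e f. \<eta> e \<le> \<eta> f) + ?F (\<lambda>e f. \<eta> f \<le> \<eta> e)"
    unfolding sum.distrib[symmetric] distrib_left[symmetric]
    using w x0 by (intro sum_mono mult_left_mono) auto
  also have "?F (\<lambda>e f. \<eta> f \<le> \<eta> e) = ?F (\<lambda>e f. \<eta> e \<le> \<eta> f)"
    by (subst sum.swap) (intro sum.cong refl, simp add: sym mult_ac)
  also have "?F (\<lambda>e f. \<eta> e \<le> \<eta> f) \<le> (\<Sum>e\<in>E. x e * (a e / 8))"
  proof (rule sum_mono)
    fix e assume e: "e \<in> E"
    show "(\<Sum>f\<in>E. w e f * (x e * x f) * of_bool (\<eta> e \<le> \<eta> f)) \<le> x e * (a e / 8)"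
    proof (cases "x e = 0")
      case False
      then have "late_sum E w \<eta> z e \<le> 8 * a e" by (auto simp: x_def pruned_def split: if_splits)
      moreover have "(\<Sum>f\<in>E. w e f * x f * of_bool (\<eta> e \<le> \<eta> f)) \<le> late_sum E w \<eta> z e / 64"
        unfolding late_sum_def sum_divide_distrib
      proof (rule sum_mono)
        fix f assume f: "f \<in> E"
        show "w e f * x f * of_bool (\<eta> e \<le> \<eta> f) \<le> w e f * (if \<eta> e \<le> \<eta> f then z f else 0) / 64"
          using mult_left_mono[OF x0(2)[OF f] w[OF e f]] by auto
      qed
      ultimately have "(\<Sum>f\<in>E. w e f * x f * of_bool (\<eta> e \<le> \<eta> f)) \<le> a e / 8" by linarith
      from mult_left_mono[OF this x0(1)[OF e]] show ?thesis by (simp add: sum_distrib_left mult_ac)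
    qed simp
  qed
  finally show ?thesis by (simp add: sum_divide_distrib[symmetric] mult_ac)
qed

lemma pruned_levels:
  assumes "z = sampled m \<eta> Z"
  shows "pruned E w a \<eta> z e = 0 \<or> (\<exists>j\<le>m + 6. pruned E w a \<eta> z e = (1/2) ^ j)"
proof -
  have "(1/2) ^ min (\<eta> e) m / 64 = (1/2::real) ^ (min (\<eta> e) m + 6)" by (simp add: power_add power_one_over)
  moreover have "min (\<eta> e) m + 6 \<le> m + 6" by simp
  ultimately show ?thesis unfolding pruned_def assms sampled_def
    by (cases "e \<in> Z") (auto intro!: exI[of _ "min (\<eta> e) m + 6"])
qed

section \<open>The distributed algorithm\<close>

lemma edge_local_overlap_sum_const:
  fixes K :: "'b \<Rightarrow> 'b \<Rightarrow> real"
  assumes "edge_local t P"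
  shows "edge_local (t + 2) (\<lambda>I e. \<Sum>f\<in>edges I. overlap I e f * K (P I e) (P I f))"
  using edge_local_map[OF edge_local_overlap_sum[OF assms, where K="\<lambda>_::unit. K"], of "\<lambda>g. g ()"] by simp

lemma edge_local_dbl: "edge_local (2 * i) (\<lambda>I. dbl (edges I) (overlap I) (wt I) s i)"
proof (induction i)
  case 0
  show ?case by (simp add: edge_local_const)
next
  case (Suc i)
  let ?n = "\<lambda>I. dbl (edges I) (overlap I) (wt I) s i"
  have P: "edge_local (2 * i) (\<lambda>I e. (wt I e, ?n I e))"
    by (intro edge_local_Pair Suc.IH edge_local_mono[OF edge_local_wt]) simp
  have S: "edge_local (2 * i + 2) (\<lambda>I e. \<Sum>f\<in>edges I. overlap I e f * (wt I f * 2 ^ ?n I f))"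
    using edge_local_overlap_sum_const[OF P, where K="\<lambda>_ q. fst q * 2 ^ snd q"] by simp
  have P': "edge_local (2 * i + 2) (\<lambda>I e. (wt I e, ?n I e))"
    by (rule edge_local_mono[OF P]) simp
  show ?case
    by (rule edge_local_cong[OF edge_local_map2[OF P' S, where
        h="\<lambda>p S. if fst p * 2 ^ snd p + S < fst p * 2 ^ s then Suc (snd p) else snd p"]]) simp_all
qed

text \<open>The weights have to be \<open>overlap\<close> times a function of the two states. This
  shape is kept when they are restricted to monochromatic pairs: the colour just joins the state, as
  the second colouring of a level requires.\<close>

lemma edge_local_hash_col:
  assumes P: "edge_local t P" and \<phi>: "edge_local t \<phi>"
    and W: "W = (\<lambda>I e f. overlap I e f * \<kappa> (P I e) (P I f))"
  shows "edge_local (t + 2) (\<lambda>I. hash_col (edges I) (W I) k j (\<phi> I))"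
proof -
  let ?K = "\<lambda>u p q. \<kappa> (fst p) (fst q) * of_bool (hash k j u (snd q) = hash k j u (snd p))"
  have S: "edge_local (t + 2) (\<lambda>I e u. \<Sum>f\<in>edges I. overlap I e f * ?K u (P I e, \<phi> I e) (P I f, \<phi> I f))"
    by (rule edge_local_overlap_sum[OF edge_local_Pair[OF P \<phi>]])
  have \<phi>': "edge_local (t + 2) \<phi>" by (rule edge_local_mono[OF \<phi>]) simp
  show ?thesis
    by (rule edge_local_cong[OF edge_local_map2[OF S \<phi>', where h="\<lambda>g b. let u = pick (k*j) g in u * (2*k*j) + hash k j u b"]])
      (simp_all add: hash_col_def W mult.assoc)
qed

lemma edge_local_greedy_col:
  assumes P: "edge_local t P" and \<phi>: "edge_local t \<phi>"
    and W: "W = (\<lambda>I e f. overlap I e f * \<kappa> (P I e) (P I f))"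
  shows "edge_local (t + 2 * i) (\<lambda>I. greedy_col (edges I) (W I) k (\<phi> I) i)"
proof (induction i)
  case 0
  show ?case by (simp add: edge_local_const)
next
  case (Suc i)
  let ?g = "\<lambda>I. greedy_col (edges I) (W I) k (\<phi> I) i"
  let ?K = "\<lambda>c p q. \<kappa> (fst p) (fst q) * of_bool (fst (snd q) < i \<and> snd (snd q) = c)"
  have Q: "edge_local (t + 2 * i) (\<lambda>I e. (P I e, \<phi> I e, ?g I e))"
    by (intro edge_local_Pair Suc.IH edge_local_mono[OF P] edge_local_mono[OF \<phi>]) simp_all
  have S: "edge_local (t + 2 * i + 2) (\<lambda>I e c. \<Sum>f\<in>edges I.
      overlap I e f * ?K c (P I e, \<phi> I e, ?g I e) (P I f, \<phi> I f, ?g I f))"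
    by (rule edge_local_overlap_sum[OF Q])
  have Q': "edge_local (t + 2 * i + 2) (\<lambda>I e. (P I e, \<phi> I e, ?g I e))"
    by (rule edge_local_mono[OF Q]) simp
  show ?case
    by (rule edge_local_cong[OF edge_local_map2[OF S Q', where h="\<lambda>g p. if fst (snd p) = i then pick k g else snd (snd p)"]])
      (simp_all add: W mult.assoc)
qed

abbreviation refine_time :: "nat \<Rightarrow> nat \<Rightarrow> nat" where
  "refine_time k j2 \<equiv> 4 + 2 * (k*j2*(2*k*j2))"

lemma edge_local_refine_col:
  assumes P: "edge_local t P" and \<phi>: "edge_local t \<phi>"
    and W: "W = (\<lambda>I e f. overlap I e f * \<kappa> (P I e) (P I f))"
  shows "edge_local (t + refine_time k j2) (\<lambda>I. refine_col (edges I) (W I) k j1 j2 (\<phi> I))"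
proof -
  have 1: "edge_local (t + 2) (\<lambda>I. hash_col (edges I) (W I) k j1 (\<phi> I))"
    by (rule edge_local_hash_col[OF P \<phi> W])
  have P1: "edge_local (t + 2) P" by (rule edge_local_mono[OF P]) simp
  have 2: "edge_local (t + 2 + 2) (\<lambda>I. hash_col (edges I) (W I) k j2 (hash_col (edges I) (W I) k j1 (\<phi> I)))"
    by (rule edge_local_hash_col[OF P1 1 W])
  have P2: "edge_local (t + 2 + 2) P" by (rule edge_local_mono[OF P]) simp
  show ?thesis
    by (rule edge_local_cong[OF edge_local_greedy_col[OF P2 2 W, of "k*j2*(2*k*j2)" k]])
      (simp_all add: refine_col_def)
qed

lemma edge_local_pair_col:
  assumes P: "edge_local t P" and \<phi>: "edge_local t \<phi>"
    and W: "W = (\<lambda>I e f. overlap I e f * \<kappa> (P I e) (P I f))"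
  shows "edge_local (t + 2 * refine_time k j2) (\<lambda>I. pair_col (edges I) (W I) k j1 j2 (\<phi> I))"
proof -
  let ?R = "refine_time k j2"
  let ?c = "\<lambda>I. refine_col (edges I) (W I) k j1 j2 (\<phi> I)"
  have c: "edge_local (t + ?R) ?c" by (rule edge_local_refine_col[OF P \<phi> W])
  have P': "edge_local (t + ?R) (\<lambda>I e. (P I e, ?c I e))"
    by (intro edge_local_Pair c edge_local_mono[OF P]) simp
  have \<phi>': "edge_local (t + ?R) \<phi>" by (rule edge_local_mono[OF \<phi>]) simp
  have "edge_local (t + ?R + ?R) (\<lambda>I. refine_col (edges I) (\<lambda>e f. W I e f * of_bool (?c I f = ?c I e)) k j1 j2 (\<phi> I))"
    by (rule edge_local_refine_col[OF P' \<phi>', where \<kappa>="\<lambda>p q. \<kappa> (fst p) (fst q) * of_bool (snd q = snd p)"])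
      (intro ext, simp add: W mult.assoc)
  moreover have "edge_local (t + ?R + ?R) ?c" by (rule edge_local_mono[OF c]) simp
  ultimately have "edge_local (t + ?R + ?R) (\<lambda>I e. ?c I e * k
      + refine_col (edges I) (\<lambda>e f. W I e f * of_bool (?c I f = ?c I e)) k j1 j2 (\<phi> I) e)"
    by (rule edge_local_map2[rotated])
  then show ?thesis by (rule edge_local_cong) (simp_all add: pair_col_def Let_def)
qed

definition weight_overlap :: "inst \<Rightarrow> nat \<Rightarrow> nat \<Rightarrow> real" where
  "weight_overlap I e f = overlap I e f * min (wt I e) (wt I f)"

lemma weight_overlap_mult:
  "weight_overlap I e f * x = overlap I e f * (min (wt I e) (wt I f) * x)"
  by (simp add: weight_overlap_def mult.assoc)

lemma edge_local_class_round:
  assumes c: "edge_local t c" and x: "edge_local t x"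
  shows "edge_local (t + 2 * i) (\<lambda>I. class_round (edges I) (wt I) (weight_overlap I) lm p (c I) (x I) i)"
proof (induction i)
  case 0
  show ?case using x by simp
next
  case (Suc i)
  let ?g = "\<lambda>I. class_round (edges I) (wt I) (weight_overlap I) lm p (c I) (x I) i"
  let ?K = "\<lambda>(a::real, xe::real, ce::nat, ge::real) (a'::real, xf::real, cf::nat, gf::real).
      min a a' * (if xf = p \<and> cf = i then 0 else gf)"
  let ?h = "\<lambda>S (a::real, xe::real, ce::nat, ge::real).
      if xe = p \<and> ce = i then (if lm * S < a then 2 * p else 0) else ge"
  have Q: "edge_local (t + 2 * i) (\<lambda>I e. (wt I e, x I e, c I e, ?g I e))"
    by (intro edge_local_Pair Suc.IH edge_local_mono[OF x] edge_local_mono[OF c]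
        edge_local_mono[OF edge_local_wt]) simp_all
  have S: "edge_local (t + 2 * i + 2) (\<lambda>I e. \<Sum>f\<in>edges I.
      overlap I e f * ?K (wt I e, x I e, c I e, ?g I e) (wt I f, x I f, c I f, ?g I f))"
    by (rule edge_local_overlap_sum_const[OF Q])
  have Q': "edge_local (t + 2 * i + 2) (\<lambda>I e. (wt I e, x I e, c I e, ?g I e))"
    by (rule edge_local_mono[OF Q]) simp
  show ?case
    by (rule edge_local_cong[OF edge_local_map2[OF S Q', where h="?h"]])
      (simp_all add: weight_overlap_mult)
qed

abbreviation level_time :: "nat \<Rightarrow> nat \<Rightarrow> nat" where
  "level_time k j2 \<equiv> 2 * refine_time k j2 + 2 * (k * k)"

lemma edge_local_level_round:
  assumes \<phi>: "edge_local t \<phi>" and x: "edge_local t x"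
  shows "edge_local (t + level_time k j2)
    (\<lambda>I. level_round (edges I) (wt I) (weight_overlap I) k j1 j2 (\<phi> I) l (x I))"
proof -
  let ?p = "(1/2) ^ l :: real"
  let ?W = "\<lambda>I e f. weight_overlap I e f * of_bool (x I e = ?p \<and> x I f = ?p)"
  have P: "edge_local t (\<lambda>I e. (wt I e, x I e))"
    by (intro edge_local_Pair x edge_local_mono[OF edge_local_wt]) simp
  have c: "edge_local (t + 2 * refine_time k j2) (\<lambda>I. pair_col (edges I) (?W I) k j1 j2 (\<phi> I))"
    by (rule edge_local_pair_col[OF P \<phi>,
          where \<kappa>="\<lambda>p q. min (fst p) (fst q) * of_bool (snd p = ?p \<and> snd q = ?p)"])
      (intro ext, simp add: weight_overlap_def mult.assoc)
  have x': "edge_local (t + 2 * refine_time k j2) x" by (rule edge_local_mono[OF x]) simp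
  show ?thesis
    by (rule edge_local_cong[OF edge_local_class_round[OF c x', of "k * k" "(1 + 27 / (real k)\<^sup>2) ^ (l - 1)" ?p]])
      (simp_all add: level_round_def Let_def)
qed

lemma edge_local_rounding:
  assumes \<phi>: "edge_local t \<phi>" and x: "edge_local t x"
  shows "edge_local (t + i * level_time k j2)
    (\<lambda>I. rounding (edges I) (wt I) (weight_overlap I) k j1 j2 (\<phi> I) L (x I) i)"
proof (induction i)
  case 0
  show ?case using x by simp
next
  case (Suc i)
  have "edge_local (t + i * level_time k j2) \<phi>" by (rule edge_local_mono[OF \<phi>]) simp
  from edge_local_level_round[OF this Suc.IH, of k j2 j1 "L - i"] show ?case
    by (rule edge_local_cong) simp_all
qed

locale matching_params =
  fixes s m k j1 j2 :: nat
begin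

definition exponent :: "inst \<Rightarrow> nat \<Rightarrow> nat" where
  "exponent I = halvings (edges I) (overlap I) (wt I) s"

text \<open>All values are powers of two, so the sampling probabilities are realised exactly by
  conjunctions of fair bits.\<close>

definition survives :: "inst \<Rightarrow> nat \<Rightarrow> bool" where
  "survives I e \<longleftrightarrow> (\<forall>i < exponent I e - m. rnd I (Inr e) i)"

definition start :: "inst \<Rightarrow> nat \<Rightarrow> real" where
  "start I = pruned (edges I) (weight_overlap I) (wt I) (exponent I)
     (sampled m (exponent I) {e \<in> edges I. survives I e})"

definition edge_col :: "inst \<Rightarrow> nat \<Rightarrow> nat" where
  "edge_col I e = col I (Inr e)"

definition rounded :: "inst \<Rightarrow> nat \<Rightarrow> real" where
  "rounded I = rounding (edges I) (wt I) (weight_overlap I) k j1 j2 (edge_col I) (m + 6) (start I) (m + 6)"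

definition chosen :: "inst \<Rightarrow> nat \<Rightarrow> bool" where
  "chosen I = unbeaten (edges I) (wt I) (overlap I) (edge_col I) (rounded I)"

text \<open>Doubling, pruning, the levels, and the comparison with the neighbours.\<close>

definition time :: nat where
  "time = 2 * s + 2 + (m + 6) * level_time k j2 + 2"

lemma edge_local_start: "edge_local (2 * s + 2) start"
proof -
  let ?z = "\<lambda>I. sampled m (exponent I) {e \<in> edges I. survives I e}"
  have \<eta>: "edge_local (2 * s) exponent"
    unfolding exponent_def halvings_def by (rule edge_local_map[OF edge_local_dbl])
  have r: "edge_local (2 * s) (\<lambda>I e. rnd I (Inr e))"
    by (rule edge_local_mono[OF edge_local_rnd]) simp
  have "edge_local (2 * s) (\<lambda>I e. of_bool (\<forall>i < exponent I e - m. rnd I (Inr e) i) * (1/2) ^ min (exponent I e) m :: real)"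
    by (rule edge_local_map2[OF \<eta> r, where h="\<lambda>n b. of_bool (\<forall>i < n - m. b i) * (1/2) ^ min n m"])
  then have z: "edge_local (2 * s) ?z"
    by (rule edge_local_cong) (simp_all add: sampled_def survives_def)
  let ?Q = "\<lambda>I e. (wt I e, exponent I e, ?z I e)"
  let ?K = "\<lambda>(a::real, n::nat, z::real) (a'::real, n'::nat, z'::real).
      min a a' * (if n \<le> n' then z' else 0)"
  let ?h = "\<lambda>S (a::real, n::nat, z::real). if S \<le> 8 * a then z / 64 else 0"
  have Q: "edge_local (2 * s) ?Q"
    by (intro edge_local_Pair \<eta> z edge_local_mono[OF edge_local_wt]) simp
  have S: "edge_local (2 * s + 2) (\<lambda>I e. \<Sum>f\<in>edges I. overlap I e f * ?K (?Q I e) (?Q I f))"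
    by (rule edge_local_overlap_sum_const[OF Q])
  have Q': "edge_local (2 * s + 2) ?Q" by (rule edge_local_mono[OF Q]) simp
  show ?thesis
    by (rule edge_local_cong[OF edge_local_map2[OF S Q', where h="?h"]])
      (simp_all add: start_def pruned_def late_sum_def weight_overlap_mult)
qed

lemma edge_local_chosen: "edge_local time chosen"
proof -
  let ?T = "2 * s + 2 + (m + 6) * level_time k j2"
  have \<phi>: "edge_local t edge_col" for t
    unfolding edge_col_def by (rule edge_local_mono[OF edge_local_col]) simp
  have x: "edge_local ?T rounded"
    unfolding rounded_def by (rule edge_local_rounding[OF \<phi> edge_local_start])
  let ?Q = "\<lambda>I e. (wt I e, edge_col I e, rounded I e)"
  let ?K = "\<lambda>(a::real, c::nat, x::real) (a'::real, c'::nat, x'::real).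
      of_bool (x' = 1 \<and> (a < a' \<or> a = a' \<and> c < c'))"
  have Q: "edge_local ?T ?Q"
    by (intro edge_local_Pair \<phi> x edge_local_mono[OF edge_local_wt]) simp
  have S: "edge_local (?T + 2) (\<lambda>I e. \<Sum>f\<in>edges I. overlap I e f * ?K (?Q I e) (?Q I f))"
    by (rule edge_local_overlap_sum_const[OF Q])
  have Q': "edge_local (?T + 2) rounded" by (rule edge_local_mono[OF x]) simp
  show ?thesis
    by (rule edge_local_cong[OF edge_local_map2[OF S Q', where h="\<lambda>S x. x = 1 \<and> S \<le> 0"]])
      (simp_all add: chosen_def unbeaten_def beats_def time_def)
qed

end

section \<open>Random sampling\<close>

definition all_heads :: "nat \<Rightarrow> (nat \<Rightarrow> bool) \<Rightarrow> bool" where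
  "all_heads b \<omega> \<longleftrightarrow> (\<forall>i<b. \<omega> i)"

interpretation bits: product_prob_space "\<lambda>_::nat. measure_pmf (bernoulli_pmf (1/2))" UNIV
  by unfold_locales

lemma space_bits_M: "space bits_M = UNIV"
  by (simp add: bits_M_def space_PiM)

lemma prob_space_bits_M: "prob_space bits_M"
  unfolding bits_M_def by (rule prob_space_PiM) (rule prob_space_measure_pmf)

lemma pred_all_heads [measurable]: "Measurable.pred bits_M (all_heads b)"
  unfolding all_heads_def[abs_def] bits_M_def by measurable

lemma prob_all_heads: "measure bits_M {\<omega>. all_heads b \<omega>} = (1/2) ^ b"
proof -
  have "emeasure bits_M {\<omega>\<in>space bits_M. \<forall>i\<in>{..<b}. \<omega> i \<in> {True}}
      = (\<Prod>i\<in>{..<b}. emeasure (measure_pmf (bernoulli_pmf (1/2))) {True})"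
    unfolding bits_M_def by (rule bits.emeasure_PiM_Collect) auto
  also have "\<dots> = ennreal ((1/2) ^ b)"
    by (simp add: emeasure_pmf_single ennreal_power[symmetric] prod_constant)
  also have "{\<omega>\<in>space bits_M. \<forall>i\<in>{..<b}. \<omega> i \<in> {True}} = {\<omega>. all_heads b \<omega>}"
    by (auto simp: all_heads_def space_bits_M)
  finally show ?thesis by (simp add: measure_def)
qed

lemma integral_all_heads:
  fixes u v :: real
  shows "(\<integral>\<omega>. (if all_heads b \<omega> then u else v) \<partial>bits_M) = (1/2) ^ b * u + (1 - (1/2) ^ b) * v"
proof -
  interpret prob_space bits_M by (rule prob_space_bits_M)
  have S: "{\<omega>. all_heads b \<omega>} \<in> sets bits_M"
    using pred_all_heads[of b] by (simp add: pred_def space_bits_M)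
  have "(\<integral>\<omega>. (if all_heads b \<omega> then u else v) \<partial>bits_M)
      = (\<integral>\<omega>. v + (u - v) * indicator {\<omega>. all_heads b \<omega>} \<omega> \<partial>bits_M)"
    by (intro Bochner_Integration.integral_cong) auto
  also have "\<dots> = v + (u - v) * (1/2) ^ b"
    using S by (subst Bochner_Integration.integral_add)
      (auto simp: prob_space prob_all_heads emeasure_eq_measure)
  finally show ?thesis by (simp add: algebra_simps)
qed

definition survivors :: "nat set \<Rightarrow> (nat \<Rightarrow> nat) \<Rightarrow> (nat + nat \<Rightarrow> nat \<Rightarrow> bool) \<Rightarrow> nat set" where
  "survivors E b \<omega> = {e \<in> E. all_heads (b e) (\<omega> (Inr e))}"

locale sampling =
  fixes V E :: "nat set" and b :: "nat \<Rightarrow> nat"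
  assumes finV: "finite V" and finE: "finite E"
begin

sublocale prob_space "rand_M V E"
  unfolding rand_M_def by (rule prob_space_PiM) (rule prob_space_bits_M)

text \<open>The random bits enter the algorithm only through this set, which takes finitely many
  values. Every event defined by it is therefore measurable and every real function of it
  integrable.\<close>

lemma survivors_measurable: "survivors E b \<in> measurable (rand_M V E) (count_space (Pow E))"
proof (subst measurable_count_space_eq2)
  have "{\<omega>\<in>space (rand_M V E). survivors E b \<omega> = Z} \<in> sets (rand_M V E)" if "Z \<in> Pow E" for Z
  proof -
    have "Measurable.pred (rand_M V E) (\<lambda>\<omega>. \<forall>e\<in>E. all_heads (b e) (\<omega> (Inr e)) \<longleftrightarrow> e \<in> Z)"
      unfolding rand_M_def
    proof (rule pred_intros_finite(3)[OF finE])
      fix e assume "e \<in> E"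
      then have "(\<lambda>\<omega>. \<omega> (Inr e)) \<in> measurable (PiM (inc_nodes V E) (\<lambda>_. bits_M)) bits_M"
        by (intro measurable_component_singleton) (auto simp: inc_nodes_def)
      from measurable_compose[OF this pred_all_heads[of "b e"]]
      show "Measurable.pred (PiM (inc_nodes V E) (\<lambda>_. bits_M)) (\<lambda>\<omega>. all_heads (b e) (\<omega> (Inr e)) \<longleftrightarrow> e \<in> Z)"
        by (cases "e \<in> Z") (simp_all add: pred_intros_logic(2))
    qed
    moreover have "{\<omega>\<in>space (rand_M V E). survivors E b \<omega> = Z}
        = {\<omega>\<in>space (rand_M V E). \<forall>e\<in>E. all_heads (b e) (\<omega> (Inr e)) \<longleftrightarrow> e \<in> Z}"
      using that by (auto simp: survivors_def)
    ultimately show ?thesis by (simp add: pred_def)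
  qed
  then show "survivors E b \<in> space (rand_M V E) \<rightarrow> Pow E
      \<and> (\<forall>a\<in>Pow E. survivors E b -` {a} \<inter> space (rand_M V E) \<in> sets (rand_M V E))"
    by (auto simp: survivors_def vimage_def Int_def conj_commute)
qed (simp add: finE)

lemma survivors_sets: "{\<omega>\<in>space (rand_M V E). P (survivors E b \<omega>)} \<in> sets (rand_M V E)"
proof -
  have "P \<in> measurable (count_space (Pow E)) (count_space UNIV)" by simp
  from measurable_compose[OF survivors_measurable this] show ?thesis by (simp add: pred_def)
qed

lemma survivors_integrable:
  fixes F :: "nat set \<Rightarrow> real"
  shows "integrable (rand_M V E) (\<lambda>\<omega>. F (survivors E b \<omega>))"
proof (rule integrable_const_bound[where B="\<Sum>Z\<in>Pow E. \<bar>F Z\<bar>"])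
  have "F \<in> measurable (count_space (Pow E)) borel" by simp
  from measurable_compose[OF survivors_measurable this]
  show "(\<lambda>\<omega>. F (survivors E b \<omega>)) \<in> borel_measurable (rand_M V E)" .
  have "\<bar>F (survivors E b \<omega>)\<bar> \<le> (\<Sum>Z\<in>Pow E. \<bar>F Z\<bar>)" for \<omega>
    by (rule member_le_sum) (auto simp: survivors_def finE)
  then show "AE \<omega> in rand_M V E. norm (F (survivors E b \<omega>)) \<le> (\<Sum>Z\<in>Pow E. \<bar>F Z\<bar>)" by simp
qed

text \<open>Independence, in the form used for exponential moments. The probability space also
  contains the bits of the vertices, which contribute factors 1.\<close>

lemma expectation_prod:
  fixes u v :: "nat \<Rightarrow> real"
  shows "(\<integral>\<omega>. (\<Prod>e\<in>E. if e \<in> survivors E b \<omega> then u e else v e) \<partial>rand_M V E)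
     = (\<Prod>e\<in>E. (1/2) ^ b e * u e + (1 - (1/2) ^ b e) * v e)"
proof -
  interpret bm: prob_space bits_M by (rule prob_space_bits_M)
  interpret product_sigma_finite "\<lambda>_::nat+nat. bits_M"
    by unfold_locales
  define g :: "nat + nat \<Rightarrow> (nat \<Rightarrow> bool) \<Rightarrow> real" where "g = (\<lambda>x \<omega>. case x of Inl _ \<Rightarrow> 1 | Inr e \<Rightarrow> if all_heads (b e) \<omega> then u e else v e)"
  have gint: "integrable bits_M (g x)" for x
  proof (rule bm.integrable_const_bound[where B="case x of Inl _ \<Rightarrow> 1 | Inr e \<Rightarrow> \<bar>u e\<bar> + \<bar>v e\<bar>"])
    show "g x \<in> borel_measurable bits_M" by (cases x) (simp_all add: g_def)
  qed (auto simp: g_def split: sum.split)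
  have E_prod: "(\<Prod>x\<in>inc_nodes V E. G x) = (\<Prod>e\<in>E. G (Inr e))" if "\<And>v. G (Inl v) = 1" for G :: "nat + nat \<Rightarrow> real"
  proof -
    have "(\<Prod>x\<in>inc_nodes V E. G x) = (\<Prod>x\<in>Inr ` E. G x)"
      by (rule prod.mono_neutral_right) (auto simp: inc_nodes_def finV finE that)
    also have "\<dots> = (\<Prod>e\<in>E. G (Inr e))" by (simp add: prod.reindex)
    finally show ?thesis .
  qed
  have "(\<integral>\<omega>. (\<Prod>e\<in>E. if e \<in> survivors E b \<omega> then u e else v e) \<partial>rand_M V E)
      = (\<integral>\<omega>. (\<Prod>x\<in>inc_nodes V E. g x (\<omega> x)) \<partial>PiM (inc_nodes V E) (\<lambda>_. bits_M))"
    unfolding rand_M_def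
    by (intro Bochner_Integration.integral_cong refl)
      (subst E_prod, auto simp: g_def survivors_def intro!: prod.cong)
  also have "\<dots> = (\<Prod>x\<in>inc_nodes V E. integral\<^sup>L bits_M (g x))"
    by (rule product_integral_prod) (auto simp: inc_nodes_def finV finE gint)
  also have "\<dots> = (\<Prod>e\<in>E. integral\<^sup>L bits_M (g (Inr e)))"
    by (rule E_prod) (simp add: g_def bm.prob_space)
  also have "\<dots> = (\<Prod>e\<in>E. (1/2) ^ b e * u e + (1 - (1/2) ^ b e) * v e)"
    by (simp add: g_def integral_all_heads)
  finally show ?thesis .
qed

lemma markov:
  assumes "\<And>Z. F Z \<ge> 0" "c > 0"
  shows "prob {\<omega>\<in>space (rand_M V E). c \<le> F (survivors E b \<omega>)} \<le> (\<integral>\<omega>. F (survivors E b \<omega>) \<partial>rand_M V E) / c"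
  using assms by (intro integral_Markov_inequality_measure[where A="{}"] survivors_integrable) auto

end

section \<open>Exponential moments of a single sampled edge\<close>

lemma exp_neg_le:
  fixes u :: real
  assumes "0 \<le> u" "u \<le> 1"
  shows "exp (- u) \<le> 1 - u / 2"
proof -
  have "1 \<le> (1 - u/2) * (1 + u)"
    using mult_nonneg_nonneg[of u "1 - u"] assms by (simp add: algebra_simps)
  also have "\<dots> \<le> (1 - u/2) * exp u" using assms by (intro mult_left_mono exp_ge_add_one_self) auto
  finally show ?thesis by (simp add: exp_minus field_simps)
qed

text \<open>The alternative \<open>q = 1\<close> covers the edges that are kept with certainty:
  their contribution \<open>u\<close> may be large, but nothing about them is random.\<close>

lemma mix_exp_neg_le:
  fixes q u :: real
  assumes "0 \<le> q" "0 \<le> u" "q = 1 \<or> u \<le> 1"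
  shows "q * exp (- u) + (1 - q) \<le> exp (- (q * u / 2))"
proof (cases "q = 1")
  case False
  then have "q * exp (- u) + (1 - q) \<le> q * (1 - u / 2) + (1 - q)"
    using assms by (intro add_right_mono mult_left_mono exp_neg_le) auto
  also have "\<dots> \<le> exp (- (q * u / 2))" using exp_ge_add_one_self[of "- (q * u / 2)"] by (simp add: algebra_simps)
  finally show ?thesis .
qed (use assms in simp)

lemma mix_exp_le:
  fixes q u :: real
  assumes "0 \<le> q" "0 \<le> u" "q = 1 \<or> u \<le> 1"
  shows "q * exp u + (1 - q) \<le> exp (2 * (q * u))"
proof (cases "q = 1")
  case False
  then have "exp u \<le> 1 + u + u\<^sup>2" using assms by (intro exp_bound) auto
  also have "u\<^sup>2 \<le> u" using assms False mult_left_mono[of u 1 u] by (simp add: power2_eq_square)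
  finally have "q * exp u + (1 - q) \<le> q * (1 + 2 * u) + (1 - q)"
    using assms by (intro add_right_mono mult_left_mono) auto
  also have "\<dots> \<le> exp (2 * (q * u))" using exp_ge_add_one_self[of "2 * (q * u)"] by (simp add: algebra_simps)
  finally show ?thesis .
qed (use assms in simp)

locale sampled_weights =
  fixes V E :: "nat set" and a :: "nat \<Rightarrow> real" and w :: "nat \<Rightarrow> nat \<Rightarrow> real" and \<eta> :: "nat \<Rightarrow> nat"
    and m :: nat and \<rho> \<delta> A :: real
  assumes finV: "finite V" and finE: "finite E"
    and a: "\<And>e. e \<in> E \<Longrightarrow> a e \<ge> 0" and w: "\<And>e f. e \<in> E \<Longrightarrow> f \<in> E \<Longrightarrow> w e f \<ge> 0"
    and w_le: "\<And>e f. e \<in> E \<Longrightarrow> f \<in> E \<Longrightarrow> w e f \<le> \<rho> * a e"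
    and w_refl: "\<And>e. e \<in> E \<Longrightarrow> w e e = 0"
    and \<rho>: "\<rho> > 0" and \<delta>: "0 < \<delta>" "\<delta> < 1/2" and m: "8 * \<rho> * ln (1/\<delta>) \<le> 2 ^ m"
    and A: "A = (\<Sum>e\<in>E. a e * (1/2) ^ \<eta> e)"
    and a_le: "\<And>e. e \<in> E \<Longrightarrow> a e \<le> \<rho> * A"
    and late: "\<And>e. e \<in> E \<Longrightarrow> late_sum E w \<eta> (\<lambda>f. (1/2) ^ \<eta> f) e \<le> 2 * a e"
begin

abbreviation "b \<equiv> \<lambda>e. \<eta> e - m"

sublocale sampling V E b
  by unfold_locales (rule finV, rule finE)

abbreviation "N \<equiv> rand_M V E"
abbreviation "Z \<equiv> survivors E b"
abbreviation q :: "nat \<Rightarrow> real" where "q e \<equiv> (1/2) ^ b e"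
abbreviation \<zeta> :: "nat \<Rightarrow> real" where "\<zeta> e \<equiv> (1/2) ^ min (\<eta> e) m"

lemma q_\<zeta>: "q e * \<zeta> e = (1/2) ^ \<eta> e"
  by (subst power_add[symmetric]) (simp add: min_def)

lemma q_or_\<zeta>: "q e = 1 \<or> \<zeta> e = 1 / 2 ^ m"
  by (cases "\<eta> e \<le> m") (auto simp: min_def power_one_over)

lemma total_lower_tail:
  assumes A0: "A > 0"
  shows "prob {\<omega>\<in>space N. (\<Sum>e\<in>E. a e * sampled m \<eta> (Z \<omega>) e) \<le> A / 4} \<le> exp (- (2 ^ m / (4 * \<rho>)))"
proof -
  \<comment> \<open>The largest value for which \<open>a_le\<close> guarantees
    \<open>\<theta> * a e * \<zeta> e\<close> \<le> 1 on the edges that are really sampled, where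
    \<zeta> e = 1 / 2^m.\<close>
  define \<theta> where "\<theta> = 2 ^ m / (\<rho> * A)"
  have \<theta>: "\<theta> > 0" using \<rho> A0 by (simp add: \<theta>_def)
  define F where "F = (\<lambda>Z. exp (- \<theta> * (\<Sum>e\<in>E. a e * sampled m \<eta> Z e)))"
  have F: "F (Z \<omega>) = (\<Prod>e\<in>E. if e \<in> Z \<omega> then exp (- (\<theta> * a e * \<zeta> e)) else 1)" for \<omega>
    unfolding F_def sum_distrib_left exp_sum[OF finE]
    by (intro prod.cong refl) (auto simp: sampled_def)
  have "{\<omega>\<in>space N. (\<Sum>e\<in>E. a e * sampled m \<eta> (Z \<omega>) e) \<le> A / 4} = {\<omega>\<in>space N. exp (- (\<theta> * (A / 4))) \<le> F (Z \<omega>)}"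
    using \<theta> by (auto simp: F_def)
  also have "prob \<dots> \<le> (\<integral>\<omega>. F (Z \<omega>) \<partial>N) / exp (- (\<theta> * (A / 4)))"
    by (rule markov) (auto simp: F_def)
  also have "(\<integral>\<omega>. F (Z \<omega>) \<partial>N) = (\<Prod>e\<in>E. q e * exp (- (\<theta> * a e * \<zeta> e)) + (1 - q e) * 1)"
    unfolding F by (rule expectation_prod)
  also have "\<dots> \<le> (\<Prod>e\<in>E. exp (- (\<theta> / 2 * (a e * (1/2) ^ \<eta> e))))"
  proof (rule prod_mono, intro conjI)
    fix e assume e: "e \<in> E"
    show "0 \<le> q e * exp (- (\<theta> * a e * \<zeta> e)) + (1 - q e) * 1" by (simp add: power_le_one)
    have "q e = 1 \<or> \<theta> * a e * \<zeta> e \<le> 1"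
      using q_or_\<zeta>[of e] a_le[OF e] \<rho> A0 by (auto simp: \<theta>_def field_simps)
    then have "q e * exp (- (\<theta> * a e * \<zeta> e)) + (1 - q e) \<le> exp (- (q e * (\<theta> * a e * \<zeta> e) / 2))"
      using \<theta> a[OF e] by (intro mix_exp_neg_le) auto
    also have "q e * (\<theta> * a e * \<zeta> e) / 2 = \<theta> / 2 * (a e * (q e * \<zeta> e))" by simp
    finally show "q e * exp (- (\<theta> * a e * \<zeta> e)) + (1 - q e) * 1 \<le> exp (- (\<theta> / 2 * (a e * (1/2) ^ \<eta> e)))"
      by (simp only: q_\<zeta> mult_1_right)
  qed
  also have "\<dots> = exp (- (\<theta> / 2 * A))"
    by (simp add: A exp_sum[OF finE, symmetric] sum_distrib_left sum_negf)
  finally have "prob {\<omega>\<in>space N. (\<Sum>e\<in>E. a e * sampled m \<eta> (Z \<omega>) e) \<le> A / 4}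
      \<le> exp (- (\<theta> / 2 * A)) / exp (- (\<theta> * (A / 4)))" by (simp add: divide_right_mono)
  also have "\<dots> = exp (- (\<theta> * A / 4))" by (simp add: exp_diff[symmetric])
  also have "\<theta> * A / 4 = 2 ^ m / (4 * \<rho>)" using A0 by (simp add: \<theta>_def)
  finally show ?thesis .
qed

lemma expected_overload:
  assumes e: "e \<in> E"
  shows "(\<integral>\<omega>. a e * sampled m \<eta> (Z \<omega>) e * of_bool (8 * a e < late_sum E w \<eta> (sampled m \<eta> (Z \<omega>)) e) \<partial>N)
     \<le> a e * (1/2) ^ \<eta> e * exp (- (4 * 2 ^ m / \<rho>))"
proof (cases "a e = 0")
  case False
  then have a0: "a e > 0" using a[OF e] by simp
  \<comment> \<open>As for the total, now with \<open>w_le\<close> bounding the contribution of one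
    neighbour to the load of \<open>e\<close>.\<close>
  define \<theta> where "\<theta> = 2 ^ m / (\<rho> * a e)"
  have \<theta>: "\<theta> > 0" using \<rho> a0 by (simp add: \<theta>_def)
  define lt where "lt = (\<lambda>f. w e f * of_bool (\<eta> e \<le> \<eta> f))"
  \<comment> \<open>The factor at \<open>e\<close> is its sampled value instead of an exponential.
    Since \<open>w e e = 0\<close>, the load of \<open>e\<close> does not involve \<open>e\<close>
    itself, and the whole product has independent factors.\<close>
  define u where "u = (\<lambda>f. if f = e then \<zeta> e else exp (\<theta> * lt f * \<zeta> f))"
  define v where "v = (\<lambda>f. if f = e then 0 else 1 :: real)"
  have ls: "late_sum E w \<eta> z e = (\<Sum>f\<in>E. lt f * z f)" for z
    by (auto simp: late_sum_def lt_def intro!: sum.cong)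
  have prod: "sampled m \<eta> (Z \<omega>) e * exp (\<theta> * late_sum E w \<eta> (sampled m \<eta> (Z \<omega>)) e)
      = (\<Prod>f\<in>E. if f \<in> Z \<omega> then u f else v f)" for \<omega>
  proof -
    have "exp (\<theta> * late_sum E w \<eta> (sampled m \<eta> (Z \<omega>)) e) = (\<Prod>f\<in>E. exp (\<theta> * (lt f * sampled m \<eta> (Z \<omega>) f)))"
      unfolding ls sum_distrib_left by (rule exp_sum[OF finE])
    also have "\<dots> = (\<Prod>f\<in>E - {e}. exp (\<theta> * (lt f * sampled m \<eta> (Z \<omega>) f)))"
      using w_refl[OF e] by (subst prod.remove[OF finE e]) (simp add: lt_def)
    also have "\<dots> = (\<Prod>f\<in>E - {e}. if f \<in> Z \<omega> then u f else v f)"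
      by (intro prod.cong refl) (auto simp: u_def v_def sampled_def)
    finally show ?thesis
      by (subst prod.remove[OF finE e]) (auto simp: u_def v_def sampled_def)
  qed
  have "(\<integral>\<omega>. a e * sampled m \<eta> (Z \<omega>) e * of_bool (8 * a e < late_sum E w \<eta> (sampled m \<eta> (Z \<omega>)) e) \<partial>N)
      \<le> (\<integral>\<omega>. a e * exp (- (\<theta> * (8 * a e))) * (\<Prod>f\<in>E. if f \<in> Z \<omega> then u f else v f) \<partial>N)"
  proof (intro integral_mono survivors_integrable
      [of "\<lambda>Z. a e * sampled m \<eta> Z e * of_bool (8 * a e < late_sum E w \<eta> (sampled m \<eta> Z) e)"]
      survivors_integrable[of "\<lambda>Z. a e * exp (- (\<theta> * (8 * a e))) * (\<Prod>f\<in>E. if f \<in> Z then u f else v f)"])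
    fix \<omega>
    let ?L = "late_sum E w \<eta> (sampled m \<eta> (Z \<omega>)) e"
    have "of_bool (8 * a e < ?L) \<le> exp (\<theta> * (?L - 8 * a e))"
      using \<theta> by (auto simp: of_bool_def intro!: mult_nonneg_nonneg)
    also have "\<dots> = exp (- (\<theta> * (8 * a e))) * exp (\<theta> * ?L)"
      by (simp add: exp_add[symmetric] algebra_simps)
    finally have "a e * sampled m \<eta> (Z \<omega>) e * of_bool (8 * a e < ?L)
        \<le> a e * sampled m \<eta> (Z \<omega>) e * (exp (- (\<theta> * (8 * a e))) * exp (\<theta> * ?L))"
      using a0 by (intro mult_left_mono) (auto simp: sampled_def)
    then show "a e * sampled m \<eta> (Z \<omega>) e * of_bool (8 * a e < ?L)
        \<le> a e * exp (- (\<theta> * (8 * a e))) * (\<Prod>f\<in>E. if f \<in> Z \<omega> then u f else v f)"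
      unfolding prod[symmetric] by (simp add: mult_ac)
  qed
  also have "\<dots> = a e * exp (- (\<theta> * (8 * a e))) * (\<Prod>f\<in>E. q f * u f + (1 - q f) * v f)"
    by (simp add: expectation_prod)
  \<comment> \<open>The mean late load is at most \<open>2 * a e\<close>, and
    \<open>mix_exp_le\<close> loses a factor 2; the threshold \<open>8 * a e\<close> leaves a gap of
    \<open>4 * a e\<close> in the exponent.\<close>
  also have "\<dots> \<le> a e * exp (- (\<theta> * (8 * a e))) * ((1/2) ^ \<eta> e * exp (\<theta> * (4 * a e)))"
  proof (rule mult_left_mono)
    have "(\<Prod>f\<in>E. q f * u f + (1 - q f) * v f) = (1/2) ^ \<eta> e * (\<Prod>f\<in>E - {e}. q f * u f + (1 - q f) * v f)"
      by (subst prod.remove[OF finE e]) (simp add: u_def v_def q_\<zeta>)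
    also have "\<dots> \<le> (1/2) ^ \<eta> e * (\<Prod>f\<in>E - {e}. exp (2 * \<theta> * (lt f * (1/2) ^ \<eta> f)))"
    proof (rule mult_left_mono, rule prod_mono, intro conjI)
      fix f assume f: "f \<in> E - {e}"
      then have fE: "f \<in> E" by simp
      have lt: "0 \<le> lt f" "lt f \<le> \<rho> * a e" using w[OF e fE] w_le[OF e fE] by (auto simp: lt_def)
      show "0 \<le> q f * u f + (1 - q f) * v f" using f by (simp add: u_def v_def power_le_one)
      have "\<theta> * lt f * (1 / 2 ^ m) \<le> 1" using lt \<rho> a0 by (simp add: \<theta>_def field_simps)
      then have "q f = 1 \<or> \<theta> * lt f * \<zeta> f \<le> 1" using q_or_\<zeta>[of f] by auto
      then have "q f * exp (\<theta> * lt f * \<zeta> f) + (1 - q f) \<le> exp (2 * (q f * (\<theta> * lt f * \<zeta> f)))"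
        using \<theta> lt by (intro mix_exp_le) auto
      also have "2 * (q f * (\<theta> * lt f * \<zeta> f)) = 2 * \<theta> * (lt f * (q f * \<zeta> f))" by simp
      finally show "q f * u f + (1 - q f) * v f \<le> exp (2 * \<theta> * (lt f * (1/2) ^ \<eta> f))"
        unfolding q_\<zeta> using f by (simp add: u_def v_def)
    qed simp
    also have "(\<Prod>f\<in>E - {e}. exp (2 * \<theta> * (lt f * (1/2) ^ \<eta> f))) = exp (2 * \<theta> * (\<Sum>f\<in>E - {e}. lt f * (1/2) ^ \<eta> f))"
      by (simp add: exp_sum finE sum_distrib_left)
    also have "(\<Sum>f\<in>E - {e}. lt f * (1/2) ^ \<eta> f) = late_sum E w \<eta> (\<lambda>f. (1/2) ^ \<eta> f) e"
      using w_refl[OF e] unfolding ls by (simp add: sum.remove[OF finE e] lt_def)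
    also have "(1/2) ^ \<eta> e * exp (2 * \<theta> * late_sum E w \<eta> (\<lambda>f. (1/2) ^ \<eta> f) e) \<le> (1/2) ^ \<eta> e * exp (\<theta> * (4 * a e))"
      using late[OF e] \<theta> by (intro mult_left_mono) auto
    finally show "(\<Prod>f\<in>E. q f * u f + (1 - q f) * v f) \<le> (1/2) ^ \<eta> e * exp (\<theta> * (4 * a e))"
      by simp
  qed (use a0 in simp)
  also have "\<dots> = a e * (1/2) ^ \<eta> e * exp (- (\<theta> * (4 * a e)))"
    by (simp add: exp_add[symmetric] mult_ac)
  also have "\<theta> * (4 * a e) = 4 * 2 ^ m / \<rho>" using a0 by (simp add: \<theta>_def)
  finally show ?thesis .
qed simp

text \<open>Overloads of different edges are dependent, but the expected overloaded weight is
  already an exponentially small fraction of \<open>A\<close>, so Markov's inequality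
  suffices.\<close>

lemma overload_tail:
  assumes A0: "A > 0"
  defines "ovl \<equiv> \<lambda>Z. \<Sum>e\<in>E. a e * sampled m \<eta> Z e * of_bool (8 * a e < late_sum E w \<eta> (sampled m \<eta> Z) e)"
  shows "prob {\<omega>\<in>space N. A / 8 \<le> ovl (Z \<omega>)} \<le> 8 * exp (- (4 * 2 ^ m / \<rho>))"
proof -
  have "prob {\<omega>\<in>space N. A / 8 \<le> (\<Sum>e\<in>E. max 0 (a e) * sampled m \<eta> (Z \<omega>) e
          * of_bool (8 * a e < late_sum E w \<eta> (sampled m \<eta> (Z \<omega>)) e))}
      \<le> (\<integral>\<omega>. (\<Sum>e\<in>E. max 0 (a e) * sampled m \<eta> (Z \<omega>) e
          * of_bool (8 * a e < late_sum E w \<eta> (sampled m \<eta> (Z \<omega>)) e)) \<partial>N) / (A / 8)"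
    using A0 by (intro markov[of "\<lambda>Z. \<Sum>e\<in>E. max 0 (a e) * sampled m \<eta> Z e
          * of_bool (8 * a e < late_sum E w \<eta> (sampled m \<eta> Z) e)"] sum_nonneg) (auto simp: sampled_def)
  then have "prob {\<omega>\<in>space N. A / 8 \<le> ovl (Z \<omega>)} \<le> (\<integral>\<omega>. ovl (Z \<omega>) \<partial>N) / (A / 8)"
    using a by (simp add: ovl_def max_def cong: sum.cong)
  also have "(\<integral>\<omega>. ovl (Z \<omega>) \<partial>N) = (\<Sum>e\<in>E. \<integral>\<omega>. a e * sampled m \<eta> (Z \<omega>) e
      * of_bool (8 * a e < late_sum E w \<eta> (sampled m \<eta> (Z \<omega>)) e) \<partial>N)"
    unfolding ovl_def by (rule Bochner_Integration.integral_sum) (rule survivors_integrable)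
  also have "\<dots> \<le> (\<Sum>e\<in>E. a e * (1/2) ^ \<eta> e * exp (- (4 * 2 ^ m / \<rho>)))"
    by (intro sum_mono expected_overload)
  also have "\<dots> = A * exp (- (4 * 2 ^ m / \<rho>))" by (simp add: A sum_distrib_right)
  finally show ?thesis using A0 by (simp add: divide_right_mono field_simps)
qed

text \<open>Unless a bad event occurs, more than A/4 is sampled and less than A/8 of it is
  overloaded; the remaining A/8 is divided by 64. The choice of \<open>m\<close> bounds the bad
  events by \<delta>^2 and 8 \<delta>^5, both at most \<delta>/2 because \<delta> < 1/2.\<close>

lemma pruned_weight_prob:
  "1 - \<delta> \<le> prob {\<omega>\<in>space N. A / 512 \<le> (\<Sum>e\<in>E. a e * pruned E w a \<eta> (sampled m \<eta> (Z \<omega>)) e)}"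
proof (cases "A > 0")
  case False
  have "0 \<le> (\<Sum>e\<in>E. a e * pruned E w a \<eta> (sampled m \<eta> (Z \<omega>)) e)" for \<omega>
    using a by (intro sum_nonneg) (auto simp: pruned_def sampled_def)
  then have "{\<omega>\<in>space N. A / 512 \<le> (\<Sum>e\<in>E. a e * pruned E w a \<eta> (sampled m \<eta> (Z \<omega>)) e)} = space N"
    using False by (auto intro: order_trans[of _ 0])
  then show ?thesis using \<delta> by (simp add: prob_space)
next
  case A0: True
  define ovl where "ovl = (\<lambda>Z. \<Sum>e\<in>E. a e * sampled m \<eta> Z e * of_bool (8 * a e < late_sum E w \<eta> (sampled m \<eta> Z) e))"
  let ?B1 = "{\<omega>\<in>space N. (\<Sum>e\<in>E. a e * sampled m \<eta> (Z \<omega>) e) \<le> A / 4}"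
  let ?B2 = "{\<omega>\<in>space N. A / 8 \<le> ovl (Z \<omega>)}"
  let ?G = "{\<omega>\<in>space N. A / 512 \<le> (\<Sum>e\<in>E. a e * pruned E w a \<eta> (sampled m \<eta> (Z \<omega>)) e)}"
  have sets: "?B1 \<in> events" "?B2 \<in> events" "?G \<in> events"
    using survivors_sets[of "\<lambda>Z. (\<Sum>e\<in>E. a e * sampled m \<eta> Z e) \<le> A / 4"]
      survivors_sets[of "\<lambda>Z. A / 8 \<le> ovl Z"]
      survivors_sets[of "\<lambda>Z. A / 512 \<le> (\<Sum>e\<in>E. a e * pruned E w a \<eta> (sampled m \<eta> Z) e)"] by simp_all
  have lnd: "ln (1/\<delta>) = - ln \<delta>" using \<delta> by (simp add: ln_div)
  have \<delta>4: "\<delta> * \<delta> \<le> \<delta> / 2" using \<delta> by simp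
  have "prob ?B1 \<le> exp (- (2 ^ m / (4 * \<rho>)))" by (rule total_lower_tail[OF A0])
  also have "\<dots> \<le> exp (2 * ln \<delta>)"
    using m \<rho> unfolding lnd by (simp add: field_simps)
  also have "\<dots> = \<delta> * \<delta>" using \<delta> by (simp only: mult_2 exp_add exp_ln)
  finally have 1: "prob ?B1 \<le> \<delta> / 2" using \<delta>4 by simp
  have "prob ?B2 \<le> 8 * exp (- (4 * 2 ^ m / \<rho>))" unfolding ovl_def by (rule overload_tail[OF A0])
  also have "\<dots> \<le> 8 * exp (ln \<delta> * 5)"
  proof -
    have "- ln \<delta> \<ge> 0" using \<delta> by simp
    moreover have "8 * (- ln \<delta>) \<le> 2 ^ m / \<rho>" using m \<rho> unfolding lnd by (simp add: field_simps)
    ultimately show ?thesis by (simp add: field_simps)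
  qed
  also have "exp (ln \<delta> * 5) = \<delta> ^ 5"
    using \<delta> exp_of_nat_mult[of 5 "ln \<delta>"] by (simp add: mult.commute)
  also have "8 * \<delta> ^ 5 \<le> \<delta> / 2"
  proof -
    have "\<delta> ^ 4 \<le> (1/2) ^ 4" using \<delta> by (intro power_mono) auto
    then have "\<delta> * \<delta> ^ 4 \<le> \<delta> * (1/2) ^ 4" using \<delta> by (intro mult_left_mono) auto
    then show ?thesis by (simp add: power_one_over eval_nat_numeral)
  qed
  finally have 2: "prob ?B2 \<le> \<delta> / 2" .
  have "space N - (?B1 \<union> ?B2) \<subseteq> ?G"
  proof
    fix \<omega> assume \<omega>: "\<omega> \<in> space N - (?B1 \<union> ?B2)"
    have "(\<Sum>e\<in>E. a e * pruned E w a \<eta> (sampled m \<eta> (Z \<omega>)) e)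
        = ((\<Sum>e\<in>E. a e * sampled m \<eta> (Z \<omega>) e) - ovl (Z \<omega>)) / 64"
      unfolding ovl_def sum_subtractf[symmetric] sum_divide_distrib
      by (intro sum.cong refl) (auto simp: pruned_def)
    then show "\<omega> \<in> ?G" using \<omega> by auto
  qed
  then have "prob (space N - (?B1 \<union> ?B2)) \<le> prob ?G" using sets by (intro finite_measure_mono) auto
  moreover have "prob (space N - (?B1 \<union> ?B2)) = 1 - prob (?B1 \<union> ?B2)"
    using sets by (intro prob_compl) auto
  moreover have "prob (?B1 \<union> ?B2) \<le> prob ?B1 + prob ?B2"
    using sets by (intro measure_Un_le) auto
  ultimately show ?thesis using 1 2 by linarith
qed

end

section \<open>Parameters and running time\<close>

lemma ceillog2_le_ln:
  assumes "n > 0"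
  shows "real (ceillog2 n) \<le> 2 * ln (real n) + 1"
proof -
  have "log 2 (real n) \<le> 2 * ln (real n)"
    using assms ln2_ge_two_thirds mult_right_mono[of 1 "2 * ln 2" "ln (real n)"]
    by (simp add: log_def field_simps)
  then show ?thesis using ceillog2_less_log[OF assms] by linarith
qed

lemma lg_ge_1: "lg x \<ge> 1" and lg_ge_ln: "lg x \<ge> ln x"
  by (simp_all add: lg_def)

text \<open>The number of levels contains ln r; this is how its square is absorbed by a multiple of
  r.\<close>

lemma ln_square_le:
  assumes "x \<ge> (1::real)"
  shows "(ln x)\<^sup>2 \<le> 4 * x"
proof -
  have "ln x = 2 * ln (sqrt x)" using assms by (simp add: ln_sqrt)
  also have "\<dots> \<le> 2 * sqrt x" using assms ln_bound[of "sqrt x"] by simp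
  finally have "(ln x)\<^sup>2 \<le> (2 * sqrt x)\<^sup>2" using assms by (intro power_mono) auto
  then show ?thesis using assms by (simp add: power_mult_distrib)
qed

section \<open>Choice of the parameters\<close>

definition par_s :: "nat \<Rightarrow> nat \<Rightarrow> nat" where
  "par_s \<Delta> r = ceillog2 (r * \<Delta>)"

definition par_m :: "nat \<Rightarrow> real \<Rightarrow> nat" where
  "par_m r \<delta> = ceillog2 (nat \<lceil>8 * real r * ln (1/\<delta>)\<rceil>)"

text \<open>A square root suffices because the composed colouring has k^2 classes. The constant 27
  is the growth factor of a level, and \<open>m + 6\<close> is the number of levels.\<close>

definition par_k :: "nat \<Rightarrow> real \<Rightarrow> nat" where
  "par_k r \<delta> = nat \<lceil>sqrt (27 * real (par_m r \<delta> + 6))\<rceil>"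

definition par_j1 :: "nat \<Rightarrow> nat \<Rightarrow> nat \<Rightarrow> nat" where
  "par_j1 d \<Delta> r = d * ceillog2 (r + \<Delta>) + 1"

definition par_j2 :: "nat \<Rightarrow> nat \<Rightarrow> nat \<Rightarrow> real \<Rightarrow> nat" where
  "par_j2 d \<Delta> r \<delta> = ceillog2 (par_k r \<delta> * par_j1 d \<Delta> r * (2 * par_k r \<delta> * par_j1 d \<Delta> r)) + 1"

lemma par_s: "real (r * \<Delta>) \<le> 2 ^ par_s \<Delta> r"
  using le_two_power_ceillog2[of "r * \<Delta>"] of_nat_mono[of "r * \<Delta>" "2 ^ ceillog2 (r * \<Delta>)", where 'a=real]
  by (simp add: par_s_def)

lemma par_m: "8 * real r * ln (1/\<delta>) \<le> 2 ^ par_m r \<delta>"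
proof -
  let ?x = "8 * real r * ln (1/\<delta>)"
  have "?x \<le> real (nat \<lceil>?x\<rceil>)" by (rule of_nat_ceiling)
  also have "\<dots> \<le> real (2 ^ par_m r \<delta>)"
    unfolding par_m_def of_nat_le_iff by (rule le_two_power_ceillog2)
  finally show ?thesis by simp
qed

lemma par_k: "par_k r \<delta> \<ge> 1" "27 * (par_m r \<delta> + 6) \<le> (par_k r \<delta>)\<^sup>2"
  "(real (par_k r \<delta>))\<^sup>2 \<le> 56 * real (par_m r \<delta> + 6)"
proof -
  define x where "x = sqrt (27 * real (par_m r \<delta> + 6))"
  have x: "x \<ge> 0" "x\<^sup>2 = 27 * real (par_m r \<delta> + 6)" by (simp_all add: x_def)
  have k: "par_k r \<delta> = nat \<lceil>x\<rceil>" by (simp add: par_k_def x_def)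
  have lb: "x \<le> real (par_k r \<delta>)" unfolding k by (rule of_nat_ceiling)
  have ub: "real (par_k r \<delta>) \<le> x + 1" unfolding k using x(1) by linarith
  have "x\<^sup>2 \<le> (real (par_k r \<delta>))\<^sup>2" using lb x(1) by (intro power_mono) auto
  then have "real (27 * (par_m r \<delta> + 6)) \<le> real ((par_k r \<delta>)\<^sup>2)" using x(2) by simp
  then show "27 * (par_m r \<delta> + 6) \<le> (par_k r \<delta>)\<^sup>2" unfolding of_nat_le_iff .
  then show "par_k r \<delta> \<ge> 1" by (cases "par_k r \<delta>") auto
  have "(real (par_k r \<delta>))\<^sup>2 \<le> (x + 1)\<^sup>2" using ub by (intro power_mono) auto
  also have "\<dots> \<le> 2 * x\<^sup>2 + 2"
    using zero_le_power2[of "x - 1"] by (simp add: power2_eq_square algebra_simps)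
  finally show "(real (par_k r \<delta>))\<^sup>2 \<le> 56 * real (par_m r \<delta> + 6)" unfolding x(2) by simp
qed

lemma par_j1: "par_j1 d \<Delta> r \<ge> 1" "(r + \<Delta>) ^ d \<le> 2 ^ par_j1 d \<Delta> r"
proof -
  have "(r + \<Delta>) ^ d \<le> (2 ^ ceillog2 (r + \<Delta>)) ^ d" by (intro power_mono le_two_power_ceillog2) simp
  also have "\<dots> = 2 ^ (d * ceillog2 (r + \<Delta>))" by (simp add: power_mult[symmetric] mult.commute)
  also have "\<dots> \<le> 2 ^ par_j1 d \<Delta> r" by (simp add: par_j1_def)
  finally show "(r + \<Delta>) ^ d \<le> 2 ^ par_j1 d \<Delta> r" .
qed (simp add: par_j1_def)

lemma par_j2: "par_j2 d \<Delta> r \<delta> \<ge> 1"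
  "par_k r \<delta> * par_j1 d \<Delta> r * (2 * par_k r \<delta> * par_j1 d \<Delta> r) \<le> 2 ^ par_j2 d \<Delta> r \<delta>"
proof -
  let ?n = "par_k r \<delta> * par_j1 d \<Delta> r * (2 * par_k r \<delta> * par_j1 d \<Delta> r)"
  have "?n \<le> 2 ^ ceillog2 ?n" by (rule le_two_power_ceillog2)
  also have "\<dots> \<le> 2 ^ par_j2 d \<Delta> r \<delta>" by (simp add: par_j2_def)
  finally show "?n \<le> 2 ^ par_j2 d \<Delta> r \<delta>" .
qed (simp add: par_j2_def)

definition run_time :: "nat \<Rightarrow> nat \<Rightarrow> nat \<Rightarrow> real \<Rightarrow> nat" where
  "run_time d \<Delta> r \<delta> = matching_params.time (par_s \<Delta> r) (par_m r \<delta>) (par_k r \<delta>) (par_j2 d \<Delta> r \<delta>)"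

lemma run_time_bound:
  "\<exists>C. \<forall>\<Delta> r \<delta>. 2 \<le> r \<longrightarrow> 0 < \<delta> \<longrightarrow> \<delta> < 1/2 \<longrightarrow>
     real (run_time d \<Delta> r \<delta>) \<le> C * round_expr \<Delta> r \<delta> * (lg (round_expr \<Delta> r \<delta>)) ^ 2"
proof -
  \<comment> \<open>\<open>B\<close> collects the constants in the bound on the palette after the
    first reduction; \<open>B\<close> and \<open>C\<close> depend on \<open>d\<close> only.\<close>
  define B where "B = 50400 * (3 * real d + 1)\<^sup>2"
  define C where "C = 14 + 453600 * (2 * ln B + 8)\<^sup>2"
  have B1: "B \<ge> 1"
  proof -
    have "1 \<le> (3 * real d + 1)\<^sup>2" by (intro one_le_power) simp
    then show ?thesis unfolding B_def by linarith
  qed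
  have "real (run_time d \<Delta> r \<delta>) \<le> C * round_expr \<Delta> r \<delta> * (lg (round_expr \<Delta> r \<delta>)) ^ 2"
    if r: "2 \<le> r" and \<delta>: "0 < \<delta>" "\<delta> < 1/2" for \<Delta> r \<delta>
  proof -
    define l where "l = lg (lg (1/\<delta>))"
    define R where "R = round_expr \<Delta> r \<delta>"
    define L where "L = lg R"
    define s m k j1 j2 where "s = par_s \<Delta> r" and "m = par_m r \<delta>" and "k = par_k r \<delta>"
      and "j1 = par_j1 d \<Delta> r" and "j2 = par_j2 d \<Delta> r \<delta>"
    have l: "l \<ge> 1" and L: "L \<ge> 1" "L \<ge> ln R" by (simp_all add: l_def L_def lg_ge_1 lg_ge_ln)
    have R_eq: "R = lg (real \<Delta>) + real r * l + l\<^sup>2" by (simp add: R_def round_expr_def l_def)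
    have rl: "real r \<le> real r * l" using l by (simp add: mult_le_cancel_left1)
    have lgD: "lg (real \<Delta>) \<ge> 1" by (rule lg_ge_1)
    have R: "R \<ge> lg (real \<Delta>) + real r" "R \<ge> real r + l\<^sup>2" "R \<ge> 1"
      using rl lgD r zero_le_power2[of l] unfolding R_eq by linarith+
    have lnr: "0 \<le> ln (real r)" "ln (real r) \<le> real r" using r ln_bound[of "real r"] by auto
    have s: "real s \<le> 5 * R"
    proof (cases "\<Delta> = 0")
      case False
      have "real s \<le> 2 * ln (real (r * \<Delta>)) + 1"
        unfolding s_def par_s_def using False r by (intro ceillog2_le_ln) simp
      also have "ln (real (r * \<Delta>)) = ln (real r) + ln (real \<Delta>)" using False r by (simp add: ln_mult)
      finally have "real s \<le> 2 * (ln (real r) + ln (real \<Delta>)) + 1" .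
      moreover have "ln (real r) + ln (real \<Delta>) \<le> R"
        using add_mono[OF lnr(2) lg_ge_ln[of "real \<Delta>"]] R(1) by simp
      ultimately show ?thesis using R(3) by simp
    qed (use R in \<open>simp add: s_def par_s_def\<close>)
    have m: "real (m + 6) \<le> 2 * ln (real r) + 15 * l"
    proof -
      have ln\<delta>: "ln (1/\<delta>) > 0" using \<delta> by simp
      define x where "x = 8 * real r * ln (1/\<delta>)"
      define n where "n = nat \<lceil>x\<rceil>"
      have x0: "x > 0" using ln\<delta> r by (simp add: x_def)
      then have n0: "n > 0" by (simp add: n_def)
      have "real n \<le> x + 1" unfolding n_def using x0 by linarith
      also have "\<dots> \<le> 8 * (real r * lg (1/\<delta>)) + 1 * (real r * lg (1/\<delta>))"
      proof (intro add_mono)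
        have "real r * ln (1/\<delta>) \<le> real r * lg (1/\<delta>)" using lg_ge_ln by (intro mult_left_mono) auto
        then show "x \<le> 8 * (real r * lg (1/\<delta>))" by (simp add: x_def)
        show "1 \<le> 1 * (real r * lg (1/\<delta>))" using mult_mono[of 1 "real r" 1 "lg (1/\<delta>)"] lg_ge_1 r by simp
      qed
      finally have "real n \<le> 9 * (real r * lg (1/\<delta>))" by simp
      then have "ln (real n) \<le> ln (9 * (real r * lg (1/\<delta>)))" using n0 by simp
      also have "\<dots> = ln 9 + (ln (real r) + ln (lg (1/\<delta>)))"
        using r lg_ge_1[of "1/\<delta>"] by (simp add: ln_mult)
      also have "ln 9 \<le> (3::real)"
      proof -
        have "exp (3::real) \<ge> (1 + 3 / real 30) ^ 30" by (rule exp_ge_one_plus_x_over_n_power_n) auto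
        moreover have "(1 + 3 / real 30) ^ 30 \<ge> (9::real)" by (simp add: eval_nat_numeral)
        ultimately have "(9::real) \<le> exp 3" by linarith
        then show ?thesis by (simp add: ln_ge_iff[symmetric] ln_le_cancel_iff[symmetric] del: ln_le_cancel_iff)
      qed
      finally have "ln (real n) \<le> 3 + ln (real r) + l" using lg_ge_ln[of "lg (1/\<delta>)"] by (simp add: l_def)
      moreover have "real m \<le> 2 * ln (real n) + 1"
        unfolding m_def par_m_def using ceillog2_le_ln[OF n0] by (simp add: n_def x_def)
      ultimately show ?thesis using l by simp
    qed
    \<comment> \<open>The number of levels may enter squared: (ln r)^2 is bounded by a multiple of
      r, and l^2 is itself a summand of \<open>R\<close>.\<close>
    have m2: "(real (m + 6))\<^sup>2 \<le> 450 * R"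
    proof -
      have "(real (m + 6))\<^sup>2 \<le> (2 * ln (real r) + 15 * l)\<^sup>2" using m by (intro power_mono) auto
      also have "\<dots> \<le> 8 * (ln (real r))\<^sup>2 + 450 * l\<^sup>2"
        using zero_le_power2[of "2 * ln (real r) - 15 * l"] by (simp add: power2_eq_square algebra_simps)
      also have "(ln (real r))\<^sup>2 \<le> 4 * real r" using r by (intro ln_square_le) simp
      finally show ?thesis using R(2) by simp
    qed
    have k1: "k \<ge> 1" and k2: "(real k)\<^sup>2 \<le> 56 * real (m + 6)"
      unfolding k_def m_def by (rule par_k)+
    have kR: "(real k)\<^sup>2 \<le> 25200 * R"
    proof -
      have "real (m + 6) \<le> (real (m + 6))\<^sup>2" by (simp add: power2_eq_square)
      from order_trans[OF this m2] show ?thesis using k2 by simp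
    qed
    have j1: "real j1 \<le> (3 * real d + 1) * R"
    proof -
      have "real (r + \<Delta>) \<le> exp (real r + lg (real \<Delta>))"
      proof (cases "\<Delta> = 0")
        case True
        have "real r \<le> exp (real r)" using exp_ge_add_one_self[of "real r"] by linarith
        also have "\<dots> \<le> exp (real r + lg (real \<Delta>))" using lgD by simp
        finally show ?thesis using True by simp
      next
        case False
        have "real (r + \<Delta>) \<le> (1 + real r) * real \<Delta>"
          using False mult_left_mono[of 1 "real \<Delta>" "real r"] by (simp add: algebra_simps)
        also have "\<dots> \<le> exp (real r) * exp (ln (real \<Delta>))"
          using False exp_ge_add_one_self[of "real r"] by (intro mult_mono) auto
        also have "\<dots> \<le> exp (real r + lg (real \<Delta>))"
          using lg_ge_ln[of "real \<Delta>"] by (simp add: exp_add)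
        finally show ?thesis .
      qed
      also have "\<dots> \<le> exp R" using R(1) by simp
      finally have "ln (real (r + \<Delta>)) \<le> ln (exp R)" using r by (subst ln_le_cancel_iff) auto
      then have "ln (real (r + \<Delta>)) \<le> R" by simp
      then have c: "real (ceillog2 (r + \<Delta>)) \<le> 3 * R" using ceillog2_le_ln[of "r + \<Delta>"] r R(3) by simp
      have "real d * real (ceillog2 (r + \<Delta>)) \<le> real d * (3 * R)" using c by (rule mult_left_mono) simp
      then show ?thesis using R(3) by (simp add: j1_def par_j1_def algebra_simps)
    qed
    \<comment> \<open>\<open>j2\<close> is a logarithm of 2 k^2 j1^2, where k^2 is linear and j1^2
      quadratic in \<open>R\<close>; hence the cubic bound and only a logarithm of \<open>R\<close>
      in the result.\<close>
    have j2: "real j2 \<le> (2 * ln B + 8) * L"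
    proof -
      define n where "n = k * j1 * (2 * k * j1)"
      have j11: "j1 \<ge> 1" unfolding j1_def by (rule par_j1)
      have n0: "n > 0" using k1 j11 by (simp add: n_def)
      have "(real j1)\<^sup>2 \<le> ((3 * real d + 1) * R)\<^sup>2" using j1 by (intro power_mono) auto
      then have "2 * ((real k)\<^sup>2 * (real j1)\<^sup>2) \<le> 2 * ((25200 * R) * ((3 * real d + 1) * R)\<^sup>2)"
        using kR R(3) by (intro mult_left_mono mult_mono) auto
      also have "\<dots> = B * R ^ 3" by (simp add: B_def power_mult_distrib power2_eq_square power3_eq_cube)
      finally have "real n \<le> B * R ^ 3" by (simp add: n_def power2_eq_square mult_ac)
      then have "ln (real n) \<le> ln (B * R ^ 3)" using n0 by simp
      also have "\<dots> = ln B + 3 * ln R" using B1 R(3) by (simp add: ln_mult ln_realpow)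
      finally have "ln (real n) \<le> ln B + 3 * ln R" .
      moreover have "real j2 \<le> 2 * ln (real n) + 2"
        unfolding j2_def par_j2_def using ceillog2_le_ln[OF n0] by (simp add: n_def k_def j1_def)
      ultimately have "real j2 \<le> 2 * ln B + 8 * L" using L by simp
      also have "2 * ln B \<le> 2 * ln B * L" using L(1) B1 by (simp add: mult_le_cancel_left1)
      finally show ?thesis by (simp add: algebra_simps)
    qed
    have j21: "j2 \<ge> 1" unfolding j2_def by (rule par_j2)
    have "real (run_time d \<Delta> r \<delta>) = 2 * real s + 4 + real (m + 6) * (8 + 8 * ((real k)\<^sup>2 * (real j2)\<^sup>2) + 2 * (real k)\<^sup>2)"
      by (simp add: run_time_def matching_params.time_def s_def m_def k_def j2_def power2_eq_square algebra_simps)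
    also have "\<dots> \<le> 2 * real s + 4 + real (m + 6) * (18 * ((real k)\<^sup>2 * (real j2)\<^sup>2))"
    proof -
      have "1 \<le> (real k)\<^sup>2" "1 \<le> (real j2)\<^sup>2" using k1 j21 by auto
      then have "(real k)\<^sup>2 \<le> (real k)\<^sup>2 * (real j2)\<^sup>2" "1 \<le> (real k)\<^sup>2 * (real j2)\<^sup>2"
        using mult_mono[of 1 "(real k)\<^sup>2" 1 "(real j2)\<^sup>2"] by (auto simp: mult_le_cancel_left1)
      then have "8 + 8 * ((real k)\<^sup>2 * (real j2)\<^sup>2) + 2 * (real k)\<^sup>2 \<le> 18 * ((real k)\<^sup>2 * (real j2)\<^sup>2)" by linarith
      then show ?thesis by (intro add_left_mono mult_left_mono) auto
    qed
    \<comment> \<open>As k^2 is linear in the number of levels, levels times k^2 is only quadratic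
      in it.\<close>
    also have "real (m + 6) * (18 * ((real k)\<^sup>2 * (real j2)\<^sup>2)) \<le> real (m + 6) * (18 * ((56 * real (m + 6)) * (real j2)\<^sup>2))"
      using k2 by (intro mult_left_mono mult_right_mono) auto
    also have "\<dots> = 1008 * ((real (m + 6))\<^sup>2 * (real j2)\<^sup>2)" by (simp add: power2_eq_square)
    also have "(real (m + 6))\<^sup>2 * (real j2)\<^sup>2 \<le> (450 * R) * ((2 * ln B + 8) * L)\<^sup>2"
      using m2 j2 R(3) by (intro mult_mono power_mono) auto
    also have "1008 * ((450 * R) * ((2 * ln B + 8) * L)\<^sup>2) = 453600 * (2 * ln B + 8)\<^sup>2 * (R * L\<^sup>2)"
      by (simp add: power_mult_distrib)
    finally have "real (run_time d \<Delta> r \<delta>) \<le> 2 * real s + 4 + 453600 * (2 * ln B + 8)\<^sup>2 * (R * L\<^sup>2)" by simp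
    moreover have "2 * real s + 4 \<le> 14 * (R * L\<^sup>2)"
    proof -
      have "1 \<le> L\<^sup>2" using L(1) by (rule one_le_power)
      then have "R \<le> R * L\<^sup>2" using R(3) by (simp add: mult_le_cancel_left1)
      then show ?thesis using s R(3) by linarith
    qed
    ultimately have "real (run_time d \<Delta> r \<delta>) \<le> C * (R * L\<^sup>2)" by (simp add: C_def distrib_right)
    then show ?thesis by (simp add: R_def L_def mult.assoc)
  qed
  then show ?thesis by blast
qed

section \<open>The main theorem\<close>

text \<open>The sum at each vertex of \<open>e\<close> contains \<open>F e\<close> once, and
  \<open>e\<close> has at least one vertex.\<close>

lemma overlap_sum_le:
  assumes wf: "wf_inst I" and e: "e \<in> edges I" and F: "\<And>f. f \<in> edges I \<Longrightarrow> F f \<ge> 0"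
  shows "F e + (\<Sum>f\<in>edges I. overlap I e f * F f) \<le> (\<Sum>v\<in>ends I e. \<Sum>f\<in>edges_at I v. F f)"
proof -
  have fin: "finite (ends I e)" by (rule wf_instD(5)[OF wf e])
  obtain v where v: "v \<in> ends I e" using wf_instD(6)[OF wf e] by blast
  have "F e \<le> (\<Sum>v\<in>ends I e. F e)" by (rule member_le_sum[OF v]) (use F e fin in auto)
  moreover have "(\<Sum>f\<in>edges_at I v. F f) = F e + (\<Sum>f\<in>edges_at I v - {e}. F f)" if "v \<in> ends I e" for v
    using that e wf_instD(3)[OF wf] by (intro sum.remove) (auto simp: edges_at_def)
  ultimately show ?thesis
    unfolding sum_overlap[OF wf e] by (simp add: sum.distrib)
qed

section \<open>The algorithm on a fixed instance\<close>

locale bounded_inst =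
  fixes I :: inst and \<Delta> r d :: nat and \<delta> :: real
  assumes wf: "wf_inst I" and r: "2 \<le> r" and \<delta>: "0 < \<delta>" "\<delta> < 1/2"
    and deg: "\<And>v. v \<in> verts I \<Longrightarrow> hdeg (edges I) (ends I) v \<le> \<Delta>"
    and rank: "\<And>e. e \<in> edges I \<Longrightarrow> card (ends I e) \<le> r"
    and good: "good_coloring (verts I) (edges I) (ends I) ((r + \<Delta>) ^ d) (col I)"
    and wt_nonneg: "\<And>e. e \<in> edges I \<Longrightarrow> wt I e \<ge> 0"
begin

abbreviation "E \<equiv> edges I"
abbreviation "s \<equiv> par_s \<Delta> r"
abbreviation "m \<equiv> par_m r \<delta>"
abbreviation "k \<equiv> par_k r \<delta>"
abbreviation "j1 \<equiv> par_j1 d \<Delta> r"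
abbreviation "j2 \<equiv> par_j2 d \<Delta> r \<delta>"
abbreviation "\<phi> \<equiv> \<lambda>e. col I (Inr e)"
abbreviation "\<eta> \<equiv> halvings E (overlap I) (wt I) s"
abbreviation "A \<equiv> \<Sum>e\<in>E. wt I e * (1/2) ^ \<eta> e"

lemma finE: "finite E" by (rule wf_instD(2)[OF wf])

lemma overlap_sym: "overlap I e f = overlap I f e"
  by (simp add: overlap_def Int_commute)

lemma overlap_nonneg: "overlap I e f \<ge> 0"
  by (simp add: overlap_def)

lemma overlap_0_or_ge_1: "overlap I e f = 0 \<or> overlap I e f \<ge> 1"
  by (cases "card (ends I e \<inter> ends I f)") (auto simp: overlap_def)

lemma overlap_le_r: "e \<in> E \<Longrightarrow> overlap I e f \<le> real r"
  using card_mono[OF wf_instD(5)[OF wf], of e "ends I e \<inter> ends I f"] rank[of e]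
  by (auto simp: overlap_def)

lemma same_col_overlap:
  assumes e: "e \<in> E" and f: "f \<in> E" and eq: "\<phi> e = \<phi> f"
  shows "overlap I e f = 0"
proof (rule ccontr)
  assume n: "overlap I e f \<noteq> 0"
  then have ne: "e \<noteq> f" "ends I e \<inter> ends I f \<noteq> {}" by (auto simp: overlap_def split: if_splits)
  then obtain v where v: "v \<in> ends I e" "v \<in> ends I f" by blast
  then have "v \<in> verts I" using wf_instD(4)[OF wf e] by blast
  then have "\<exists>z\<in>inc_nodes (verts I) E. inc_adj (verts I) E (ends I) (Inr e) z \<and> inc_adj (verts I) E (ends I) z (Inr f)"
    using v e f by (intro bexI[of _ "Inl v"]) (auto simp: inc_adj_def inc_nodes_def)
  moreover have "Inr e \<in> inc_nodes (verts I) E" "Inr f \<in> inc_nodes (verts I) E"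
    using e f by (simp_all add: inc_nodes_def)
  ultimately show False using good ne(1) eq unfolding good_coloring_def by (metis sum.inject(2))
qed

lemma edges_at_sum_le: "v \<in> verts I \<Longrightarrow> (\<Sum>f\<in>edges_at I v. 1::real) \<le> real \<Delta>"
  using deg[of v] by (simp add: edges_at_def hdeg_def)

lemma overlap_total: "e \<in> E \<Longrightarrow> (\<Sum>f\<in>E. overlap I e f) \<le> 2 ^ s"
proof -
  assume e: "e \<in> E"
  have "(\<Sum>f\<in>E. overlap I e f) \<le> (\<Sum>v\<in>ends I e. \<Sum>f\<in>edges_at I v. 1)"
    using overlap_sum_le[OF wf e, of "\<lambda>_. 1"] by simp
  also have "\<dots> \<le> (\<Sum>v\<in>ends I e. real \<Delta>)"
    using wf_instD(4)[OF wf e] by (intro sum_mono edges_at_sum_le) auto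
  also have "\<dots> \<le> real r * real \<Delta>" using rank[OF e] by (simp add: mult_right_mono)
  also have "\<dots> \<le> 2 ^ s" using par_s[of r \<Delta>] by simp
  finally show ?thesis .
qed

sublocale doubling E "overlap I" "wt I" s
  by unfold_locales (auto intro: finE overlap_nonneg wt_nonneg overlap_total)

text \<open>Adding the constraints at the at most r vertices of \<open>f\<close> bounds
  \<open>h\<close> on the closed neighbourhood of \<open>f\<close>, as weak duality
  requires.\<close>

lemma frac_le:
  assumes h: "frac_matching (verts I) E (ends I) h"
  shows "(\<Sum>e\<in>E. wt I e * h e) \<le> real r * A"
proof (rule frac_bound)
  show h0: "h e \<ge> 0" if "e \<in> E" for e using h that by (simp add: frac_matching_def)
  fix f assume f: "f \<in> E"
  have "h f + (\<Sum>e\<in>E. overlap I f e * h e) \<le> (\<Sum>v\<in>ends I f. \<Sum>e\<in>edges_at I v. h e)"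
    by (rule overlap_sum_le[OF wf f h0])
  also have "\<dots> \<le> (\<Sum>v\<in>ends I f. 1)"
    using h wf_instD(4)[OF wf f] by (intro sum_mono) (auto simp: frac_matching_def edges_at_def)
  also have "\<dots> \<le> real r" using rank[OF f] by simp
  finally show "h f + (\<Sum>e\<in>E. overlap I f e * h e) \<le> real r" .
qed (rule overlap_sym)

lemma frac_opt_le: "frac_opt (verts I) E (ends I) (wt I) \<le> real r * A"
  unfolding frac_opt_def
proof (rule cSup_least)
  have "frac_matching (verts I) E (ends I) (\<lambda>_. 0)" by (simp add: frac_matching_def)
  then show "{\<Sum>e\<in>E. wt I e * h e |h. frac_matching (verts I) E (ends I) h} \<noteq> {}" by blast
qed (use frac_le in auto)

text \<open>A single edge is a fractional matching. This limits its influence on the total, as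
  needed for concentration.\<close>

lemma wt_le:
  assumes e: "e \<in> E"
  shows "wt I e \<le> real r * A"
proof -
  have "frac_matching (verts I) E (ends I) (\<lambda>f. of_bool (f = e))"
    by (auto simp: frac_matching_def of_bool_def finE sum.delta)
  moreover have "(\<Sum>f\<in>E. wt I f * of_bool (f = e)) = wt I e"
    using e finE by (simp add: of_bool_def if_distrib[of "(*) _"] sum.delta cong: if_cong)
  ultimately show ?thesis using frac_le[of "\<lambda>f. of_bool (f = e)"] by simp
qed

sublocale conflict_weights E "weight_overlap I" k j1 j2 \<phi>
proof
  fix e f assume E: "e \<in> E" "f \<in> E"
  show "weight_overlap I e f \<ge> 0"
    using wt_nonneg E overlap_nonneg by (simp add: weight_overlap_def)
  show "weight_overlap I e f = weight_overlap I f e"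
    by (simp add: weight_overlap_def overlap_sym min.commute)
  show "\<phi> e = \<phi> f \<Longrightarrow> weight_overlap I e f = 0"
    using same_col_overlap[OF E] by (simp add: weight_overlap_def)
next
  fix e assume "e \<in> E"
  then have "\<phi> e < (r + \<Delta>) ^ d" using good by (auto simp: good_coloring_def inc_nodes_def)
  then show "\<phi> e < 2 ^ j1" using par_j1(2)[of r \<Delta> d] by linarith
qed (use par_k(1)[of r \<delta>] par_j1(1)[of d \<Delta> r] par_j2[where d=d and \<Delta>=\<Delta> and r=r and \<delta>=\<delta>] in auto)

sublocale sampled_weights "verts I" E "wt I" "weight_overlap I" \<eta> m "real r" \<delta> A
proof
  fix e assume e: "e \<in> E"
  show "weight_overlap I e e = 0" by (simp add: weight_overlap_def overlap_def)
  show "late_sum E (weight_overlap I) \<eta> (\<lambda>f. (1/2) ^ \<eta> f) e \<le> 2 * wt I e"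
    unfolding late_sum_def weight_overlap_def by (rule late_load[OF e])
  fix f assume f: "f \<in> E"
  show "weight_overlap I e f \<le> real r * wt I e"
    unfolding weight_overlap_def using overlap_le_r[OF e] wt_nonneg[OF e] wt_nonneg[OF f]
    by (intro mult_mono) auto
qed (use r \<delta> in \<open>auto simp: wf_instD(1)[OF wf] finE wt_nonneg w_nonneg par_m wt_le\<close>)

text \<open>The output as a function of the surviving set alone, which isolates the randomness. The
  matching property holds for every set \<open>S\<close>, hence surely and not just with high
  probability.\<close>

definition selection :: "nat set \<Rightarrow> nat set" where
  "selection S = {e \<in> E. unbeaten E (wt I) (overlap I) \<phi>
     (rounding E (wt I) (weight_overlap I) k j1 j2 \<phi> (m + 6)
       (pruned E (weight_overlap I) (wt I) \<eta> (sampled m \<eta> S)) (m + 6)) e}"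

lemma selection_matching: "is_matching E (ends I) (selection S)"
  unfolding is_matching_def
proof (intro conjI ballI impI)
  fix e f assume "e \<in> selection S" "f \<in> selection S" and ne: "e \<noteq> f"
  then have "overlap I e f = 0"
    unfolding selection_def
    by (intro unbeaten_independent[of E "overlap I" \<phi>, OF finE overlap_nonneg overlap_sym same_col_overlap]) auto
  moreover have "finite (ends I e)"
    using wf_instD(5)[OF wf] \<open>e \<in> selection S\<close> by (simp add: selection_def)
  ultimately show "ends I e \<inter> ends I f = {}" using ne by (simp add: overlap_def)
qed (auto simp: selection_def)

text \<open>Three times the quadratic form is at most 3/8 of the total, so at least 5/8 of the total
  remains.\<close>

lemma selection_weight:
  "(\<Sum>e\<in>E. wt I e * pruned E (weight_overlap I) (wt I) \<eta> (sampled m \<eta> S) e) / 2 \<le> (\<Sum>e\<in>selection S. wt I e)"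
proof -
  define x where "x = pruned E (weight_overlap I) (wt I) \<eta> (sampled m \<eta> S)"
  define y where "y = rounding E (wt I) (weight_overlap I) k j1 j2 \<phi> (m + 6) x (m + 6)"
  have q: "8 * quad E (weight_overlap I) x \<le> (\<Sum>e\<in>E. wt I e * x e)"
    unfolding x_def by (rule quad_pruned) (auto simp: w_nonneg w_sym sampled_def)
  have x0: "(\<Sum>e\<in>E. wt I e * x e) \<ge> 0"
    using wt_nonneg by (intro sum_nonneg) (auto simp: x_def pruned_def sampled_def)
  have lev: "x e = 0 \<or> (\<exists>j\<le>m + 6. x e = (1/2) ^ j)" for e
    unfolding x_def by (rule pruned_levels) simp
  have y: "y e = 0 \<or> y e = 1" if "e \<in> E" for e
    unfolding y_def using lev par_k(2) that by (intro rounding(1)) auto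
  have "(\<Sum>e\<in>E. wt I e * x e) - 3 * quad E (weight_overlap I) x
      \<le> (\<Sum>e\<in>E. wt I e * y e) - quad E (weight_overlap I) y"
    unfolding y_def using lev par_k(2) by (intro rounding(2)) auto
  also have "\<dots> \<le> (\<Sum>e\<in>{e\<in>E. unbeaten E (wt I) (overlap I) \<phi> y e}. wt I e)"
    unfolding weight_overlap_def[abs_def]
    by (rule unbeaten_weight[OF finE overlap_0_or_ge_1 overlap_sym wt_nonneg y])
  finally show ?thesis
    using q x0 unfolding selection_def x_def[symmetric] y_def[symmetric] by linarith
qed

text \<open>The constant is 1/512 from sampling and pruning times 1/2 from rounding.\<close>

lemma selection_prob:
  "1 - \<delta> \<le> measure (rand_M (verts I) E) {\<omega> \<in> space (rand_M (verts I) E).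
     1/1024 * frac_opt (verts I) E (ends I) (wt I) / real r \<le> (\<Sum>e\<in>selection (Z \<omega>). wt I e)}"
proof -
  let ?G = "{\<omega>\<in>space N. A / 512 \<le> (\<Sum>e\<in>E. wt I e * pruned E (weight_overlap I) (wt I) \<eta> (sampled m \<eta> (Z \<omega>)) e)}"
  have "1 - \<delta> \<le> prob ?G" by (rule pruned_weight_prob)
  also have "\<dots> \<le> prob {\<omega> \<in> space N. 1/1024 * frac_opt (verts I) E (ends I) (wt I) / real r
      \<le> (\<Sum>e\<in>selection (Z \<omega>). wt I e)}"
  proof (rule finite_measure_mono)
    show "{\<omega> \<in> space N. 1/1024 * frac_opt (verts I) E (ends I) (wt I) / real r
      \<le> (\<Sum>e\<in>selection (Z \<omega>). wt I e)} \<in> events" by (rule survivors_sets)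
    have le: "frac_opt (verts I) E (ends I) (wt I) / real r \<le> A"
      using frac_opt_le r by (simp add: field_simps)
    show "?G \<subseteq> {\<omega> \<in> space N. 1/1024 * frac_opt (verts I) E (ends I) (wt I) / real r
      \<le> (\<Sum>e\<in>selection (Z \<omega>). wt I e)}"
    proof
      fix \<omega> assume "\<omega> \<in> ?G"
      then show "\<omega> \<in> {\<omega> \<in> space N. 1/1024 * frac_opt (verts I) E (ends I) (wt I) / real r
          \<le> (\<Sum>e\<in>selection (Z \<omega>). wt I e)}"
        using le selection_weight[of "Z \<omega>"] unfolding times_divide_eq_right[symmetric] by auto
    qed
  qed
  finally show ?thesis .
qed

text \<open>Replacing the random bits of the instance changes nothing but the surviving set.\<close>

lemma chosen_eq_selection:
  "{e \<in> E. matching_params.chosen s m k j1 j2 (I\<lparr>rnd := \<omega>\<rparr>) e} = selection (Z \<omega>)"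
proof -
  have ov: "overlap (I\<lparr>rnd := \<omega>\<rparr>) = overlap I" by (simp add: overlap_def fun_eq_iff)
  have wov: "weight_overlap (I\<lparr>rnd := \<omega>\<rparr>) = weight_overlap I"
    by (simp add: weight_overlap_def ov fun_eq_iff)
  have ex: "matching_params.exponent s (I\<lparr>rnd := \<omega>\<rparr>) = \<eta>"
    by (simp add: matching_params.exponent_def ov)
  have "{e \<in> E. matching_params.survives s m (I\<lparr>rnd := \<omega>\<rparr>) e} = Z \<omega>"
    by (simp add: matching_params.survives_def ex survivors_def all_heads_def)
  then show ?thesis
    by (simp add: selection_def matching_params.chosen_def matching_params.rounded_def
        matching_params.start_def matching_params.edge_col_def[abs_def] ov wov ex)
qed

end

theorem theorem1p2:
  "\<exists>c::real. c > 0 \<and>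
    (\<forall>d::nat. \<exists>(T :: nat \<Rightarrow> nat \<Rightarrow> nat \<Rightarrow> real \<Rightarrow> nat)
                (D :: nat \<Rightarrow> nat \<Rightarrow> nat \<Rightarrow> real \<Rightarrow> view \<Rightarrow> bool).
      (\<exists>(C::real) (k::nat). \<forall>n \<Delta> r \<delta>. 2 \<le> r \<longrightarrow> 0 < \<delta> \<longrightarrow> \<delta> < 1/2 \<longrightarrow>
          real (T n \<Delta> r \<delta>) \<le> C * round_expr \<Delta> r \<delta> * (lg (round_expr \<Delta> r \<delta>)) ^ k) \<and>
      (\<forall>n \<Delta> r \<delta> V E ends a col.
          2 \<le> r \<longrightarrow> 0 < \<delta> \<longrightarrow> \<delta> < 1/2 \<longrightarrow>
          hypergraph V E ends \<longrightarrow> card V \<le> n \<longrightarrow>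
          (\<forall>v\<in>V. hdeg E ends v \<le> \<Delta>) \<longrightarrow> (\<forall>e\<in>E. card (ends e) \<le> r) \<longrightarrow>
          good_coloring V E ends ((r + \<Delta>) ^ d) col \<longrightarrow>
          (\<forall>e\<in>E. 0 \<le> a e) \<longrightarrow>
          (\<forall>\<omega>\<in>space (rand_M V E).
              is_matching E ends (alg_output V E ends a col \<omega> (T n \<Delta> r \<delta>) (D n \<Delta> r \<delta>))) \<and>
          measure (rand_M V E)
            {\<omega> \<in> space (rand_M V E).
               (\<Sum>e\<in>alg_output V E ends a col \<omega> (T n \<Delta> r \<delta>) (D n \<Delta> r \<delta>). a e)
                 \<ge> c * frac_opt V E ends a / real r} \<ge> 1 - \<delta>))"
proof (intro exI[of _ "1/1024 :: real"] conjI allI)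
  fix d :: nat
  let ?chosen = "\<lambda>\<Delta> r \<delta>. matching_params.chosen (par_s \<Delta> r) (par_m r \<delta>) (par_k r \<delta>) (par_j1 d \<Delta> r) (par_j2 d \<Delta> r \<delta>)"
  \<comment> \<open>The rule \<open>D\<close> is obtained from the parameters before any instance is
    fixed; it must not depend on the instance.\<close>
  have "\<forall>\<Delta> r \<delta>. \<exists>g. \<forall>I e. wf_inst I \<longrightarrow> e \<in> edges I \<longrightarrow>
      ?chosen \<Delta> r \<delta> I e = g (inst_view I (run_time d \<Delta> r \<delta>) (Inr e))"
    using matching_params.edge_local_chosen unfolding edge_local_def run_time_def by blast
  then obtain D where D: "\<And>\<Delta> r \<delta> I e. wf_inst I \<Longrightarrow> e \<in> edges I \<Longrightarrow>
      ?chosen \<Delta> r \<delta> I e = D \<Delta> r \<delta> (inst_view I (run_time d \<Delta> r \<delta>) (Inr e))" by metis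
  obtain C where C: "\<And>\<Delta> r \<delta>. 2 \<le> r \<Longrightarrow> 0 < \<delta> \<Longrightarrow> \<delta> < 1/2 \<Longrightarrow>
      real (run_time d \<Delta> r \<delta>) \<le> C * round_expr \<Delta> r \<delta> * (lg (round_expr \<Delta> r \<delta>)) ^ 2"
    using run_time_bound by blast
  have main: "(\<forall>\<omega>\<in>space (rand_M V E).
              is_matching E nd (alg_output V E nd a cl \<omega> (run_time d \<Delta> r \<delta>) (D \<Delta> r \<delta>))) \<and>
          measure (rand_M V E)
            {\<omega> \<in> space (rand_M V E).
               (\<Sum>e\<in>alg_output V E nd a cl \<omega> (run_time d \<Delta> r \<delta>) (D \<Delta> r \<delta>). a e)
                 \<ge> 1/1024 * frac_opt V E nd a / real r} \<ge> 1 - \<delta>"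
    if "2 \<le> r" "0 < \<delta>" "\<delta> < 1/2" "hypergraph V E nd" "\<forall>v\<in>V. hdeg E nd v \<le> \<Delta>"
      "\<forall>e\<in>E. card (nd e) \<le> r" "good_coloring V E nd ((r + \<Delta>) ^ d) cl" "\<forall>e\<in>E. 0 \<le> a e"
    for \<Delta> r \<delta> V E nd a cl
  proof -
    \<comment> \<open>The locale assumptions and \<open>selection\<close> do not refer to the random
      bits, so their value is arbitrary here; \<open>\<omega>\<close> is substituted below.\<close>
    define I where "I = \<lparr>verts = V, edges = E, ends = nd, wt = a, col = cl, rnd = undefined\<rparr>"
    interpret bounded_inst I \<Delta> r d \<delta>
      by unfold_locales (use that in \<open>simp_all add: I_def wf_inst_def\<close>)
    have out: "alg_output V E nd a cl \<omega> (run_time d \<Delta> r \<delta>) (D \<Delta> r \<delta>) = selection (survivors (edges I) (\<lambda>e. \<eta> e - m) \<omega>)" for \<omega>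
    proof -
      have "wf_inst (I\<lparr>rnd := \<omega>\<rparr>)" using wf by (simp add: wf_inst_def)
      then have "{e \<in> E. ?chosen \<Delta> r \<delta> (I\<lparr>rnd := \<omega>\<rparr>) e}
          = alg_output V E nd a cl \<omega> (run_time d \<Delta> r \<delta>) (D \<Delta> r \<delta>)"
        unfolding alg_output_def using D[of "I\<lparr>rnd := \<omega>\<rparr>"]
        by (auto simp: I_def inst_view_def)
      then show ?thesis using chosen_eq_selection[of \<omega>] by (simp add: I_def)
    qed
    show ?thesis
      unfolding out using selection_matching selection_prob by (simp add: I_def)
  qed
  show "\<exists>(T :: nat \<Rightarrow> nat \<Rightarrow> nat \<Rightarrow> real \<Rightarrow> nat) (D :: nat \<Rightarrow> nat \<Rightarrow> nat \<Rightarrow> real \<Rightarrow> view \<Rightarrow> bool).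
      (\<exists>(C::real) (k::nat). \<forall>n \<Delta> r \<delta>. 2 \<le> r \<longrightarrow> 0 < \<delta> \<longrightarrow> \<delta> < 1/2 \<longrightarrow>
          real (T n \<Delta> r \<delta>) \<le> C * round_expr \<Delta> r \<delta> * (lg (round_expr \<Delta> r \<delta>)) ^ k) \<and>
      (\<forall>n \<Delta> r \<delta> V E ends a col.
          2 \<le> r \<longrightarrow> 0 < \<delta> \<longrightarrow> \<delta> < 1/2 \<longrightarrow>
          hypergraph V E ends \<longrightarrow> card V \<le> n \<longrightarrow>
          (\<forall>v\<in>V. hdeg E ends v \<le> \<Delta>) \<longrightarrow> (\<forall>e\<in>E. card (ends e) \<le> r) \<longrightarrow>
          good_coloring V E ends ((r + \<Delta>) ^ d) col \<longrightarrow>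
          (\<forall>e\<in>E. 0 \<le> a e) \<longrightarrow>
          (\<forall>\<omega>\<in>space (rand_M V E).
              is_matching E ends (alg_output V E ends a col \<omega> (T n \<Delta> r \<delta>) (D n \<Delta> r \<delta>))) \<and>
          measure (rand_M V E)
            {\<omega> \<in> space (rand_M V E).
               (\<Sum>e\<in>alg_output V E ends a col \<omega> (T n \<Delta> r \<delta>) (D n \<Delta> r \<delta>). a e)
                 \<ge> 1/1024 * frac_opt V E ends a / real r} \<ge> 1 - \<delta>)"
    using C main by (intro exI[of _ "\<lambda>n. run_time d"] exI[of _ "\<lambda>n. D"] exI[of _ C] exI[of _ 2] conjI allI impI) blast+
qed simp

end
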